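(* Let $m, n \geq 1$ be integers and let $D$ be a domain in $\mathbb{C}$. Assume that $F=(f_1,\ldots,f_m): D\rightarrow \mathbb{C}^m$ and $G=(g_1,\ldots,g_n): D\rightarrow \mathbb{G}_n$ are holomorphic mappings such that $$F^{*}\omega_{\mathbb{C}^m}=G^{*}\omega_{\mathbb{G}_n}\quad \text{on } D,$$ where $\omega_{\mathbb{C}^m}$ is the Euclidean metric on $\mathbb{C}^m$ and $\omega_{\mathbb{G}_n}$ is the Bergman metric on the symmetrized polydisc $\mathbb{G}_n$. Then $F$ must be a constant map.
   Context: A domain is a nonempty connected open set. Let $\mathbb{D}$ be the unit disc in $\mathbb{C}$. The symmetrization map $\pi_n=(\pi_{n,1},\ldots,\pi_{n,n}):\mathbb{C}^n\to\mathbb{C}^n$ is given by the elementary symmetric polynomials $$\pi_{n,k}(\lambda)=\sum_{1\leq j_1<\cdots<j_k\leq n}\lambda_{j_1}\cdots\lambda_{j_k},\quad 1\leq k\leq n,\ \lambda=(\lambda_1,\ldots,\lambda_n)\in\mathbb{C}^n.$$ The symmetrized polydisc is $\mathbb{G}_n:=\pi_n(\mathbb{D}^n)$, a bounded domain in $\mathbb{C}^n$ (with $\mathbb{G}_1=\mathbb{D}$). Metrics are identified with their Kähler forms. The Euclidean metric on $\mathbb{C}^m$ is $\omega_{\mathbb{C}^m}=\sqrt{-1}\,\partial\bar\partial\sum_{i=1}^m|z_i|^2$. Let $K_{\mathbb{G}_n}(\cdot,\cdot)$ be the Bergman kernel of $\mathbb{G}_n$, i.e. the reproducing kernel of the Hilbert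 space of square-integrable (with respect to Lebesgue measure) holomorphic functions on $\mathbb{G}_n$; it is holomorphic in the first variable and anti-holomorphic in the second. The Bergman metric on $\mathbb{G}_n$ is $\omega_{\mathbb{G}_n}=\sqrt{-1}\,\partial\bar\partial\log K_{\mathbb{G}_n}(\xi,\xi)$. Thus the condition $F^{*}\omega_{\mathbb{C}^m}=G^{*}\omega_{\mathbb{G}_n}$ on $D$ means that $\partial\bar\partial\big(\sum_{i=1}^m|f_i(z)|^2-\log K_{\mathbb{G}_n}(G(z),G(z))\big)=0$ for all $z\in D$. *)

theory Defs
  imports "HOL-Analysis.Analysis"
begin

unbundle no fps_syntax

(* The coordinates of C^n are those of complex ^ 'n with CARD('n) = n.  Where the k-th coordinate
   matters, 'n is of sort {finite, wellorder}, and the index i is the k-th one for k = card {..i}. *)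

section \<open>The symmetrized polydisc\<close>

definition elem_sym :: "nat \<Rightarrow> complex ^ 'n \<Rightarrow> complex" where
  "elem_sym k x = (\<Sum>J | card J = k. \<Prod>j\<in>J. x $ j)"

definition symmetrization :: "complex ^ 'n::{finite,wellorder} \<Rightarrow> complex ^ 'n::_" where
  "symmetrization x = (\<chi> i. elem_sym (card {..i}) x)"

definition polydisc :: "(complex ^ 'n) set" where
  "polydisc = {x. \<forall>j. x $ j \<in> ball 0 1}"

definition sym_polydisc :: "(complex ^ 'n::{finite,wellorder}) set" where
  "sym_polydisc = symmetrization ` polydisc"

section \<open>The Bergman kernel\<close>

text \<open>Holomorphy on an open subset of \<open>\<complex>\<^sup>n\<close>: the real Frechet derivative exists
  and is complex linear.\<close>

definition several_holomorphic_on :: "(complex ^ 'n \<Rightarrow> complex) \<Rightarrow> (complex ^ 'n) set \<Rightarrow> bool" where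
  "several_holomorphic_on f \<Omega> \<longleftrightarrow>
     (\<forall>p\<in>\<Omega>. \<exists>f'. (f has_derivative f') (at p) \<and> (\<forall>c v. f' (c *s v) = c * f' v))"

definition bergman_space :: "(complex ^ 'n) set \<Rightarrow> (complex ^ 'n \<Rightarrow> complex) set" where
  "bergman_space \<Omega> = {f. several_holomorphic_on f \<Omega> \<and>
     set_integrable lebesgue \<Omega> (\<lambda>z. (cmod (f z))\<^sup>2)}"

definition reproducing_kernel ::
    "(complex ^ 'n) set \<Rightarrow> (complex ^ 'n \<Rightarrow> complex ^ 'n \<Rightarrow> complex) \<Rightarrow> bool" where
  "reproducing_kernel \<Omega> K \<longleftrightarrow>
     (\<forall>w\<in>\<Omega>. (\<lambda>z. K z w) \<in> bergman_space \<Omega>) \<and>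
     (\<forall>f\<in>bergman_space \<Omega>. \<forall>w\<in>\<Omega>. f w = (LINT z:\<Omega>|lebesgue. f z * cnj (K z w)))"

text \<open>The reproducing kernel is unique on \<open>\<Omega> \<times> \<Omega>\<close>; extension by zero makes it
  unique as a total function.\<close>

definition bergman_kernel :: "(complex ^ 'n) set \<Rightarrow> complex ^ 'n \<Rightarrow> complex ^ 'n \<Rightarrow> complex" where
  "bergman_kernel \<Omega> = (THE K. reproducing_kernel \<Omega> K \<and>
     (\<forall>z w. (z, w) \<notin> \<Omega> \<times> \<Omega> \<longrightarrow> K z w = 0))"

section \<open>Metrics as Kaehler forms\<close>

text \<open>Wirtinger derivatives \<open>\<partial>/\<partial>z\<^sub>j\<close> and \<open>\<partial>/\<partial>z\<^sub>j\<close>-bar; with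
  \<open>z\<^sub>j = x\<^sub>j + i y\<^sub>j\<close>, \<open>axis j 1\<close> and \<open>axis j \<i>\<close> are the
  directions of \<open>x\<^sub>j\<close> and \<open>y\<^sub>j\<close>.\<close>

definition wirtinger :: "'n \<Rightarrow> (complex ^ 'n \<Rightarrow> complex) \<Rightarrow> complex ^ 'n \<Rightarrow> complex" where
  "wirtinger j u p = (frechet_derivative u (at p) (axis j 1)
     - \<i> * frechet_derivative u (at p) (axis j \<i>)) / 2"

definition wirtinger_bar :: "'n \<Rightarrow> (complex ^ 'n \<Rightarrow> complex) \<Rightarrow> complex ^ 'n \<Rightarrow> complex" where
  "wirtinger_bar j u p = (frechet_derivative u (at p) (axis j 1)
     + \<i> * frechet_derivative u (at p) (axis j \<i>)) / 2"

text \<open>A 2-form assigns to a point \<open>p\<close> an alternating bilinear form in two tangent vectors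
  \<open>v\<close>, \<open>w\<close>.  The form \<open>i \<partial>\<partial>bar \<phi>\<close> is
  \<open>i \<Sum>\<^sub>j\<^sub>k (\<partial>\<^sup>2\<phi> / \<partial>z\<^sub>j \<partial>zbar\<^sub>k) dz\<^sub>j \<and> dzbar\<^sub>k\<close>, where
  \<open>(dz\<^sub>j \<and> dzbar\<^sub>k)(v, w) = v\<^sub>j cnj w\<^sub>k - w\<^sub>j cnj v\<^sub>k\<close>.\<close>

type_synonym 'a two_form = "'a \<Rightarrow> 'a \<Rightarrow> 'a \<Rightarrow> complex"

definition i_ddbar :: "(complex ^ 'n \<Rightarrow> real) \<Rightarrow> (complex ^ 'n) two_form" where
  "i_ddbar \<phi> p v w = \<i> * (\<Sum>j\<in>UNIV. \<Sum>k\<in>UNIV.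
     wirtinger j (wirtinger_bar k (\<lambda>q. complex_of_real (\<phi> q))) p *
       (v $ j * cnj (w $ k) - w $ j * cnj (v $ k)))"

definition pullback ::
    "('a::real_normed_vector \<Rightarrow> 'b::real_normed_vector) \<Rightarrow> 'b two_form \<Rightarrow> 'a two_form" where
  "pullback F \<omega> z v w =
     \<omega> (F z) (frechet_derivative F (at z) v) (frechet_derivative F (at z) w)"

definition euclidean_form :: "(complex ^ 'm) two_form" where
  "euclidean_form = i_ddbar (\<lambda>z. \<Sum>i\<in>UNIV. (cmod (z $ i))\<^sup>2)"

text \<open>Only meaningful at points of \<open>\<Omega>\<close>.  There \<open>K(\<xi>, \<xi>)\<close> is real, and it is
  positive for bounded \<open>\<Omega>\<close>, since the Bergman space then contains the constants.\<close>

definition bergman_form :: "(complex ^ 'n) set \<Rightarrow> (complex ^ 'n) two_form" where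
  "bergman_form \<Omega> = i_ddbar (\<lambda>\<xi>. ln (Re (bergman_kernel \<Omega> \<xi> \<xi>)))"

end

(* Pulling the Bergman kernel K of the symmetrized polydisc G_n back to the polydisc, where the
   kernel is a product, expresses K as a quotient A / B of polynomials in the point and the
   conjugate of its second argument: by antisymmetry, the determinant of the disc kernels is
   divisible by both Vandermonde determinants.

   Polarizing F^* omega = G^* omega_B shows that, for all z, y near a point, the exponential of the
   inner product of phi(z) and psi(y), with phi the normalized F and psi its conjugate, is a
   rational function of G(z) and of the conjugate of G.  The set of vectors v for which
   exp <phi, v> is a rational function of G is an additive group.  It contains the curve psi, hence
   a translate of an open subset of the span of the derivatives psi', hence this whole span and in
   particular t psi'(y) for every t.  But for a nonconstant theta the functions exp (t theta) with
   rationally independent t are algebraically independent, whereas the rational functions of G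
   have transcendence degree at most n.  So <phi, psi'(y)> is constant for every y, and taking for
   psi' the conjugate of phi' gives phi' = 0. *)

theory Submission
  imports Defs "HOL-Complex_Analysis.Complex_Analysis" "HOL-Computational_Algebra.Fundamental_Theorem_Algebra"
begin

text \<open>Equality of the metrics fixes a potential only up to the real part of a holomorphic
  function. So the kernel enters through a cross-ratio in \<open>z\<close>, \<open>z0\<close>,
  \<open>y\<close>, \<open>y0\<close>, in which this ambiguity cancels. The resulting rational
  functions of \<open>G\<close> come with no degree bound that is uniform in the vector
  \<open>v\<close>: only group operations are available on such \<open>v\<close>, and the count of
  dimensions uses just \<open>n + 1\<close> exponentials at a time. Sums of values of \<psi> fill an
  open set, and dividing by a large integer turns small multiples into all multiples. Divisibility
  by the Vandermonde determinants is obtained without dividing polynomials: once denominators are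
  cleared, the matrix of disc kernels is a product of a Vandermonde matrix in \<open>y\<close>, a
  matrix of polynomials in the symmetrized coordinates, and a transposed Vandermonde matrix in
  \<open>x\<close>. That the quotient is the Bergman kernel is proved by unfolding integrals onto
  the part of the polydisc with increasing real parts, then summing over permutations. Points with
  repeated coordinates, where the Vandermonde determinant vanishes, are reached as limits.\<close>

no_notation fps_nth (infixl "$" 75)

section \<open>Algebraic independence of exponentials over rational functions\<close>

text \<open>Elimination: an unknown \<open>k\<close> that occurs in equation \<open>j\<close> is
  removed from the other equations, which lowers both counts by one.\<close>

lemma homogeneous_system_nontrivial_solution:
  fixes c :: "'i \<Rightarrow> 'j \<Rightarrow> 'a::field"
  assumes "finite J" "finite I" "card J < card I"
  shows "\<exists>x. (\<exists>i\<in>I. x i \<noteq> 0) \<and> (\<forall>j\<in>J. (\<Sum>i\<in>I. x i * c i j) = 0)"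
  using assms
proof (induction J arbitrary: I c rule: finite_induct)
  case empty
  then obtain i where "i \<in> I" by fastforce
  then show ?case by (intro exI[of _ "\<lambda>_. 1"]) auto
next
  case (insert j J)
  show ?case
  proof (cases "\<forall>i\<in>I. c i j = 0")
    case True
    have "card J < card I" using insert.prems insert.hyps by simp
    from insert.IH[OF insert.prems(1) this, of c] obtain x where
      "\<exists>i\<in>I. x i \<noteq> 0" "\<forall>j\<in>J. (\<Sum>i\<in>I. x i * c i j) = 0" by blast
    with True show ?thesis by (intro exI[of _ x]) auto
  next
    case False
    then obtain k where k: "k \<in> I" "c k j \<noteq> 0" by blast
    let ?I = "I - {k}"
    define d where "d i l = c i l - c i j / c k j * c k l" for i l
    have "card J < card ?I" "finite ?I" using insert.prems insert.hyps k by auto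
    from insert.IH[OF this(2,1), of d] obtain x where x:
      "\<exists>i\<in>?I. x i \<noteq> 0" "\<forall>l\<in>J. (\<Sum>i\<in>?I. x i * d i l) = 0" by blast
    \<comment> \<open>\<open>- s\<close> is the value that equation \<open>j\<close> forces on the
      eliminated unknown.\<close>
    define s where "s = (\<Sum>i\<in>?I. x i * c i j) / c k j"
    define y where "y = x(k := - s)"
    have sum: "(\<Sum>i\<in>I. y i * c i l) = (\<Sum>i\<in>?I. x i * c i l) - s * c k l" for l
    proof -
      have "(\<Sum>i\<in>I. y i * c i l) = y k * c k l + (\<Sum>i\<in>?I. y i * c i l)"
        using insert.prems k by (simp add: sum.remove)
      also have "(\<Sum>i\<in>?I. y i * c i l) = (\<Sum>i\<in>?I. x i * c i l)"
        by (rule sum.cong) (auto simp: y_def)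
      finally show ?thesis by (simp add: y_def)
    qed
    have "(\<Sum>i\<in>I. y i * c i l) = 0" if "l \<in> insert j J" for l
    proof (cases "l = j")
      case True then show ?thesis using k by (simp add: sum s_def)
    next
      case False
      then have "0 = (\<Sum>i\<in>?I. x i * d i l)" using x that by auto
      also have "\<dots> = (\<Sum>i\<in>?I. x i * c i l) - s * c k l"
        by (simp add: d_def s_def algebra_simps sum_subtractf sum_distrib_left sum_divide_distrib)
      finally show ?thesis by (simp add: sum)
    qed
    moreover have "\<exists>i\<in>I. y i \<noteq> 0" using x(1) by (auto simp: y_def)
    ultimately show ?thesis by blast
  qed
qed

text \<open>Dividing a relation by the exponential of index \<open>k\<close> and differentiating
  kills that term. The other terms gain the factors \<open>s i - s k\<close>, which do not vanish,
  and a common factor \<open>\<theta>' z\<close>, which has no zeros on \<open>U\<close> and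
  cancels.\<close>

lemma exponentials_linearly_independent:
  fixes \<theta> :: "complex \<Rightarrow> complex" and s :: "'i \<Rightarrow> complex"
  assumes "open U" "U \<noteq> {}" "\<And>z. z \<in> U \<Longrightarrow> (\<theta> has_field_derivative \<theta>' z) (at z)"
    and "\<And>z. z \<in> U \<Longrightarrow> \<theta>' z \<noteq> 0"
    and "finite I" "inj_on s I" "\<And>z. z \<in> U \<Longrightarrow> (\<Sum>i\<in>I. x i * exp (s i * \<theta> z)) = 0"
  shows "\<forall>i\<in>I. x i = 0"
  using assms(5-7)
proof (induction I arbitrary: x rule: finite_induct)
  case (insert k I)
  have z0: "(\<Sum>i\<in>I. (x i * (s i - s k)) * exp (s i * \<theta> z)) = 0" if z: "z \<in> U" for z
  proof -
    define g where "g z = x k + (\<Sum>i\<in>I. x i * exp ((s i - s k) * \<theta> z))" for z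
    have g0: "g z = 0" if "z \<in> U" for z
    proof -
      have "0 = exp (- s k * \<theta> z) * (\<Sum>i\<in>insert k I. x i * exp (s i * \<theta> z))"
        using insert.prems that by simp
      also have "\<dots> = g z"
        using insert.hyps by (simp add: g_def sum_distrib_left algebra_simps flip: exp_add)
      finally show ?thesis by simp
    qed
    have "(g has_field_derivative (\<Sum>i\<in>I. x i * (exp ((s i - s k) * \<theta> z) * ((s i - s k) * \<theta>' z)))) (at z)"
      unfolding g_def by (auto intro!: derivative_eq_intros assms z sum.cong)
    moreover have "(g has_field_derivative 0) (at z)"
      using has_field_derivative_transform_within_open[of "\<lambda>_. 0" 0 z U g] assms(1) z g0 by auto
    ultimately have "(\<Sum>i\<in>I. x i * (exp ((s i - s k) * \<theta> z) * ((s i - s k) * \<theta>' z))) = 0"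
      using DERIV_unique by blast
    then have "0 = exp (s k * \<theta> z) * (\<Sum>i\<in>I. x i * (exp ((s i - s k) * \<theta> z) * ((s i - s k) * \<theta>' z))) / \<theta>' z"
      by simp
    also have "\<dots> = (\<Sum>i\<in>I. (x i * (s i - s k)) * exp (s i * \<theta> z))"
      using assms(4)[OF z]
      by (auto simp: sum_distrib_left sum_divide_distrib field_simps simp flip: exp_add intro!: sum.cong)
    finally show ?thesis by simp
  qed
  have "\<forall>i\<in>I. x i * (s i - s k) = 0"
    by (rule insert.IH) (use insert.prems z0 in \<open>auto simp: inj_on_def\<close>)
  then have xI: "\<forall>i\<in>I. x i = 0" using insert.prems insert.hyps by (auto simp: inj_on_def)
  obtain z where "z \<in> U" using assms by blast
  then have "x k = 0" using insert.prems(2)[of z] insert.hyps xI by simp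
  with xI show ?case by simp
qed simp

section \<open>Polynomials and rational functions of a vector-valued map\<close>

definition monomial :: "('n::finite \<Rightarrow> nat) \<Rightarrow> complex ^ 'n \<Rightarrow> complex" where
  "monomial e x = (\<Prod>i\<in>UNIV. (x $ i) ^ e i)"

text \<open>Each exponent is bounded separately instead of the total degree, so that the number of
  monomials is simply \<open>(d + 1) ^ CARD('n)\<close>.\<close>

definition exponents :: "nat \<Rightarrow> ('n::finite \<Rightarrow> nat) set" where
  "exponents d = PiE UNIV (\<lambda>_. {..d})"

text \<open>These are functions of the parameter \<open>z\<close>, not polynomials: the monomials
  may well be dependent along \<open>G\<close>, and only an upper bound on their number is ever
  used.\<close>

definition poly_along :: "('a \<Rightarrow> complex ^ 'n::finite) \<Rightarrow> nat \<Rightarrow> ('a \<Rightarrow> complex) set" where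
  "poly_along G d = {h. \<exists>c. \<forall>z. h z = (\<Sum>e\<in>exponents d. c e * monomial e (G z))}"

lemma finite_exponents [simp]: "finite (exponents d)"
  unfolding exponents_def by (rule finite_PiE) auto

lemma card_exponents: "card (exponents d :: ('n::finite \<Rightarrow> nat) set) = (d + 1) ^ CARD('n)"
  by (simp add: exponents_def card_PiE)

lemma poly_along_mono:
  assumes "h \<in> poly_along G d" "d \<le> d'" shows "h \<in> poly_along G d'"
proof -
  obtain c where c: "\<And>z. h z = (\<Sum>e\<in>exponents d. c e * monomial e (G z))"
    using assms by (auto simp: poly_along_def)
  have "h z = (\<Sum>e\<in>exponents d'. (if e \<in> exponents d then c e else 0) * monomial e (G z))" for z
    unfolding c using assms(2)
    by (intro sum.mono_neutral_cong_left[OF finite_exponents])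
       (auto simp: exponents_def PiE_def Pi_def intro: order_trans)
  then show ?thesis by (auto simp: poly_along_def)
qed

lemma poly_along_monomial: "e \<in> exponents d \<Longrightarrow> (\<lambda>z. monomial e (G z)) \<in> poly_along G d"
  unfolding poly_along_def
  by (auto intro!: exI[of _ "\<lambda>e'. if e' = e then 1 else 0"] simp: if_distrib[of "\<lambda>c. c * _"] sum.delta cong: if_cong)

lemma poly_along_zero: "(\<lambda>z. 0) \<in> poly_along G d"
  by (auto simp: poly_along_def intro!: exI[of _ "\<lambda>_. 0"])

lemma poly_along_add:
  assumes "g \<in> poly_along G d" "h \<in> poly_along G d"
  shows "(\<lambda>z. g z + h z) \<in> poly_along G d"
proof -
  obtain c c' where "\<And>z. g z = (\<Sum>e\<in>exponents d. c e * monomial e (G z))"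
    "\<And>z. h z = (\<Sum>e\<in>exponents d. c' e * monomial e (G z))"
    using assms by (auto simp: poly_along_def)
  then show ?thesis
    by (auto simp: poly_along_def algebra_simps sum.distrib intro!: exI[of _ "\<lambda>e. c e + c' e"])
qed

lemma poly_along_cmult:
  assumes "h \<in> poly_along G d" shows "(\<lambda>z. a * h z) \<in> poly_along G d"
proof -
  obtain c where "\<And>z. h z = (\<Sum>e\<in>exponents d. c e * monomial e (G z))"
    using assms by (auto simp: poly_along_def)
  then show ?thesis
    by (auto simp: poly_along_def algebra_simps sum_distrib_left intro!: exI[of _ "\<lambda>e. a * c e"])
qed

lemma poly_along_sum:
  assumes "\<And>i. i \<in> I \<Longrightarrow> h i \<in> poly_along G d"
  shows "(\<lambda>z. \<Sum>i\<in>I. h i z) \<in> poly_along G d"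
  using assms by (induction I rule: infinite_finite_induct) (auto intro: poly_along_zero poly_along_add)

lemma poly_along_mult:
  assumes "g \<in> poly_along G d" "h \<in> poly_along G d'"
  shows "(\<lambda>z. g z * h z) \<in> poly_along G (d + d')"
proof -
  obtain c c' where c: "\<And>z. g z = (\<Sum>e\<in>exponents d. c e * monomial e (G z))"
    "\<And>z. h z = (\<Sum>e\<in>exponents d'. c' e * monomial e (G z))"
    using assms by (auto simp: poly_along_def)
  have "(\<lambda>z. g z * h z) = (\<lambda>z. \<Sum>e\<in>exponents d. \<Sum>e'\<in>exponents d'. (c e * c' e') * monomial (\<lambda>i. e i + e' i) (G z))"
    by (simp add: c sum_product monomial_def power_add prod.distrib mult.assoc mult.left_commute)
  also have "\<dots> \<in> poly_along G (d + d')"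
    by (intro poly_along_sum poly_along_cmult poly_along_monomial)
       (auto simp: exponents_def PiE_def Pi_def intro: add_mono)
  finally show ?thesis .
qed

lemma poly_along_const: "(\<lambda>z. a) \<in> poly_along G d"
  using poly_along_cmult[OF poly_along_monomial[of "\<lambda>_. 0" d G], of a]
  by (simp add: monomial_def exponents_def PiE_def)

lemma poly_along_coord: "(\<lambda>z. G z $ i) \<in> poly_along G 1"
proof -
  have "(\<lambda>z. monomial (\<lambda>j. if j = i then 1 else 0) (G z)) \<in> poly_along G 1"
    by (rule poly_along_monomial) (auto simp: exponents_def)
  moreover have "monomial (\<lambda>j. if j = i then 1 else 0) x = x $ i" for x
  proof -
    have "monomial (\<lambda>j. if j = i then 1 else 0) x = (\<Prod>j\<in>UNIV. if j = i then x $ j else 1)"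
      unfolding monomial_def by (rule prod.cong) auto
    then show ?thesis by simp
  qed
  ultimately show ?thesis by simp
qed

lemma poly_along_power:
  assumes "h \<in> poly_along G d" shows "(\<lambda>z. h z ^ k) \<in> poly_along G (k * d)"
  by (induction k) (auto intro: poly_along_const poly_along_mult[OF assms])

lemma poly_along_prod:
  assumes "finite I" "\<And>i. i \<in> I \<Longrightarrow> h i \<in> poly_along G d"
  shows "(\<lambda>z. \<Prod>i\<in>I. h i z) \<in> poly_along G (card I * d)"
  using assms by (induction I rule: finite_induct) (auto intro: poly_along_const poly_along_mult)

text \<open>The denominator must have no zero on \<open>U\<close>, so that a quotient is a genuine
  function on \<open>U\<close> and membership passes at once to smaller sets.\<close>

definition rat_along :: "('a \<Rightarrow> complex ^ 'n::finite) \<Rightarrow> 'a set \<Rightarrow> ('a \<Rightarrow> complex) set" where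
  "rat_along G U = {h. \<exists>d A B. A \<in> poly_along G d \<and> B \<in> poly_along G d \<and>
      (\<forall>z\<in>U. B z \<noteq> 0 \<and> h z * B z = A z)}"

lemma rat_along_mult:
  assumes "g \<in> rat_along G U" "h \<in> rat_along G U"
  shows "(\<lambda>z. g z * h z) \<in> rat_along G U"
proof -
  obtain d A B where 1: "A \<in> poly_along G d" "B \<in> poly_along G d" "\<forall>z\<in>U. B z \<noteq> 0 \<and> g z * B z = A z"
    using assms by (auto simp: rat_along_def)
  obtain d' A' B' where 2: "A' \<in> poly_along G d'" "B' \<in> poly_along G d'" "\<forall>z\<in>U. B' z \<noteq> 0 \<and> h z * B' z = A' z"
    using assms by (auto simp: rat_along_def)
  have "\<forall>z\<in>U. B z * B' z \<noteq> 0 \<and> (g z * h z) * (B z * B' z) = A z * A' z"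
    using 1(3) 2(3) by (metis mult.assoc mult.left_commute no_zero_divisors)
  then show ?thesis unfolding rat_along_def using poly_along_mult[OF 1(1) 2(1)] poly_along_mult[OF 1(2) 2(2)]
    by blast
qed

lemma rat_along_divide:
  assumes "g \<in> rat_along G U" "h \<in> rat_along G U" "\<And>z. z \<in> U \<Longrightarrow> h z \<noteq> 0"
  shows "(\<lambda>z. g z / h z) \<in> rat_along G U"
proof -
  obtain d A B where 2: "A \<in> poly_along G d" "B \<in> poly_along G d" "\<forall>z\<in>U. B z \<noteq> 0 \<and> h z * B z = A z"
    using assms by (auto simp: rat_along_def)
  have "\<forall>z\<in>U. A z \<noteq> 0 \<and> inverse (h z) * A z = B z"
    using 2(3) assms(3) by (auto simp: field_simps)
  then have "(\<lambda>z. inverse (h z)) \<in> rat_along G U" unfolding rat_along_def using 2 by blast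
  from rat_along_mult[OF assms(1) this] show ?thesis by (simp add: field_class.field_divide_inverse)
qed

lemma rat_along_cong:
  assumes "g \<in> rat_along G U" "\<And>z. z \<in> U \<Longrightarrow> h z = g z"
  shows "h \<in> rat_along G U"
  using assms by (auto simp: rat_along_def)

text \<open>Injectivity on tuples of natural numbers amounts to linear independence over the
  rationals. A further number \<open>u\<close> can fail only by being a quotient of a difference of
  old values by a difference of integers; there are countably many such quotients, and the complex
  numbers are uncountable.\<close>

lemma exists_rationally_independent:
  "\<exists>t :: nat \<Rightarrow> complex. inj_on (\<lambda>a. \<Sum>j<N. of_nat (a j) * t j) (PiE {..<N} (\<lambda>_. UNIV))"
proof (induction N)
  case 0
  then show ?case by auto
next
  case (Suc N)
  then obtain t :: "nat \<Rightarrow> complex" where t: "inj_on (\<lambda>a. \<Sum>j<N. of_nat (a j) * t j) (PiE {..<N} (\<lambda>_. UNIV :: nat set))"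
    (is "inj_on ?f ?S") by blast
  let ?Q = "(\<lambda>(a, b, k, l). (?f a - ?f b) / (of_nat k - of_nat l)) ` (?S \<times> ?S \<times> (UNIV :: nat set) \<times> (UNIV :: nat set))"
  have "countable ?S" by (intro countable_PiE) auto
  then have "countable ?Q" by (intro countable_image countable_SIGMA) auto
  then have "?Q \<noteq> UNIV" using uncountable_UNIV_complex by auto
  then obtain u where u: "u \<notin> ?Q" by blast
  define t' where "t' = t(N := u)"
  have f': "(\<Sum>j<Suc N. of_nat (a j) * t' j) = ?f (restrict a {..<N}) + of_nat (a N) * u" for a
    by (simp add: t'_def)
  have "a = b" if ab: "a \<in> PiE {..<Suc N} (\<lambda>_. UNIV)" "b \<in> PiE {..<Suc N} (\<lambda>_. UNIV)"
    and eq: "(\<Sum>j<Suc N. of_nat (a j) * t' j) = (\<Sum>j<Suc N. of_nat (b j) * t' j)" for a b :: "nat \<Rightarrow> nat"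
  proof -
    let ?a = "restrict a {..<N}" and ?b = "restrict b {..<N}"
    have S: "?a \<in> ?S" "?b \<in> ?S" by auto
    from eq have e: "?f ?b - ?f ?a = (of_nat (a N) - of_nat (b N)) * u"
      unfolding f' by (simp add: algebra_simps)
    have N: "a N = b N"
    proof (rule ccontr)
      assume ne: "a N \<noteq> b N"
      then have "u = (?f ?b - ?f ?a) / (of_nat (a N) - of_nat (b N))" using e by simp
      then have "u \<in> ?Q" using S by (intro image_eqI[of _ _ "(?b, ?a, a N, b N)"]) auto
      then show False using u by blast
    qed
    with e have "?f ?a = ?f ?b" by simp
    then have "?a = ?b" using inj_onD[OF t _ S] by blast
    then have "a j = b j" if "j < N" for j by (metis lessThan_iff restrict_apply' that)
    with N have "a j = b j" if "j \<in> {..<Suc N}" for j using that by (auto simp: less_Suc_eq)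
    with ab show ?thesis by (intro PiE_ext) auto
  qed
  then show ?case by (intro exI[of _ t'] inj_onI)
qed

text \<open>From \<open>D * p + 1 \<le> (D + 1) * (p + 1)\<close> the left side loses at most the
  factor \<open>(D + 1) ^ n\<close> against \<open>(p + 1) ^ n\<close>; the witness is this factor
  itself, and \<open>p + 1\<close> exceeds it.\<close>

lemma power_count_exceeds:
  fixes n :: nat and D :: nat
  shows "\<exists>p. (D * p + 1) ^ n < (p + 1) ^ (n + 1)"
proof -
  let ?p = "(D + 1) ^ n"
  have "(D * ?p + 1) ^ n \<le> ((D + 1) * (?p + 1)) ^ n" by (intro power_mono) auto
  also have "\<dots> = ?p * (?p + 1) ^ n" by (simp only: power_mult_distrib)
  also have "\<dots> < (?p + 1) ^ (n + 1)" by simp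
  finally show ?thesis by blast
qed

text \<open>For rationally independent \<open>t\<^sub>0, \<dots>, t\<^sub>n\<close> the functions \<open>exp (t\<^sub>j \<theta>)\<close> are algebraically
  independent, whereas all rational functions of \<open>G\<close> have transcendence degree at most \<open>n\<close>;
  the dimension count below makes this comparison without field theory.\<close>

lemma exponentials_not_all_rational:
  fixes \<theta> :: "complex \<Rightarrow> complex" and G :: "complex \<Rightarrow> complex ^ 'n::finite"
  assumes U: "open U" "U \<noteq> {}" "\<And>z. z \<in> U \<Longrightarrow> (\<theta> has_field_derivative \<theta>' z) (at z)"
    and nz: "\<And>z. z \<in> U \<Longrightarrow> \<theta>' z \<noteq> 0"
  shows "\<exists>t. (\<lambda>z. exp (t * \<theta> z)) \<notin> rat_along G U"
proof (rule ccontr)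
  assume "\<not> ?thesis"
  then have rat: "(\<lambda>z. exp (t * \<theta> z)) \<in> rat_along G U" for t by blast
  define n where "n = CARD('n)"
  define N where "N = n + 1"
  obtain t :: "nat \<Rightarrow> complex" where
    t: "inj_on (\<lambda>a. \<Sum>j<N. of_nat (a j) * t j) (PiE {..<N} (\<lambda>_. UNIV))"
    by (rule exE[OF exists_rationally_independent[of N]])
  have "\<forall>j. \<exists>d A B. A \<in> poly_along G d \<and> B \<in> poly_along G d \<and>
      (\<forall>z\<in>U. B z \<noteq> 0 \<and> exp (t j * \<theta> z) * B z = A z)"
    using rat by (auto simp: rat_along_def)
  then obtain d A B where AB: "\<And>j. A j \<in> poly_along G (d j)" "\<And>j. B j \<in> poly_along G (d j)"
      "\<And>j z. z \<in> U \<Longrightarrow> B j z \<noteq> 0" "\<And>j z. z \<in> U \<Longrightarrow> exp (t j * \<theta> z) * B j z = A j z"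
    by metis
  define e where "e = (\<Sum>j<N. d j)"
  have de: "d j \<le> e" if "j < N" for j unfolding e_def using that by (intro member_le_sum) auto
  have AB': "A j \<in> poly_along G e" "B j \<in> poly_along G e" if "j < N" for j
    using AB(1,2) de[OF that] by (auto intro: poly_along_mono)
  \<comment> \<open>The products of the \<open>N = n + 1\<close> exponentials with exponents up to
    \<open>p\<close> number \<open>(p + 1) ^ (n + 1)\<close>, while after clearing denominators they
    are combinations of only \<open>(N * e * p + 1) ^ n\<close> monomials in
    \<open>G\<close>.\<close>
  obtain p where p: "((N * e) * p + 1) ^ n < (p + 1) ^ (n + 1)" using power_count_exceeds by blast
  let ?I = "PiE {..<N} (\<lambda>_. {..p})"
  define s where "s a = (\<Sum>j<N. of_nat (a j) * t j)" for a
  \<comment> \<open>The exponential with exponent vector \<open>a\<close>, times a common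
    denominator: the complementary exponents \<open>p - a j\<close> make that denominator the same
    for every \<open>a\<close>, so a linear relation among the \<open>h a\<close> is one among the
    exponentials.\<close>
  define h where "h a z = (\<Prod>j<N. A j z ^ a j * B j z ^ (p - a j))" for a z
  have hB: "h a z = exp (s a * \<theta> z) * (\<Prod>j<N. B j z ^ p)" if "a \<in> ?I" "z \<in> U" for a z
  proof -
    have "h a z = (\<Prod>j<N. exp (of_nat (a j) * t j * \<theta> z) * B j z ^ p)"
      unfolding h_def
    proof (rule prod.cong)
      fix j assume "j \<in> {..<N}"
      then have "a j \<le> p" using that by auto
      then have "B j z ^ p = B j z ^ a j * B j z ^ (p - a j)" by (simp flip: power_add)
      moreover have "A j z ^ a j = exp (of_nat (a j) * t j * \<theta> z) * B j z ^ a j"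
        by (simp add: AB(4)[OF that(2), symmetric] power_mult_distrib mult.assoc flip: exp_of_nat_mult)
      ultimately show "A j z ^ a j * B j z ^ (p - a j) = exp (of_nat (a j) * t j * \<theta> z) * B j z ^ p" by simp
    qed simp
    then show ?thesis by (simp add: prod.distrib s_def sum_distrib_right flip: exp_sum)
  qed
  have hW: "h a \<in> poly_along G (N * e * p)" if "a \<in> ?I" for a
  proof -
    have *: "(\<lambda>z. A j z ^ a j * B j z ^ (p - a j)) \<in> poly_along G (p * e)" if j: "j \<in> {..<N}" for j
    proof -
      have "a j * e + (p - a j) * e = p * e" using j \<open>a \<in> ?I\<close>
        by (metis PiE_mem add_mult_distrib atMost_iff le_add_diff_inverse)
      then show ?thesis
        using poly_along_mult[OF poly_along_power[OF AB'(1), of j "a j"] poly_along_power[OF AB'(2), of j "p - a j"]] j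
        by simp
    qed
    from poly_along_prod[OF finite_lessThan *] show ?thesis by (simp add: h_def[abs_def] ac_simps)
  qed
  then have "\<forall>a. \<exists>c. a \<in> ?I \<longrightarrow> (\<forall>z. h a z = (\<Sum>e\<in>exponents (N * e * p). c e * monomial e (G z)))"
    by (auto simp: poly_along_def)
  then obtain c where c: "\<And>a z. a \<in> ?I \<Longrightarrow> h a z = (\<Sum>e\<in>exponents (N * e * p). c a e * monomial e (G z))"
    by metis
  have "card (exponents (N * e * p) :: ('n \<Rightarrow> nat) set) < card ?I"
    using p by (simp add: card_exponents card_PiE N_def n_def)
  then obtain x where x: "\<exists>a\<in>?I. x a \<noteq> 0" "\<forall>e\<in>exponents (N * e * p). (\<Sum>a\<in>?I. x a * c a e) = 0"
    using homogeneous_system_nontrivial_solution[of "exponents (N * e * p)" ?I c] by (auto intro: finite_PiE)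
  have "(\<Sum>a\<in>?I. x a * exp (s a * \<theta> z)) = 0" if z: "z \<in> U" for z
  proof -
    let ?b = "\<Prod>j<N. B j z ^ p"
    have "(\<Sum>a\<in>?I. x a * exp (s a * \<theta> z)) * ?b = (\<Sum>a\<in>?I. x a * h a z)"
      using z by (simp add: hB sum_distrib_right mult.assoc)
    also have "\<dots> = (\<Sum>a\<in>?I. \<Sum>e\<in>exponents (N * e * p). x a * c a e * monomial e (G z))"
      by (simp add: c sum_distrib_left mult.assoc)
    also have "\<dots> = (\<Sum>e\<in>exponents (N * e * p). (\<Sum>a\<in>?I. x a * c a e) * monomial e (G z))"
      by (subst sum.swap) (simp add: sum_distrib_right)
    also have "\<dots> = 0" using x(2) by simp
    finally show ?thesis using AB(3)[OF z] by simp
  qed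
  moreover have "inj_on s ?I"
    unfolding s_def[abs_def] by (rule inj_on_subset[OF t]) auto
  ultimately have "\<forall>a\<in>?I. x a = 0"
    by (intro exponentials_linearly_independent[OF U nz]) (auto intro: finite_PiE)
  then show False using x(1) by blast
qed

section \<open>Additive relations between holomorphic curves\<close>

lemma has_derivative_vecI:
  fixes f :: "'a::real_normed_vector \<Rightarrow> complex ^ 'n"
  assumes "\<And>i. ((\<lambda>x. f x $ i) has_derivative (\<lambda>h. f' h $ i)) F"
  shows "(f has_derivative f') F"
proof -
  have "((\<lambda>x. \<Sum>i\<in>UNIV. axis i (f x $ i)) has_derivative (\<lambda>h. \<Sum>i\<in>UNIV. axis i (f' h $ i))) F"
  proof (intro has_derivative_sum)
    fix i
    have "bounded_linear (axis i :: complex \<Rightarrow> complex ^ 'n)"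
      unfolding linear_conv_bounded_linear[symmetric] by (intro linearI) (auto simp: axis_def vec_eq_iff)
    from bounded_linear.has_derivative[OF this assms]
    show "((\<lambda>x. axis i (f x $ i) :: complex ^ 'n) has_derivative (\<lambda>h. axis i (f' h $ i))) F" .
  qed
  moreover have "(\<Sum>i\<in>UNIV. axis i (v $ i)) = v" for v :: "complex ^ 'n"
    by (simp add: vec_eq_iff axis_def if_distrib cong: if_cong)
  ultimately show ?thesis by simp
qed

lemma has_derivative_component:
  assumes "(f has_derivative f') F"
  shows "((\<lambda>x. f x $ i) has_derivative (\<lambda>h. f' h $ i)) F"
  using bounded_linear.has_derivative[OF bounded_linear_vec_nth assms] .

lemma bounded_linear_complex_matrix: "bounded_linear ((*v) (A :: complex ^ 'n ^ 'm))"
proof -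
  have "A *v (c *\<^sub>R x) = c *\<^sub>R (A *v x)" for c x
    by (simp add: vec_eq_iff matrix_vector_mult_def scaleR_sum_right)
  then show ?thesis
    unfolding linear_conv_bounded_linear[symmetric] by (intro linearI) (auto simp: matrix_vector_right_distrib)
qed

text \<open>The sums \<open>\<Sum>\<^sub>j \<psi>(y\<^sub>j)\<close> fill an open subset of a translate of the span of the vectors
  \<open>\<psi>'(y)\<close>; complementary basis vectors \<open>b j\<close> are added so that the open mapping theorem applies.\<close>

lemma additive_subgroup_contains_tangents:
  fixes \<psi> \<psi>' :: "complex \<Rightarrow> complex ^ 'm" and H :: "(complex ^ 'm) set"
  assumes der: "\<And>y i. y \<in> ball y0 r \<Longrightarrow> ((\<lambda>y. \<psi> y $ i) has_field_derivative \<psi>' y $ i) (at y)"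
    and H: "0 \<in> H" "\<And>u v. u \<in> H \<Longrightarrow> v \<in> H \<Longrightarrow> u + v \<in> H" "\<And>u v. u \<in> H \<Longrightarrow> v \<in> H \<Longrightarrow> u - v \<in> H"
    and \<psi>H: "\<And>y. y \<in> ball y0 r \<Longrightarrow> \<psi> y \<in> H"
    and y1: "y1 \<in> ball y0 r"
  shows "t *s \<psi>' y1 \<in> H"
proof -
  let ?Y = "ball y0 r"
  \<comment> \<open>The basis of the span is chosen among the values of \<open>\<psi>'\<close>, so
    each of its vectors is the derivative of \<psi> at some point of the ball. These points become
    the coordinates of \<open>x0\<close>.\<close>
  obtain B where B: "B \<subseteq> \<psi>' ` ?Y" "vec.independent B" "\<psi>' ` ?Y \<subseteq> vec.span B"
    using vec.maximal_independent_subset[of "\<psi>' ` ball y0 r"] by metis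
  obtain C where C: "B \<subseteq> C" "vec.independent C" "UNIV \<subseteq> vec.span C"
    using vec.maximal_independent_subset_extend[OF subset_UNIV B(2)] by metis
  have cardC: "card C = CARD('m)"
    using vec.basis_card_eq_dim[OF subset_UNIV C(3,2)] by (simp only: vec_dim_card)
  then have "finite C" by (simp add: card_ge_0_finite)
  with cardC obtain b where b: "bij_betw b (UNIV :: 'm set) C"
    using finite_same_card_bij[of "UNIV :: 'm set" C] by auto
  define I where "I = {j. b j \<in> B}"
  have "\<forall>j. \<exists>y. j \<in> I \<longrightarrow> y \<in> ?Y \<and> \<psi>' y = b j" using B(1) unfolding I_def by (metis (no_types, lifting) imageE mem_Collect_eq subsetD)
  then obtain p where p: "\<And>j. j \<in> I \<Longrightarrow> p j \<in> ?Y" "\<And>j. j \<in> I \<Longrightarrow> \<psi>' (p j) = b j" by metis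
  define x0 :: "complex ^ 'm" where "x0 = (\<chi> j. p j)"
  define A :: "complex ^ 'm ^ 'm" where "A = (\<chi> i j. b j $ i)"
  have colA: "column j A = b j" for j by (simp add: A_def column_def)
  have "columns A = C" using b by (auto simp: columns_def colA bij_betw_def image_iff)
  then have "\<exists>A'. A ** A' = mat 1"
    unfolding matrix_right_invertible_span_columns using C(3) by auto
  then obtain A' where AA': "A ** A' = mat 1" by blast
  then have A'A: "A' ** A = mat 1" by (simp add: matrix_left_right_inverse)
  \<comment> \<open>Thus \<open>A' *v v\<close> lists the coordinates of \<open>v\<close> with
    respect to the basis \<open>b\<close>.\<close>
  have A'b: "A' *v b j = axis j 1" for j
  proof -
    have "A *v axis j 1 = b j" by (simp add: A_def matrix_vector_mult_def axis_def vec_eq_iff if_distrib cong: if_cong)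
    then show ?thesis using A'A by (metis matrix_vector_mul_assoc matrix_vector_mul_lid)
  qed
  have A'B: "(A' *v v) $ k = 0" if "v \<in> vec.span B" "k \<notin> I" for v k
    using that(1)
  proof (induction rule: vec.span_induct_alt)
    case base then show ?case by simp
  next
    case (step c x y)
    obtain j where "x = b j" using step(1) C(1) b by (metis bij_betw_def imageE subsetD)
    moreover have "j \<noteq> k" using step(1) \<open>x = b j\<close> that(2) by (auto simp: I_def)
    ultimately have "(A' *v x) $ k = 0" by (simp add: A'b axis_def)
    with step show ?case by (simp add: vec.add vec.scale)
  qed
  \<comment> \<open>Since \<open>\<psi>'\<close> stays in the span of \<open>B\<close>, the
    coordinates of \<psi> outside \<open>I\<close> have zero derivative.\<close>
  have const: "(A' *v \<psi> y) $ k = (A' *v \<psi> y') $ k" if "y \<in> ?Y" "y' \<in> ?Y" "k \<notin> I" for y y' k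
  proof -
    have "((\<lambda>y. (A' *v \<psi> y) $ k) has_field_derivative 0) (at x)" if x: "x \<in> ?Y" for x
    proof -
      have "((\<lambda>y. (A' *v \<psi> y) $ k) has_field_derivative (A' *v \<psi>' x) $ k) (at x)"
        unfolding matrix_vector_mult_def by (auto intro!: derivative_eq_intros der x simp: mult.commute)
      moreover have "(A' *v \<psi>' x) $ k = 0" using A'B[OF _ \<open>k \<notin> I\<close>] B(3) x by blast
      ultimately show ?thesis by simp
    qed
    then have "\<exists>c. \<forall>x\<in>?Y. (A' *v \<psi> x) $ k = c"
      by (intro has_field_derivative_zero_constant) (auto intro: has_field_derivative_at_within)
    then show ?thesis using that by auto
  qed
  define T :: "(complex ^ 'm) set" where "T = (\<Inter>j\<in>I. (\<lambda>x. x $ j) -` ?Y)"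
  define f where "f x = (\<Sum>j\<in>UNIV. if j \<in> I then \<psi> (x $ j) else x $ j *s b j)" for x :: "complex ^ 'm"
  have T: "open T" unfolding T_def
    by (intro open_INT ballI open_vimage) (auto intro: continuous_intros)
  have x0: "x0 \<in> T" using p by (auto simp: T_def x0_def)
  define Df where "Df x h = (\<Sum>j\<in>UNIV. h $ j *s (if j \<in> I then \<psi>' (x $ j) else b j))" for x h :: "complex ^ 'm"
  have df: "(f has_derivative Df x) (at x)" if "x \<in> T" for x
  proof (rule has_derivative_vecI)
    fix i
    have "((\<lambda>x. (if j \<in> I then \<psi> (x $ j) else x $ j *s b j) $ i) has_derivative
        (\<lambda>h. (h $ j *s (if j \<in> I then \<psi>' (x $ j) else b j)) $ i)) (at x)" for j
    proof (cases "j \<in> I")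
      case True
      then have "x $ j \<in> ?Y" using \<open>x \<in> T\<close> by (auto simp: T_def)
      from der[OF this, of i, unfolded has_field_derivative_def]
      have "((\<lambda>y. \<psi> y $ i) has_derivative (*) (\<psi>' (x $ j) $ i)) (at (x $ j))" .
      from has_derivative_compose[OF bounded_linear_imp_has_derivative[OF bounded_linear_vec_nth] this]
      show ?thesis using True by (simp add: mult.commute)
    next
      case False
      then show ?thesis by (auto intro!: derivative_eq_intros has_derivative_component)
    qed
    then have "((\<lambda>x. \<Sum>j\<in>UNIV. (if j \<in> I then \<psi> (x $ j) else x $ j *s b j) $ i) has_derivative
        (\<lambda>h. \<Sum>j\<in>UNIV. (h $ j *s (if j \<in> I then \<psi>' (x $ j) else b j)) $ i)) (at x)"
      by (rule has_derivative_sum)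
    then show "((\<lambda>x. f x $ i) has_derivative (\<lambda>h. Df x h $ i)) (at x)"
      by (simp add: f_def Df_def)
  qed
  \<comment> \<open>At the base point the differential is the matrix of basis vectors, hence
    invertible, as the open mapping theorem requires.\<close>
  have "Df x0 h = A *v h" for h
    unfolding Df_def matrix_mult_sum colA by (rule sum.cong) (auto simp: x0_def p)
  then have inv: "Df x0 \<circ> (*v) A' = id"
    by (auto simp: fun_eq_iff matrix_vector_mul_assoc AA')
  have cont: "continuous_on T f"
    using df by (meson continuous_at_imp_continuous_on has_derivative_continuous)
  have "f x0 \<in> interior (f ` T)"
    by (rule sussmann_open_mapping[OF T cont x0 df[OF x0] bounded_linear_complex_matrix inv order_refl])
      (use x0 T in \<open>simp add: interior_open\<close>)
  then obtain \<epsilon> where \<epsilon>: "\<epsilon> > 0" "ball (f x0) \<epsilon> \<subseteq> f ` T"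
    by (meson mem_interior)
  let ?v = "\<psi>' y1"
  have v: "?v \<in> vec.span B" using B(3) y1 by blast
  have small: "s *s ?v \<in> H" if s: "norm (s *s ?v) < \<epsilon>" for s
  proof -
    have "f x0 + s *s ?v \<in> ball (f x0) \<epsilon>" using s by (simp add: dist_norm)
    then obtain x where x: "x \<in> T" "f x = f x0 + s *s ?v" using \<epsilon> by (metis imageE subsetD)
    have split: "f w = (\<Sum>j\<in>I. \<psi> (w $ j)) + (\<Sum>j\<in>-I. w $ j *s b j)" for w
    proof -
      have "f w = (\<Sum>j\<in>I. if j \<in> I then \<psi> (w $ j) else w $ j *s b j) + (\<Sum>j\<in>-I. if j \<in> I then \<psi> (w $ j) else w $ j *s b j)"
        unfolding f_def by (subst sum.union_disjoint[symmetric]) (auto intro: sum.cong)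
      then show ?thesis by simp
    qed
    have xY: "x $ j \<in> ?Y" "x0 $ j \<in> ?Y" if "j \<in> I" for j using x(1) x0 that by (auto simp: T_def)
    have eq: "s *s ?v = (\<Sum>j\<in>I. \<psi> (x $ j) - \<psi> (x0 $ j)) + (\<Sum>j\<in>-I. (x $ j - x0 $ j) *s b j)"
      using x(2) unfolding split by (simp add: sum_subtractf vec.scale_left_diff_distrib algebra_simps)
    \<comment> \<open>The displacement and the differences of values of \<psi> have no coordinate
      outside \<open>I\<close>, so the auxiliary variables cannot have moved; what remains is a sum
      of differences of elements of \<open>H\<close>.\<close>
    have "x $ k - x0 $ k = 0" if k: "k \<notin> I" for k
    proof -
      have "0 = (A' *v (s *s ?v)) $ k" using A'B[OF v k] by (simp add: vec.scale)
      also have "\<dots> = (\<Sum>j\<in>I. (A' *v \<psi> (x $ j)) $ k - (A' *v \<psi> (x0 $ j)) $ k)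
           + (\<Sum>j\<in>-I. (x $ j - x0 $ j) * (A' *v b j) $ k)"
        unfolding eq by (simp add: vec.add vec.sum vec.scale vec.diff left_diff_distrib)
      also have "(\<Sum>j\<in>I. (A' *v \<psi> (x $ j)) $ k - (A' *v \<psi> (x0 $ j)) $ k) = 0"
        by (rule sum.neutral) (use const xY k in auto)
      also have "(\<Sum>j\<in>-I. (x $ j - x0 $ j) * (A' *v b j) $ k) = (\<Sum>j\<in>-I. if j = k then x $ k - x0 $ k else 0)"
        by (rule sum.cong) (auto simp: A'b axis_def)
      finally show ?thesis using k by simp
    qed
    then have "s *s ?v = (\<Sum>j\<in>I. \<psi> (x $ j) - \<psi> (x0 $ j))" unfolding eq by (simp add: sum.neutral)
    moreover have "(\<Sum>j\<in>J. \<psi> (x $ j) - \<psi> (x0 $ j)) \<in> H" if "J \<subseteq> I" for J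
      using finite[of J] that by (induction J rule: finite_induct) (auto intro!: H \<psi>H xY)
    ultimately show ?thesis by simp
  qed
  have mult: "of_nat N *s u \<in> H" if "u \<in> H" for u N
    by (induction N) (auto intro: H that simp: vec.scale_left_distrib)
  \<comment> \<open>A group that contains all sufficiently small multiples of a vector contains all
    multiples: \<open>t\<close> is divided by a large integer and multiplied back.\<close>
  obtain N :: nat where N: "norm (t *s ?v) / \<epsilon> < of_nat N" using reals_Archimedean2 by blast
  with \<epsilon> have "N > 0" by (cases "N = 0") (auto simp: divide_less_0_iff)
  have "(t / of_nat N) *s ?v = (1 / real N) *\<^sub>R (t *s ?v)"
    by (simp add: vec_eq_iff) (simp add: scaleR_conv_of_real field_simps)
  then have "norm ((t / of_nat N) *s ?v) = norm (t *s ?v) / N" by simp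
  also have "\<dots> < \<epsilon>" using N \<epsilon> \<open>N > 0\<close> by (simp add: field_simps)
  finally have "of_nat N *s ((t / of_nat N) *s ?v) \<in> H" by (intro mult small)
  then show ?thesis using \<open>N > 0\<close> by (simp add: vec.scale_scale)
qed

text \<open>The conclusion is bilinear, with \<psi> still unrelated to \<phi>. Only the later choice
  of \<psi> as the reflected conjugate of \<phi> turns it into a sum of squares and so into the
  vanishing of \<open>\<phi>'\<close>.\<close>

lemma exp_inner_rational_imp_critical:
  fixes \<phi> \<phi>' \<psi> \<psi>' :: "complex \<Rightarrow> complex ^ 'm" and G :: "complex \<Rightarrow> complex ^ 'n"
  assumes r: "r > 0"
    and \<phi>: "\<And>z i. z \<in> ball z0 r \<Longrightarrow> ((\<lambda>z. \<phi> z $ i) has_field_derivative \<phi>' z $ i) (at z)"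
    and \<phi>': "\<And>i. continuous_on (ball z0 r) (\<lambda>z. \<phi>' z $ i)"
    and \<psi>: "\<And>y i. y \<in> ball y0 r \<Longrightarrow> ((\<lambda>y. \<psi> y $ i) has_field_derivative \<psi>' y $ i) (at y)"
    and rat: "\<And>y. y \<in> ball y0 r \<Longrightarrow> (\<lambda>z. exp (\<Sum>i\<in>UNIV. \<phi> z $ i * \<psi> y $ i)) \<in> rat_along G (ball z0 r)"
  shows "(\<Sum>i\<in>UNIV. \<phi>' z0 $ i * \<psi>' y0 $ i) = 0"
proof (rule ccontr)
  define \<theta> where "\<theta> z = (\<Sum>i\<in>UNIV. \<phi> z $ i * \<psi>' y0 $ i)" for z
  define \<theta>' where "\<theta>' z = (\<Sum>i\<in>UNIV. \<phi>' z $ i * \<psi>' y0 $ i)" for z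
  assume "\<not> ?thesis"
  then have nz0: "\<theta>' z0 \<noteq> 0" by (simp add: \<theta>'_def)
  define H where "H = {v. (\<lambda>z. exp (\<Sum>i\<in>UNIV. \<phi> z $ i * v $ i)) \<in> rat_along G (ball z0 r)}"
  have all: "t *s \<psi>' y0 \<in> H" for t
  proof (rule additive_subgroup_contains_tangents[OF \<psi>])
    show "0 \<in> H"
      by (auto simp: H_def rat_along_def intro!: exI[of _ "\<lambda>_. 1"] poly_along_const)
    show "u + v \<in> H" if "u \<in> H" "v \<in> H" for u v
      using that rat_along_mult unfolding H_def
      by (fastforce simp: algebra_simps sum.distrib exp_add)
    show "u - v \<in> H" if "u \<in> H" "v \<in> H" for u v
      using that rat_along_divide unfolding H_def
      by (fastforce simp: algebra_simps sum_subtractf exp_diff)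
  qed (use rat r in \<open>auto simp: H_def\<close>)
  \<comment> \<open>The independence of the exponentials asks for a derivative without zeros, so the
    ball is shrunk around \<open>z0\<close>.\<close>
  have "continuous_on (ball z0 r) \<theta>'"
    unfolding \<theta>'_def by (intro continuous_intros \<phi>')
  then have "open {z \<in> ball z0 r. \<theta>' z \<in> - {0}}"
    using continuous_open_preimage[of "ball z0 r" \<theta>' "- {0}"] by (auto simp: vimage_def Int_def)
  then obtain \<epsilon> where \<epsilon>: "\<epsilon> > 0" "ball z0 \<epsilon> \<subseteq> {z \<in> ball z0 r. \<theta>' z \<in> - {0}}"
    using r nz0 by (metis (mono_tags, lifting) ComplI centre_in_ball mem_Collect_eq openE singletonD)
  have "(\<lambda>z. exp (t * \<theta> z)) \<in> rat_along G (ball z0 \<epsilon>)" for t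
  proof -
    have "(\<lambda>z. exp (\<Sum>i\<in>UNIV. \<phi> z $ i * (t *s \<psi>' y0) $ i)) \<in> rat_along G (ball z0 r)"
      using all[of t] by (simp add: H_def)
    then have "(\<lambda>z. exp (t * \<theta> z)) \<in> rat_along G (ball z0 r)"
      by (simp add: \<theta>_def sum_distrib_left mult.left_commute)
    then show ?thesis using \<epsilon>(2) unfolding rat_along_def by blast
  qed
  moreover have "(\<theta> has_field_derivative \<theta>' z) (at z)" if "z \<in> ball z0 \<epsilon>" for z
    unfolding \<theta>_def \<theta>'_def using that \<epsilon>(2) by (auto intro!: derivative_eq_intros \<phi>)
  ultimately show False
    using exponentials_not_all_rational[of "ball z0 \<epsilon>" \<theta> \<theta>' G] \<epsilon> by fastforce
qed

section \<open>Polynomials in a point and its conjugate\<close>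

definition cnjv :: "complex ^ 'n \<Rightarrow> complex ^ 'n" where
  "cnjv x = (\<chi> i. cnj (x $ i))"

lemma cnjv_nth [simp]: "cnjv x $ i = cnj (x $ i)"
  by (simp add: cnjv_def)

text \<open>Polynomials in two independent points. The conjugate is not built in but substituted
  from outside by \<open>cnjv\<close>, so that the second argument can be varied holomorphically in
  the polarization. The inductive form makes each property needed (derivatives, continuity,
  holomorphy, degree along a curve) a short induction.\<close>

inductive bipoly :: "(complex ^ 'n \<Rightarrow> complex ^ 'n \<Rightarrow> complex) \<Rightarrow> bool" where
  const: "bipoly (\<lambda>_ _. c)"
| fst: "bipoly (\<lambda>\<xi> _. \<xi> $ i)"
| snd: "bipoly (\<lambda>_ \<eta>. \<eta> $ i)"
| add: "bipoly f \<Longrightarrow> bipoly g \<Longrightarrow> bipoly (\<lambda>\<xi> \<eta>. f \<xi> \<eta> + g \<xi> \<eta>)"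
| mult: "bipoly f \<Longrightarrow> bipoly g \<Longrightarrow> bipoly (\<lambda>\<xi> \<eta>. f \<xi> \<eta> * g \<xi> \<eta>)"

lemma bipoly_sum: "(\<And>i. i \<in> I \<Longrightarrow> bipoly (f i)) \<Longrightarrow> bipoly (\<lambda>\<xi> \<eta>. \<Sum>i\<in>I. f i \<xi> \<eta>)"
  by (induction I rule: infinite_finite_induct) (auto intro: bipoly.intros)

lemma bipoly_prod: "(\<And>i. i \<in> I \<Longrightarrow> bipoly (f i)) \<Longrightarrow> bipoly (\<lambda>\<xi> \<eta>. \<Prod>i\<in>I. f i \<xi> \<eta>)"
  by (induction I rule: infinite_finite_induct) (auto intro: bipoly.intros)

lemma bipoly_partial_derivatives:
  assumes "bipoly f"
  shows "\<exists>f1 f2. (\<forall>i. bipoly (f1 i)) \<and> (\<forall>i. bipoly (f2 i)) \<and>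
    (\<forall>\<xi> \<eta>. ((\<lambda>x. f (fst x) (snd x)) has_derivative
      (\<lambda>h. (\<Sum>i\<in>UNIV. f1 i \<xi> \<eta> * fst h $ i) + (\<Sum>i\<in>UNIV. f2 i \<xi> \<eta> * snd h $ i))) (at (\<xi>, \<eta>)))"
  using assms
proof induction
  case (const c)
  show ?case
    by (intro exI[of _ "\<lambda>_ _ _. 0"]) (auto intro: bipoly.intros)
next
  case (fst j)
  have "((\<lambda>x. fst x $ j) has_derivative (\<lambda>h. fst h $ j)) (at (\<xi>, \<eta>))" for \<xi> \<eta> :: "complex ^ 'a"
    by (intro has_derivative_component derivative_eq_intros) auto
  moreover have "(\<Sum>i\<in>UNIV. (if i = j then 1 else 0) * v $ i) = v $ j" for v :: "complex ^ 'a"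
    by (simp add: if_distrib[of "\<lambda>c. c * _"] cong: if_cong)
  ultimately show ?case
    by (intro exI[of _ "\<lambda>i _ _. if i = j then 1 else 0"] exI[of _ "\<lambda>_ _ _. 0"]) (auto intro: bipoly.intros)
next
  case (snd j)
  have "((\<lambda>x. snd x $ j) has_derivative (\<lambda>h. snd h $ j)) (at (\<xi>, \<eta>))" for \<xi> \<eta> :: "complex ^ 'a"
    by (intro has_derivative_component derivative_eq_intros) auto
  moreover have "(\<Sum>i\<in>UNIV. (if i = j then 1 else 0) * v $ i) = v $ j" for v :: "complex ^ 'a"
    by (simp add: if_distrib[of "\<lambda>c. c * _"] cong: if_cong)
  ultimately show ?case
    by (intro exI[of _ "\<lambda>_ _ _. 0"] exI[of _ "\<lambda>i _ _. if i = j then 1 else 0"]) (auto intro: bipoly.intros)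
next
  case (add f g)
  then obtain f1 f2 g1 g2 where *: "\<And>i. bipoly (f1 i)" "\<And>i. bipoly (f2 i)" "\<And>i. bipoly (g1 i)" "\<And>i. bipoly (g2 i)"
    "\<And>\<xi> \<eta>. ((\<lambda>x. f (fst x) (snd x)) has_derivative
      (\<lambda>h. (\<Sum>i\<in>UNIV. f1 i \<xi> \<eta> * fst h $ i) + (\<Sum>i\<in>UNIV. f2 i \<xi> \<eta> * snd h $ i))) (at (\<xi>, \<eta>))"
    "\<And>\<xi> \<eta>. ((\<lambda>x. g (fst x) (snd x)) has_derivative
      (\<lambda>h. (\<Sum>i\<in>UNIV. g1 i \<xi> \<eta> * fst h $ i) + (\<Sum>i\<in>UNIV. g2 i \<xi> \<eta> * snd h $ i))) (at (\<xi>, \<eta>))"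
    by blast
  show ?case
    by (rule exI[of _ "\<lambda>i \<xi> \<eta>. f1 i \<xi> \<eta> + g1 i \<xi> \<eta>"], rule exI[of _ "\<lambda>i \<xi> \<eta>. f2 i \<xi> \<eta> + g2 i \<xi> \<eta>"])
       (intro conjI allI, auto intro!: bipoly.add * derivative_eq_intros simp: algebra_simps sum.distrib)
next
  case (mult f g)
  then obtain f1 f2 g1 g2 where *: "\<And>i. bipoly (f1 i)" "\<And>i. bipoly (f2 i)" "\<And>i. bipoly (g1 i)" "\<And>i. bipoly (g2 i)"
    "\<And>\<xi> \<eta>. ((\<lambda>x. f (fst x) (snd x)) has_derivative
      (\<lambda>h. (\<Sum>i\<in>UNIV. f1 i \<xi> \<eta> * fst h $ i) + (\<Sum>i\<in>UNIV. f2 i \<xi> \<eta> * snd h $ i))) (at (\<xi>, \<eta>))"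
    "\<And>\<xi> \<eta>. ((\<lambda>x. g (fst x) (snd x)) has_derivative
      (\<lambda>h. (\<Sum>i\<in>UNIV. g1 i \<xi> \<eta> * fst h $ i) + (\<Sum>i\<in>UNIV. g2 i \<xi> \<eta> * snd h $ i))) (at (\<xi>, \<eta>))"
    by blast
  have "((\<lambda>x. f (fst x) (snd x) * g (fst x) (snd x)) has_derivative
     (\<lambda>h. (\<Sum>i\<in>UNIV. (f1 i \<xi> \<eta> * g \<xi> \<eta> + f \<xi> \<eta> * g1 i \<xi> \<eta>) * fst h $ i)
       + (\<Sum>i\<in>UNIV. (f2 i \<xi> \<eta> * g \<xi> \<eta> + f \<xi> \<eta> * g2 i \<xi> \<eta>) * snd h $ i))) (at (\<xi>, \<eta>))" for \<xi> \<eta>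
    by (rule has_derivative_eq_rhs[OF has_derivative_mult[OF *(5,6)]])
       (simp add: fun_eq_iff algebra_simps sum.distrib sum_distrib_left)
  then show ?case
    using * mult.hyps
    by (intro exI[of _ "\<lambda>i \<xi> \<eta>. f1 i \<xi> \<eta> * g \<xi> \<eta> + f \<xi> \<eta> * g1 i \<xi> \<eta>"]
         exI[of _ "\<lambda>i \<xi> \<eta>. f2 i \<xi> \<eta> * g \<xi> \<eta> + f \<xi> \<eta> * g2 i \<xi> \<eta>"]) (auto intro!: bipoly.intros)
qed

text \<open>The partial derivatives are again asked to be \<open>bipoly\<close>, because the mixed
  second derivative of a logarithm requires differentiating them once more.\<close>

definition has_partials ::
  "(complex ^ 'n \<Rightarrow> complex ^ 'n \<Rightarrow> complex) \<Rightarrow> ('n \<Rightarrow> complex ^ 'n \<Rightarrow> complex ^ 'n \<Rightarrow> complex) \<Rightarrow>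
   ('n \<Rightarrow> complex ^ 'n \<Rightarrow> complex ^ 'n \<Rightarrow> complex) \<Rightarrow> bool" where
  "has_partials f f1 f2 \<longleftrightarrow> (\<forall>i. bipoly (f1 i)) \<and> (\<forall>i. bipoly (f2 i)) \<and>
    (\<forall>\<xi> \<eta>. ((\<lambda>x. f (fst x) (snd x)) has_derivative
      (\<lambda>h. (\<Sum>i\<in>UNIV. f1 i \<xi> \<eta> * fst h $ i) + (\<Sum>i\<in>UNIV. f2 i \<xi> \<eta> * snd h $ i))) (at (\<xi>, \<eta>)))"

lemma bipoly_has_partials: "bipoly f \<Longrightarrow> \<exists>f1 f2. has_partials f f1 f2"
  unfolding has_partials_def by (rule bipoly_partial_derivatives)

lemma has_partials_compose:
  assumes "has_partials f f1 f2" "(X has_derivative X') (at p)" "(Y has_derivative Y') (at p)"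
  shows "((\<lambda>p. f (X p) (Y p)) has_derivative
    (\<lambda>h. (\<Sum>i\<in>UNIV. f1 i (X p) (Y p) * X' h $ i) + (\<Sum>i\<in>UNIV. f2 i (X p) (Y p) * Y' h $ i))) (at p)"
proof -
  have "((\<lambda>x. f (fst x) (snd x)) has_derivative
      (\<lambda>h. (\<Sum>i\<in>UNIV. f1 i (X p) (Y p) * fst h $ i) + (\<Sum>i\<in>UNIV. f2 i (X p) (Y p) * snd h $ i))) (at (X p, Y p))"
    using assms(1) by (auto simp: has_partials_def)
  from has_derivative_compose[OF has_derivative_Pair[OF assms(2,3)] this]
  show ?thesis by simp
qed

lemma has_partials_compose_field:
  assumes "has_partials f f1 f2" "\<And>i. ((\<lambda>z. X z $ i) has_field_derivative X' $ i) (at z)"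
    "\<And>i. ((\<lambda>z. Y z $ i) has_field_derivative Y' $ i) (at z)"
  shows "((\<lambda>z. f (X z) (Y z)) has_field_derivative
    (\<Sum>i\<in>UNIV. f1 i (X z) (Y z) * X' $ i) + (\<Sum>i\<in>UNIV. f2 i (X z) (Y z) * Y' $ i)) (at z)"
proof -
  have "(X has_derivative (\<lambda>h. h *s X')) (at z)" "(Y has_derivative (\<lambda>h. h *s Y')) (at z)"
    using assms(2,3) by (auto intro!: has_derivative_vecI simp: has_field_derivative_def mult.commute[of _ "_ $ _"])
  from has_partials_compose[OF assms(1) this] show ?thesis
    unfolding has_field_derivative_def
    by (rule has_derivative_eq_rhs) (simp add: fun_eq_iff algebra_simps sum_distrib_left)
qed

lemma bipoly_holomorphic:
  assumes "bipoly f" "\<And>i. (\<lambda>s. X s $ i) holomorphic_on S" "\<And>i. (\<lambda>s. Y s $ i) holomorphic_on S"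
  shows "(\<lambda>s. f (X s) (Y s)) holomorphic_on S"
  using assms(1) by induction (auto intro!: holomorphic_intros assms)

lemma bipoly_continuous:
  assumes "bipoly f" "\<And>i. continuous_on S (\<lambda>s. X s $ i)" "\<And>i. continuous_on S (\<lambda>s. Y s $ i)"
  shows "continuous_on S (\<lambda>s. f (X s) (Y s))"
  using assms(1) by induction (auto intro!: continuous_intros assms)

lemma bipoly_poly_along:
  assumes "bipoly f" shows "\<exists>d. (\<lambda>z. f (G z) \<eta>) \<in> poly_along G d"
  using assms
proof induction
  case (add f g)
  then obtain d e where "(\<lambda>z. f (G z) \<eta>) \<in> poly_along G d" "(\<lambda>z. g (G z) \<eta>) \<in> poly_along G e" by blast
  then show ?case by (intro exI[of _ "d + e"] poly_along_add) (auto elim: poly_along_mono)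
next
  case (mult f g)
  then show ?case using poly_along_mult by blast
qed (auto intro: poly_along_const poly_along_coord)

section \<open>Wirtinger derivatives and values of forms on complex tangent vectors\<close>

lemma wirtinger_of_has_derivative:
  assumes "(u has_derivative (\<lambda>h. (\<Sum>i\<in>UNIV. a i * h $ i) + (\<Sum>i\<in>UNIV. b i * cnj (h $ i)))) (at p)"
  shows "wirtinger j u p = a j" "wirtinger_bar j u p = b j"
proof -
  have "frechet_derivative u (at p) = (\<lambda>h. (\<Sum>i\<in>UNIV. a i * h $ i) + (\<Sum>i\<in>UNIV. b i * cnj (h $ i)))"
    using frechet_derivative_at[OF assms] by simp
  moreover have "(\<Sum>i\<in>UNIV. c i * axis j x $ i) = c j * x" "(\<Sum>i\<in>UNIV. c i * cnj (axis j x $ i)) = c j * cnj x" for c x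
  proof -
    have "(\<Sum>i\<in>UNIV. c i * axis j x $ i) = (\<Sum>i\<in>UNIV. if i = j then c j * x else 0)"
      "(\<Sum>i\<in>UNIV. c i * cnj (axis j x $ i)) = (\<Sum>i\<in>UNIV. if i = j then c j * cnj x else 0)"
      by (intro sum.cong; auto simp: axis_def)+
    then show "(\<Sum>i\<in>UNIV. c i * axis j x $ i) = c j * x" "(\<Sum>i\<in>UNIV. c i * cnj (axis j x $ i)) = c j * cnj x" by simp_all
  qed
  \<comment> \<open>The directions \<open>axis j 1\<close> and \<open>axis j \<i>\<close> separate
    the linear part from the antilinear one, because conjugation changes the sign of
    \<open>\<i>\<close>.\<close>
  ultimately show "wirtinger j u p = a j" "wirtinger_bar j u p = b j"
    by (simp_all add: wirtinger_def wirtinger_bar_def algebra_simps)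
qed

lemma has_derivative_cnjv: "(cnjv has_derivative cnjv) (at p)"
  by (rule has_derivative_vecI) (auto intro!: has_derivative_cnj has_derivative_component)

lemma bipoly_diagonal_has_derivative:
  assumes "has_partials f f1 f2"
  shows "((\<lambda>q. f q (cnjv q)) has_derivative
     (\<lambda>h. (\<Sum>i\<in>UNIV. f1 i p (cnjv p) * h $ i) + (\<Sum>i\<in>UNIV. f2 i p (cnjv p) * cnj (h $ i)))) (at p)"
  using has_partials_compose[OF assms has_derivative_ident has_derivative_cnjv, of p] by simp

text \<open>For \<open>w = \<i> *s v\<close> the bracket
  \<open>v $ j * cnj (w $ k) - w $ j * cnj (v $ k)\<close> equals
  \<open>- 2 * \<i> * (v $ j * cnj (v $ k))\<close>, so the alternating form becomes twice a
  Hermitian form. On a plane domain the pair \<open>1\<close>, \<open>\<i>\<close> already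
  determines a 2-form, so nothing is lost.\<close>

lemma i_ddbar_diagonal:
  assumes "\<And>j k. wirtinger j (wirtinger_bar k (\<lambda>q. complex_of_real (\<phi> q))) p = c j k"
  shows "i_ddbar \<phi> p v (\<i> *s v) = 2 * (\<Sum>j\<in>UNIV. \<Sum>k\<in>UNIV. c j k * v $ j * cnj (v $ k))"
proof -
  have "i_ddbar \<phi> p v (\<i> *s v) = \<i> * (\<Sum>j\<in>UNIV. \<Sum>k\<in>UNIV. (- 2 * \<i>) * (c j k * v $ j * cnj (v $ k)))"
    unfolding i_ddbar_def assms by (intro arg_cong[of _ _ "(*) \<i>"] sum.cong refl) (simp add: algebra_simps)
  also have "\<dots> = \<i> * ((- 2 * \<i>) * (\<Sum>j\<in>UNIV. \<Sum>k\<in>UNIV. c j k * v $ j * cnj (v $ k)))"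
    by (simp only: sum_distrib_left)
  moreover have "\<i> * ((- 2 * \<i>) * w) = 2 * w" for w by simp
  ultimately show ?thesis by (simp only:)
qed

lemma wirtinger_cong_open:
  assumes "open S" "p \<in> S" "\<And>q. q \<in> S \<Longrightarrow> u q = v q"
  shows "wirtinger j u p = wirtinger j v p" "wirtinger_bar j u p = wirtinger_bar j v p"
proof -
  have "(u has_derivative d) (at p) \<longleftrightarrow> (v has_derivative d) (at p)" for d
    using assms by (metis has_derivative_transform_within_open)
  then have "frechet_derivative u (at p) = frechet_derivative v (at p)"
    by (simp add: frechet_derivative_def)
  then show "wirtinger j u p = wirtinger j v p" "wirtinger_bar j u p = wirtinger_bar j v p"
    by (simp_all add: wirtinger_def wirtinger_bar_def)
qed

lemma euclidean_form_diagonal: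
  fixes p v :: "complex ^ 'n"
  shows "euclidean_form p v (\<i> *s v) = 2 * (\<Sum>j\<in>UNIV. v $ j * cnj (v $ j))"
proof -
  define q :: "complex ^ 'n \<Rightarrow> complex ^ 'n \<Rightarrow> complex" where "q \<xi> \<eta> = (\<Sum>i\<in>UNIV. \<xi> $ i * \<eta> $ i)" for \<xi> \<eta>
  have eq: "(\<lambda>z. complex_of_real (\<Sum>i\<in>UNIV. (cmod (z $ i))\<^sup>2)) = (\<lambda>z :: complex ^ 'n. q z (cnjv z))"
    by (simp add: q_def fun_eq_iff flip: complex_norm_square)
  have bar: "wirtinger_bar k (\<lambda>z. complex_of_real (\<Sum>i\<in>UNIV. (cmod (z $ i))\<^sup>2)) = (\<lambda>z :: complex ^ 'n. z $ k)" for k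
  proof
    fix z :: "complex ^ 'n"
    have "((\<lambda>z. q z (cnjv z)) has_derivative
        (\<lambda>h. (\<Sum>i\<in>UNIV. cnj (z $ i) * h $ i) + (\<Sum>i\<in>UNIV. z $ i * cnj (h $ i)))) (at z)"
      unfolding q_def
      by (auto intro!: derivative_eq_intros has_derivative_component simp: sum.distrib algebra_simps)
    from wirtinger_of_has_derivative(2)[OF this]
    show "wirtinger_bar k (\<lambda>z. complex_of_real (\<Sum>i\<in>UNIV. (cmod (z $ i))\<^sup>2)) z = z $ k"
      unfolding eq .
  qed
  have "wirtinger j (\<lambda>z. z $ k) p = (if j = k then 1 else 0)" for j k
  proof -
    have *: "(\<Sum>i\<in>UNIV. (if i = k then 1 else 0) * h $ i) = h $ k" for h :: "complex ^ 'n"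
      by (simp add: if_distrib[of "\<lambda>c. c * _"] cong: if_cong)
    have "((\<lambda>z. z $ k) has_derivative
      (\<lambda>h. (\<Sum>i\<in>UNIV. (if i = k then 1 else 0) * h $ i) + (\<Sum>i\<in>UNIV. 0 * cnj (h $ i)))) (at p)"
      unfolding * by (auto intro!: derivative_eq_intros has_derivative_component)
    from wirtinger_of_has_derivative(1)[OF this] show ?thesis .
  qed
  then have "euclidean_form p v (\<i> *s v) = 2 * (\<Sum>j\<in>UNIV. \<Sum>k\<in>UNIV. (if j = k then 1 else 0) * v $ j * cnj (v $ k))"
    unfolding euclidean_form_def by (intro i_ddbar_diagonal) (simp only: bar)
  then show ?thesis by (simp add: if_distrib[of "\<lambda>c. c * _"] if_distribR cong: if_cong)
qed

text \<open>With \<open>z = z0 + s + \<i> * t\<close> and \<open>y = cnj z0 + s - \<i> * t\<close>,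
  real \<open>s\<close> and \<open>t\<close> give \<open>y = cnj z\<close>. The identity theorem in
  \<open>s\<close> for real \<open>t\<close>, and then in \<open>t\<close> for complex
  \<open>s\<close>, extends the vanishing to all \<open>s\<close> and \<open>t\<close>. Halving the
  radius keeps both points in the original balls, since \<open>norm s + norm t < r\<close>.
  Holomorphy of \<open>H\<close> is expressed by substituting functions of one variable, which is
  all that these two steps use.\<close>

lemma polarization:
  fixes H :: "complex \<Rightarrow> complex \<Rightarrow> complex"
  assumes hol: "\<And>S X Y. X holomorphic_on S \<Longrightarrow> Y holomorphic_on S \<Longrightarrow> X ` S \<subseteq> ball z0 r \<Longrightarrow>
      Y ` S \<subseteq> ball (cnj z0) r \<Longrightarrow> (\<lambda>s. H (X s) (Y s)) holomorphic_on S"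
    and diag: "\<And>z. z \<in> ball z0 r \<Longrightarrow> H z (cnj z) = 0"
    and zy: "z \<in> ball z0 (r / 2)" "y \<in> ball (cnj z0) (r / 2)"
  shows "H z y = 0"
proof -
  have r: "r > 0" using zy by (metis ball_eq_empty empty_iff half_gt_zero_iff not_le)
  define X where "X s t = z0 + s + \<i> * t" for s t
  define Y where "Y s t = cnj z0 + s - \<i> * t" for s t
  have XY: "X s t \<in> ball z0 r" "Y s t \<in> ball (cnj z0) r" if "s \<in> ball 0 (r / 2)" "t \<in> ball 0 (r / 2)" for s t
  proof -
    have le: "norm (s + \<i> * t) \<le> norm s + norm t" "norm (s - \<i> * t) \<le> norm s + norm t"
      using norm_triangle_ineq[of s "\<i> * t"] norm_triangle_ineq4[of s "\<i> * t"] by (simp_all add: norm_mult)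
    have "X s t = z0 + (s + \<i> * t)" "Y s t = cnj z0 + (s - \<i> * t)" by (simp_all add: X_def Y_def)
    moreover have "dist a (a + b) = norm b" for a b :: complex by (simp add: dist_norm)
    ultimately have "dist z0 (X s t) = norm (s + \<i> * t)" "dist (cnj z0) (Y s t) = norm (s - \<i> * t)"
      by simp_all
    with le show "X s t \<in> ball z0 r" "Y s t \<in> ball (cnj z0) r" using that by auto
  qed
  let ?S = "ball (0 :: complex) (r / 2)" and ?R = "\<real> \<inter> ball (0 :: complex) (r / 2)"
  have lim: "(0 :: complex) islimpt ?R"
    unfolding islimpt_approachable
  proof (intro allI impI)
    fix e :: real assume "e > 0"
    then show "\<exists>x\<in>?R. x \<noteq> 0 \<and> dist x 0 < e"
      using r by (intro bexI[of _ "of_real (min e r / 4)"]) auto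
  qed
  have cont: "f t = 0" if "f holomorphic_on ?S" "\<And>s. s \<in> ?R \<Longrightarrow> f s = 0" "t \<in> ?S" for f t
    using analytic_continuation[OF that(1) _ _ _ _ lim] that r by auto
  have 1: "H (X s t) (Y s t) = 0" if t: "t \<in> ?R" and s: "s \<in> ?S" for s t
  proof (rule cont[of "\<lambda>s. H (X s t) (Y s t)", OF _ _ s])
    show "(\<lambda>s. H (X s t) (Y s t)) holomorphic_on ?S"
      by (rule hol) (use XY t in \<open>auto simp: X_def Y_def intro!: holomorphic_intros\<close>)
    show "H (X s t) (Y s t) = 0" if "s \<in> ?R" for s
    proof -
      have "Y s t = cnj (X s t)" using t that by (auto simp: X_def Y_def Reals_def)
      then show ?thesis using diag XY t that by auto
    qed
  qed
  have 2: "H (X s t) (Y s t) = 0" if s: "s \<in> ?S" and t: "t \<in> ?S" for s t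
  proof (rule cont[of "\<lambda>t. H (X s t) (Y s t)", OF _ _ t])
    show "(\<lambda>t. H (X s t) (Y s t)) holomorphic_on ?S"
      by (rule hol) (use XY s in \<open>auto simp: X_def Y_def intro!: holomorphic_intros\<close>)
  qed (use 1 s in auto)
  define s where "s = ((z - z0) + (y - cnj z0)) / 2"
  define t where "t = ((z - z0) - (y - cnj z0)) / (2 * \<i>)"
  have "norm ((z - z0) + (y - cnj z0)) < r" "norm ((z - z0) - (y - cnj z0)) < r"
    using zy norm_triangle_ineq[of "z - z0" "y - cnj z0"] norm_triangle_ineq4[of "z - z0" "y - cnj z0"]
    by (auto simp: dist_norm norm_minus_commute)
  then have st: "s \<in> ?S" "t \<in> ?S" by (auto simp: s_def t_def norm_divide norm_mult)
  have "\<i> * (w / (2 * \<i>)) = w / 2" for w by simp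
  then have it: "\<i> * t = ((z - z0) - (y - cnj z0)) / 2" unfolding t_def .
  have half: "(a + b) / 2 + (a - b) / 2 = a" "(a + b) / 2 - (a - b) / 2 = b" for a b :: complex
    by (simp_all add: field_simps)
  have "X s t = z" "Y s t = y"
    unfolding X_def Y_def it s_def add.assoc add_diff_eq[symmetric] half by simp_all
  with 2[OF st] show ?thesis by simp
qed

lemma pullback_diagonal:
  assumes "\<And>i. ((\<lambda>z. F z $ i) has_field_derivative F' $ i) (at z)"
  shows "pullback F \<omega> z 1 \<i> = \<omega> (F z) F' (\<i> *s F')"
proof -
  have "(F has_derivative (\<lambda>h. h *s F')) (at z)"
    using assms by (auto intro!: has_derivative_vecI simp: has_field_derivative_def mult.commute[of _ "_ $ _"])
  from frechet_derivative_at[OF this, symmetric] show ?thesis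
    by (simp add: pullback_def)
qed

text \<open>\<open>log_hessian A A1 A2 A12\<close> is the mixed second derivative of \<open>log A\<close>.\<close>

definition log_hessian where
  "log_hessian A A1 A2 A12 \<xi> \<eta> = (A12 \<xi> \<eta> * A \<xi> \<eta> - A1 \<xi> \<eta> * A2 \<xi> \<eta>) / (A \<xi> \<eta>)\<^sup>2"
  for A A1 A2 A12 :: "complex ^ 'n \<Rightarrow> complex ^ 'n \<Rightarrow> complex"

text \<open>Complex logarithms of \<open>A\<close> and \<open>B\<close> need not exist, so
  \<open>log A - log B\<close> is used only through its differential: a quotient that is real and
  positive on the diagonal has the differential of its real logarithm equal to
  \<open>DA / A - DB / B\<close>, from which the Wirtinger derivatives are read off.\<close>

lemma wirtinger_log_rational:
  fixes A B :: "complex ^ 'n \<Rightarrow> complex ^ 'n \<Rightarrow> complex" and u :: "complex ^ 'n \<Rightarrow> real"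
  assumes \<Omega>: "open \<Omega>" "p \<in> \<Omega>"
    and A: "has_partials A A1 A2" "\<And>k. has_partials (A2 k) (A12 k) (A22 k)"
    and B: "has_partials B B1 B2" "\<And>k. has_partials (B2 k) (B12 k) (B22 k)"
    and nz: "\<And>q. q \<in> \<Omega> \<Longrightarrow> A q (cnjv q) \<noteq> 0" "\<And>q. q \<in> \<Omega> \<Longrightarrow> B q (cnjv q) \<noteq> 0"
    and pos: "\<And>q. q \<in> \<Omega> \<Longrightarrow> Im (A q (cnjv q) / B q (cnjv q)) = 0" "\<And>q. q \<in> \<Omega> \<Longrightarrow> 0 < Re (A q (cnjv q) / B q (cnjv q))"
    and u: "\<And>q. q \<in> \<Omega> \<Longrightarrow> u q = ln (Re (A q (cnjv q) / B q (cnjv q)))"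
  shows "wirtinger j (wirtinger_bar k (\<lambda>q. complex_of_real (u q))) p =
    log_hessian A (A1 j) (A2 k) (A12 k j) p (cnjv p) - log_hessian B (B1 j) (B2 k) (B12 k j) p (cnjv p)"
proof -
  let ?A = "\<lambda>q. A q (cnjv q)" and ?B = "\<lambda>q. B q (cnjv q)"
  have bar: "wirtinger_bar k (\<lambda>q. complex_of_real (u q)) q = A2 k q (cnjv q) / ?A q - B2 k q (cnjv q) / ?B q"
    if q: "q \<in> \<Omega>" for q
  proof -
    define DA where "DA h = (\<Sum>i\<in>UNIV. A1 i q (cnjv q) * h $ i) + (\<Sum>i\<in>UNIV. A2 i q (cnjv q) * cnj (h $ i))" for h
    define DB where "DB h = (\<Sum>i\<in>UNIV. B1 i q (cnjv q) * h $ i) + (\<Sum>i\<in>UNIV. B2 i q (cnjv q) * cnj (h $ i))" for h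
    have dA: "(?A has_derivative DA) (at q)" unfolding DA_def by (rule bipoly_diagonal_has_derivative[OF A(1)])
    have dB: "(?B has_derivative DB) (at q)" unfolding DB_def by (rule bipoly_diagonal_has_derivative[OF B(1)])
    define K where "K q = ?A q / ?B q" for q
    define DK where "DK h = K q * (DA h / ?A q - DB h / ?B q)" for h
    have dK: "(K has_derivative DK) (at q)"
      unfolding K_def[abs_def] DK_def
      by (rule has_derivative_eq_rhs[OF has_derivative_divide'[OF dA dB]])
         (use nz q in \<open>auto simp: fun_eq_iff field_simps K_def\<close>)
    \<comment> \<open>\<open>K\<close> is real on the whole open set, so the imaginary part of its
      derivative vanishes and taking \<open>Re\<close> loses nothing.\<close>
    have "((\<lambda>q. Im (K q)) has_derivative (\<lambda>h. Im (DK h))) (at q)"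
      using dK by (rule has_derivative_Im)
    moreover have "((\<lambda>q. Im (K q)) has_derivative (\<lambda>h. 0)) (at q)"
      by (rule has_derivative_transform_within_open[of "\<lambda>_. 0" _ _ _ \<Omega>]) (use \<Omega> q pos in \<open>auto simp: K_def\<close>)
    ultimately have "(\<lambda>h. Im (DK h)) = (\<lambda>h. 0)" by (rule has_derivative_unique)
    then have Im: "Im (DK h) = 0" for h by meson
    have K: "K q = complex_of_real (Re (K q))" "Re (K q) > 0" using pos[OF q] by (auto simp: complex_eq_iff K_def)
    have "((\<lambda>q. ln (Re (K q))) has_derivative (\<lambda>h. Re (DK h) * inverse (Re (K q)))) (at q)"
      using has_derivative_ln[OF K(2) has_derivative_Re[OF dK]] .
    then have "((\<lambda>q. complex_of_real (ln (Re (K q)))) has_derivative (\<lambda>h. complex_of_real (Re (DK h) * inverse (Re (K q))))) (at q)"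
      by (rule has_derivative_of_real)
    then have "((\<lambda>q. complex_of_real (u q)) has_derivative (\<lambda>h. complex_of_real (Re (DK h) * inverse (Re (K q))))) (at q)"
      by (rule has_derivative_transform_within_open[OF _ \<Omega>(1) q]) (simp add: u K_def)
    moreover have "complex_of_real (Re (DK h) * inverse (Re (K q))) =
       (\<Sum>i\<in>UNIV. (A1 i q (cnjv q) / ?A q - B1 i q (cnjv q) / ?B q) * h $ i) +
       (\<Sum>i\<in>UNIV. (A2 i q (cnjv q) / ?A q - B2 i q (cnjv q) / ?B q) * cnj (h $ i))" for h
    proof -
      have ratio: "complex_of_real (Re x * inverse (Re y)) = x / y" if "Im x = 0" "Im y = 0" for x y
        using that by (simp add: complex_eq_iff Re_divide Im_divide field_simps power2_eq_square)
      have "complex_of_real (Re (DK h) * inverse (Re (K q))) = DK h / K q"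
        by (rule ratio) (use Im[of h] K(1) in \<open>auto simp: complex_eq_iff\<close>)
      also have "\<dots> = DA h / ?A q - DB h / ?B q" using K(2) by (auto simp: DK_def)
      finally show ?thesis by (simp add: DA_def DB_def add_divide_distrib sum_divide_distrib algebra_simps sum.distrib sum_subtractf)
    qed
    ultimately have "((\<lambda>q. complex_of_real (u q)) has_derivative (\<lambda>h.
       (\<Sum>i\<in>UNIV. (A1 i q (cnjv q) / ?A q - B1 i q (cnjv q) / ?B q) * h $ i) +
       (\<Sum>i\<in>UNIV. (A2 i q (cnjv q) / ?A q - B2 i q (cnjv q) / ?B q) * cnj (h $ i)))) (at q)"
      by simp
    from wirtinger_of_has_derivative(2)[OF this] show ?thesis .
  qed
  have quot: "((\<lambda>q. f q (cnjv q) / g q (cnjv q)) has_derivative (\<lambda>h.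
       (\<Sum>i\<in>UNIV. ((f1 i p (cnjv p) * g p (cnjv p) - f p (cnjv p) * g1 i p (cnjv p)) / (g p (cnjv p))\<^sup>2) * h $ i) +
       (\<Sum>i\<in>UNIV. ((f2 i p (cnjv p) * g p (cnjv p) - f p (cnjv p) * g2 i p (cnjv p)) / (g p (cnjv p))\<^sup>2) * cnj (h $ i)))) (at p)"
    if "has_partials f f1 f2" "has_partials g g1 g2" "g p (cnjv p) \<noteq> 0" for f g f1 f2 g1 g2
  proof -
    obtain w where w: "inverse ((g p (cnjv p))\<^sup>2) = w" by blast
    then have w': "inverse (g p (cnjv p) * g p (cnjv p)) = w" by (simp add: power2_eq_square)
    show ?thesis
      by (rule has_derivative_eq_rhs[OF has_derivative_divide'[OF bipoly_diagonal_has_derivative[OF that(1)]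
            bipoly_diagonal_has_derivative[OF that(2)] that(3)]])
         (simp only: fun_eq_iff divide_inverse w w' algebra_simps sum.distrib sum_distrib_left sum_subtractf, simp)
  qed
  have "wirtinger j (wirtinger_bar k (\<lambda>q. complex_of_real (u q))) p =
    wirtinger j (\<lambda>q. A2 k q (cnjv q) / ?A q - B2 k q (cnjv q) / ?B q) p"
    by (rule wirtinger_cong_open[OF \<Omega>]) (simp add: bar)
  also have "\<dots> = log_hessian A (A1 j) (A2 k) (A12 k j) p (cnjv p) - log_hessian B (B1 j) (B2 k) (B12 k j) p (cnjv p)"
  proof -
    have "((\<lambda>q. A2 k q (cnjv q) / ?A q - B2 k q (cnjv q) / ?B q) has_derivative (\<lambda>h.
      (\<Sum>i\<in>UNIV. ((A12 k i p (cnjv p) * ?A p - A2 k p (cnjv p) * A1 i p (cnjv p)) / (?A p)\<^sup>2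
         - (B12 k i p (cnjv p) * ?B p - B2 k p (cnjv p) * B1 i p (cnjv p)) / (?B p)\<^sup>2) * h $ i) +
      (\<Sum>i\<in>UNIV. ((A22 k i p (cnjv p) * ?A p - A2 k p (cnjv p) * A2 i p (cnjv p)) / (?A p)\<^sup>2
         - (B22 k i p (cnjv p) * ?B p - B2 k p (cnjv p) * B2 i p (cnjv p)) / (?B p)\<^sup>2) * cnj (h $ i)))) (at p)"
      by (rule has_derivative_eq_rhs[OF has_derivative_diff[OF quot[OF A(2)[of k] A(1) nz(1)[OF \<Omega>(2)]]
              quot[OF B(2)[of k] B(1) nz(2)[OF \<Omega>(2)]]]])
         (simp only: fun_eq_iff left_diff_distrib sum_subtractf add_diff_add, simp)
    from wirtinger_of_has_derivative(1)[OF this] show ?thesis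
      by (simp add: log_hessian_def mult.commute)
  qed
  finally show ?thesis .
qed

section \<open>Euclidean and rational potentials\<close>

lemma DERIV_cnj_cnj:
  assumes "(f has_field_derivative f') (at (cnj y))"
  shows "((\<lambda>y. cnj (f (cnj y))) has_field_derivative cnj f') (at y)"
  using has_field_derivative_cnj_cnj[of f f' y] assms by (simp add: o_def)

text \<open>Polarizing the equality of the two metrics gives, with \<open>k = A / B\<close> and with \<open>\<phi>\<close>, \<open>\<psi>\<close> the normalized \<open>F\<close>
  and its conjugate, \<open>exp (\<Sum>\<^sub>i \<phi>\<^sub>i(z) \<psi>\<^sub>i(y)) = k(z,y) k(z\<^sub>0,y\<^sub>0) / (k(z\<^sub>0,y) k(z,y\<^sub>0))\<close>.\<close>

lemma euclidean_rational_pullback_critical: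
  fixes F :: "complex \<Rightarrow> complex ^ 'm" and G :: "complex \<Rightarrow> complex ^ 'n"
    and A B :: "complex ^ 'n \<Rightarrow> complex ^ 'n \<Rightarrow> complex" and u :: "complex ^ 'n \<Rightarrow> real"
  assumes D: "open D" "z0 \<in> D"
    and F: "\<And>i. (\<lambda>z. F z $ i) holomorphic_on D"
    and G: "\<And>i. (\<lambda>z. G z $ i) holomorphic_on D"
    and \<Omega>: "open \<Omega>" "G ` D \<subseteq> \<Omega>"
    and AB: "bipoly A" "bipoly B"
    and nz: "\<And>q. q \<in> \<Omega> \<Longrightarrow> A q (cnjv q) \<noteq> 0" "\<And>q. q \<in> \<Omega> \<Longrightarrow> B q (cnjv q) \<noteq> 0"
    and pos: "\<And>q. q \<in> \<Omega> \<Longrightarrow> Im (A q (cnjv q) / B q (cnjv q)) = 0" "\<And>q. q \<in> \<Omega> \<Longrightarrow> 0 < Re (A q (cnjv q) / B q (cnjv q))"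
    and u: "\<And>q. q \<in> \<Omega> \<Longrightarrow> u q = ln (Re (A q (cnjv q) / B q (cnjv q)))"
    and eq: "\<And>z. z \<in> D \<Longrightarrow> pullback F euclidean_form z 1 \<i> = pullback G (i_ddbar u) z 1 \<i>"
  shows "deriv (\<lambda>z. F z $ i) z0 = 0"
proof -
  obtain A1 A2 where A: "has_partials A A1 A2" using bipoly_has_partials[OF AB(1)] by blast
  obtain B1 B2 where B: "has_partials B B1 B2" using bipoly_has_partials[OF AB(2)] by blast
  have bi: "bipoly (A1 k)" "bipoly (A2 k)" "bipoly (B1 k)" "bipoly (B2 k)" for k
    using A B by (auto simp: has_partials_def)
  have "\<forall>k. \<exists>f1 f2. has_partials (A2 k) f1 f2" "\<forall>k. \<exists>f1 f2. has_partials (B2 k) f1 f2"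
    using bi bipoly_has_partials by blast+
  then obtain A12 A22 B12 B22 where A12: "\<And>k. has_partials (A2 k) (A12 k) (A22 k)"
    and B12: "\<And>k. has_partials (B2 k) (B12 k) (B22 k)"
    by metis
  have bi2: "bipoly (A12 k j)" "bipoly (B12 k j)" for k j
    using A12 B12 by (auto simp: has_partials_def)
  define C where "C j k \<xi> \<eta> = log_hessian A (A1 j) (A2 k) (A12 k j) \<xi> \<eta> - log_hessian B (B1 j) (B2 k) (B12 k j) \<xi> \<eta>" for j k \<xi> \<eta>
  define F' where "F' z = (\<chi> i. deriv (\<lambda>z. F z $ i) z)" for z
  define G' where "G' z = (\<chi> i. deriv (\<lambda>z. G z $ i) z)" for z
  have dF: "((\<lambda>z. F z $ i) has_field_derivative F' z $ i) (at z)" if "z \<in> D" for z i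
    using holomorphic_derivI[OF F D(1) that] by (simp add: F'_def)
  have dG: "((\<lambda>z. G z $ i) has_field_derivative G' z $ i) (at z)" if "z \<in> D" for z i
    using holomorphic_derivI[OF G D(1) that] by (simp add: G'_def)
  have hol': "(\<lambda>z. F' z $ i) holomorphic_on D" "(\<lambda>z. G' z $ j) holomorphic_on D" for i j
    using holomorphic_deriv[OF F D(1)] holomorphic_deriv[OF G D(1)] by (auto simp: F'_def G'_def)
  have diag: "(\<Sum>i\<in>UNIV. F' z $ i * cnj (F' z $ i)) =
      (\<Sum>j\<in>UNIV. \<Sum>k\<in>UNIV. C j k (G z) (cnjv (G z)) * G' z $ j * cnj (G' z $ k))" if z: "z \<in> D" for z
  proof -
    have Gz: "G z \<in> \<Omega>" using z \<Omega> by blast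
    have w: "wirtinger j (wirtinger_bar k (\<lambda>q. complex_of_real (u q))) (G z) = C j k (G z) (cnjv (G z))" for j k
      unfolding C_def by (rule wirtinger_log_rational[OF \<Omega>(1) Gz A A12 B B12 nz pos u])
    have "pullback F euclidean_form z 1 \<i> = 2 * (\<Sum>i\<in>UNIV. F' z $ i * cnj (F' z $ i))"
      using pullback_diagonal[OF dF[OF z]] by (simp add: euclidean_form_diagonal)
    moreover have "pullback G (i_ddbar u) z 1 \<i> = 2 * (\<Sum>j\<in>UNIV. \<Sum>k\<in>UNIV. C j k (G z) (cnjv (G z)) * G' z $ j * cnj (G' z $ k))"
      using pullback_diagonal[OF dG[OF z]] by (simp add: i_ddbar_diagonal[OF w])
    ultimately show ?thesis using eq[OF z] by simp
  qed
  \<comment> \<open>The reflected curves \<open>y \<mapsto> cnj (F (cnj y))\<close> and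
    \<open>y \<mapsto> cnj (G (cnj y))\<close> are holomorphic near \<open>cnj z0\<close>, and at
    \<open>y = cnj z\<close> they are the conjugates of \<open>F z\<close> and
    \<open>G z\<close>.\<close>
  define y0 where "y0 = cnj z0"
  define Gs where "Gs y = cnjv (G (cnj y))" for y
  define Gs' where "Gs' y = cnjv (G' (cnj y))" for y
  define Fs where "Fs y = cnjv (F (cnj y))" for y
  define Fs' where "Fs' y = cnjv (F' (cnj y))" for y
  \<comment> \<open>Nonvanishing of \<open>A\<close> and \<open>B\<close> is given only when the
    second argument is the conjugate of the first; by continuity it persists for independent
    \<open>z\<close> and \<open>y\<close> close to \<open>z0\<close> and \<open>y0\<close>.\<close>
  obtain r where r: "r > 0" "ball z0 r \<subseteq> D"
    and rN: "\<And>z y. z \<in> ball z0 r \<Longrightarrow> y \<in> ball y0 r \<Longrightarrow> A (G z) (Gs y) \<noteq> 0"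
            "\<And>z y. z \<in> ball z0 r \<Longrightarrow> y \<in> ball y0 r \<Longrightarrow> B (G z) (Gs y) \<noteq> 0"
  proof -
    let ?P = "\<lambda>x. A (G (fst x)) (Gs (snd x)) * B (G (fst x)) (Gs (snd x))"
    have cG: "continuous_on D (\<lambda>z. G z $ i)" for i using G holomorphic_on_imp_continuous_on by blast
    obtain r0 where r0: "r0 > 0" "ball z0 r0 \<subseteq> D" using D openE by blast
    let ?U = "ball z0 r0 \<times> ball y0 r0"
    have sub: "fst ` ?U \<subseteq> D" "(\<lambda>x. cnj (snd x)) ` ?U \<subseteq> D"
    proof -
      have "dist z0 (cnj y) = dist y0 y" for y
        by (metis complex_cnj_cnj complex_cnj_diff complex_mod_cnj dist_norm y0_def)
      then show "fst ` ?U \<subseteq> D" "(\<lambda>x. cnj (snd x)) ` ?U \<subseteq> D" using r0(2) by (auto simp: subset_eq)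
    qed
    have c1: "continuous_on ?U (\<lambda>x. G (fst x) $ i)" for i
      by (rule continuous_on_compose2[OF cG _ sub(1)]) (intro continuous_on_fst continuous_on_id)
    have c2: "continuous_on ?U (\<lambda>x. Gs (snd x) $ i)" for i
      unfolding Gs_def cnjv_nth
      by (rule continuous_on_cnj, rule continuous_on_compose2[OF cG _ sub(2)])
         (intro continuous_on_cnj continuous_on_snd continuous_on_id)
    have "continuous_on ?U ?P"
      by (intro continuous_on_mult bipoly_continuous[OF AB(1)] bipoly_continuous[OF AB(2)] c1 c2)
    then have "open (?U \<inter> ?P -` (- {0}))"
      by (intro continuous_open_preimage) (auto intro: open_Times)
    moreover have "(z0, y0) \<in> ?U \<inter> ?P -` (- {0})"
      using r0 nz[of "G z0"] \<Omega>(2) D(2) by (auto simp: Gs_def y0_def)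
    ultimately obtain V W where "open V" "open W" "(z0, y0) \<in> V \<times> W" "V \<times> W \<subseteq> ?U \<inter> ?P -` (- {0})"
      by (rule open_prod_elim)
    then have VW: "open V" "open W" "z0 \<in> V" "y0 \<in> W" "V \<times> W \<subseteq> ?U \<inter> ?P -` (- {0})"
      by auto
    obtain r1 r2 where "r1 > 0" "ball z0 r1 \<subseteq> V" "r2 > 0" "ball y0 r2 \<subseteq> W" using VW openE by metis
    moreover have "V \<subseteq> D" using VW(4,5) r0(2) by blast
    ultimately have "min r1 r2 > 0" "ball z0 (min r1 r2) \<subseteq> V" "ball y0 (min r1 r2) \<subseteq> W" "V \<subseteq> D" by auto
    moreover have "A (G z) (Gs y) \<noteq> 0 \<and> B (G z) (Gs y) \<noteq> 0" if "z \<in> V" "y \<in> W" for z y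
      using VW(5) that by auto
    ultimately show ?thesis by (intro that[of "min r1 r2"]) blast+
  qed
  have cnjD: "cnj y \<in> ball z0 r" if "y \<in> ball y0 r" for y
    using that by (simp add: y0_def dist_norm) (metis complex_cnj_cnj complex_cnj_diff complex_mod_cnj)
  have dFs: "((\<lambda>y. Fs y $ i) has_field_derivative Fs' y $ i) (at y)" if "y \<in> ball y0 r" for y i
    using DERIV_cnj_cnj[OF dF, of y i] cnjD[OF that] r(2) by (auto simp: Fs_def Fs'_def)
  have dGs: "((\<lambda>y. Gs y $ i) has_field_derivative Gs' y $ i) (at y)" if "y \<in> ball y0 r" for y i
    using DERIV_cnj_cnj[OF dG, of y i] cnjD[OF that] r(2) by (auto simp: Gs_def Gs'_def)
  \<comment> \<open>The difference of the two pulled back metrics with \<open>cnj z\<close> replaced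
    by an independent variable \<open>y\<close>.\<close>
  define H where "H z y = (\<Sum>i\<in>UNIV. F' z $ i * Fs' y $ i) -
      (\<Sum>j\<in>UNIV. \<Sum>k\<in>UNIV. C j k (G z) (Gs y) * G' z $ j * Gs' y $ k)" for z y
  have H0: "H z y = 0" if "z \<in> ball z0 (r / 2)" "y \<in> ball y0 (r / 2)" for z y
  proof (rule polarization[of z0 r H])
    fix S and X Y :: "complex \<Rightarrow> complex"
    assume X: "X holomorphic_on S" "X ` S \<subseteq> ball z0 r" and Y: "Y holomorphic_on S" "Y ` S \<subseteq> ball (cnj z0) r"
    have comp: "(\<lambda>s. f (X s)) holomorphic_on S" if "f holomorphic_on D" for f
      using holomorphic_on_compose_gen[OF X(1) that] X(2) r(2) by (auto simp: o_def)
    have comps: "(\<lambda>s. f (Y s)) holomorphic_on S" if "\<And>y. y \<in> ball y0 r \<Longrightarrow> (f has_field_derivative f' y) (at y)" for f f'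
    proof -
      have "f holomorphic_on ball y0 r"
        unfolding holomorphic_on_open[OF open_ball] using that by blast
      from holomorphic_on_compose_gen[OF Y(1) this] Y(2) show ?thesis by (simp add: o_def y0_def)
    qed
    have Fs'h: "(\<lambda>s. Fs' (Y s) $ i) holomorphic_on S" for i
    proof (rule comps)
      fix y assume y: "y \<in> ball y0 r"
      then have "((\<lambda>z. F' z $ i) has_field_derivative deriv (\<lambda>z. F' z $ i) (cnj y)) (at (cnj y))"
        using holomorphic_derivI[OF hol'(1) D(1)] cnjD r(2) by blast
      from DERIV_cnj_cnj[OF this] show "((\<lambda>y. Fs' y $ i) has_field_derivative cnj (deriv (\<lambda>z. F' z $ i) (cnj y))) (at y)"
        by (simp add: Fs'_def)
    qed
    have Gs'h: "(\<lambda>s. Gs' (Y s) $ i) holomorphic_on S" for i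
    proof (rule comps)
      fix y assume y: "y \<in> ball y0 r"
      then have "((\<lambda>z. G' z $ i) has_field_derivative deriv (\<lambda>z. G' z $ i) (cnj y)) (at (cnj y))"
        using holomorphic_derivI[OF hol'(2) D(1)] cnjD r(2) by blast
      from DERIV_cnj_cnj[OF this] show "((\<lambda>y. Gs' y $ i) has_field_derivative cnj (deriv (\<lambda>z. G' z $ i) (cnj y))) (at y)"
        by (simp add: Gs'_def)
    qed
    have Gsh: "(\<lambda>s. Gs (Y s) $ i) holomorphic_on S" for i
      by (rule comps[OF dGs])
    have AB0: "A (G (X s)) (Gs (Y s)) \<noteq> 0" "B (G (X s)) (Gs (Y s)) \<noteq> 0" if "s \<in> S" for s
      using rN[of "X s" "Y s"] X(2) Y(2) that unfolding y0_def by blast+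
    show "(\<lambda>s. H (X s) (Y s)) holomorphic_on S"
      unfolding H_def C_def log_hessian_def
      by (intro holomorphic_on_diff holomorphic_on_sum holomorphic_on_mult holomorphic_on_divide holomorphic_on_power
           bipoly_holomorphic[OF AB(1)] bipoly_holomorphic[OF AB(2)] bipoly_holomorphic[OF bi(1)] bipoly_holomorphic[OF bi(2)]
           bipoly_holomorphic[OF bi(3)] bipoly_holomorphic[OF bi(4)] bipoly_holomorphic[OF bi2(1)] bipoly_holomorphic[OF bi2(2)]
           comp[OF G] comp[OF hol'(1)] comp[OF hol'(2)] Fs'h Gs'h Gsh)
         (use AB0 in auto)
  next
    fix z assume "z \<in> ball z0 r"
    then show "H z (cnj z) = 0" using diag[of z] r(2) by (auto simp: H_def Fs'_def Gs'_def Gs_def)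
  qed (use that in \<open>auto simp: y0_def\<close>)
  define \<rho> where "\<rho> = r / 2"
  have \<rho>: "\<rho> > 0" using r by (simp add: \<rho>_def)
  have \<rho>r: "z \<in> ball z0 r" if "z \<in> ball z0 \<rho>" for z using that r(1) by (auto simp: \<rho>_def)
  have \<rho>r': "y \<in> ball y0 r" if "y \<in> ball y0 \<rho>" for y using that r(1) by (auto simp: \<rho>_def)
  have z0: "z0 \<in> ball z0 \<rho>" "y0 \<in> ball y0 \<rho>" using \<rho> by auto
  \<comment> \<open>This is the logarithmic derivative in \<open>y\<close> of the quotient
    \<open>A / B\<close> along the two curves; differentiating it in \<open>z\<close> gives the
    mixed derivative that polarization has identified.\<close>
  define N where "N z y = (\<Sum>k\<in>UNIV. (A2 k (G z) (Gs y) / A (G z) (Gs y) - B2 k (G z) (Gs y) / B (G z) (Gs y)) * Gs' y $ k)" for z y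
  have dN: "((\<lambda>z. N z y) has_field_derivative (\<Sum>i\<in>UNIV. F' z $ i * Fs' y $ i)) (at z)"
    if z: "z \<in> ball z0 \<rho>" and y: "y \<in> ball y0 \<rho>" for z y
  proof -
    have zD: "z \<in> D" using \<rho>r[OF z] r(2) by blast
    have part: "((\<lambda>z. f (G z) (Gs y)) has_field_derivative (\<Sum>j\<in>UNIV. f1 j (G z) (Gs y) * G' z $ j)) (at z)"
      if "has_partials f f1 f2" for f f1 f2
      using has_partials_compose_field[OF that dG[OF zD], of "\<lambda>_. Gs y" 0] by simp
    have quot: "((\<lambda>z. f2 (G z) (Gs y) / f (G z) (Gs y)) has_field_derivative
        (\<Sum>j\<in>UNIV. log_hessian f (f1 j) f2 (f12 j) (G z) (Gs y) * G' z $ j)) (at z)"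
      if "has_partials f f1 g2" "has_partials f2 f12 f22" "f (G z) (Gs y) \<noteq> 0" for f f1 f2 f12 f22 g2
    proof (rule DERIV_cong[OF DERIV_divide[OF part[OF that(2)] part[OF that(1)] that(3)]])
      obtain w where w: "inverse ((f (G z) (Gs y))\<^sup>2) = w" by blast
      then have w': "inverse (f (G z) (Gs y) * f (G z) (Gs y)) = w" by (simp add: power2_eq_square)
      show "((\<Sum>j\<in>UNIV. f12 j (G z) (Gs y) * G' z $ j) * f (G z) (Gs y) -
          f2 (G z) (Gs y) * (\<Sum>j\<in>UNIV. f1 j (G z) (Gs y) * G' z $ j)) / (f (G z) (Gs y) * f (G z) (Gs y)) =
        (\<Sum>j\<in>UNIV. log_hessian f (f1 j) f2 (f12 j) (G z) (Gs y) * G' z $ j)"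
        unfolding log_hessian_def
        by (simp only: divide_inverse w w' algebra_simps sum_distrib_left sum_subtractf)
    qed
    have "((\<lambda>z. N z y) has_field_derivative (\<Sum>k\<in>UNIV. ((\<Sum>j\<in>UNIV. log_hessian A (A1 j) (A2 k) (A12 k j) (G z) (Gs y) * G' z $ j)
        - (\<Sum>j\<in>UNIV. log_hessian B (B1 j) (B2 k) (B12 k j) (G z) (Gs y) * G' z $ j)) * Gs' y $ k)) (at z)"
      unfolding N_def
      by (intro DERIV_sum DERIV_cmult_right DERIV_diff quot[OF A A12] quot[OF B B12] rN \<rho>r z \<rho>r' y)
    moreover have "(\<Sum>k\<in>UNIV. ((\<Sum>j\<in>UNIV. log_hessian A (A1 j) (A2 k) (A12 k j) (G z) (Gs y) * G' z $ j)
        - (\<Sum>j\<in>UNIV. log_hessian B (B1 j) (B2 k) (B12 k j) (G z) (Gs y) * G' z $ j)) * Gs' y $ k)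
      = (\<Sum>k\<in>UNIV. \<Sum>j\<in>UNIV. C j k (G z) (Gs y) * G' z $ j * Gs' y $ k)"
      by (simp add: C_def sum_distrib_right left_diff_distrib flip: sum_subtractf)
    moreover have "\<dots> = (\<Sum>j\<in>UNIV. \<Sum>k\<in>UNIV. C j k (G z) (Gs y) * G' z $ j * Gs' y $ k)"
      by (rule sum.swap)
    moreover have "\<dots> = (\<Sum>i\<in>UNIV. F' z $ i * Fs' y $ i)"
      using H0[of z y] z y by (simp add: H_def \<rho>_def)
    ultimately show ?thesis by simp
  qed
  define \<phi> where "\<phi> z = F z - F z0" for z
  define \<psi> where "\<psi> y = Fs y - Fs y0" for y
  have d\<phi>: "((\<lambda>z. \<phi> z $ i) has_field_derivative F' z $ i) (at z)" if "z \<in> ball z0 \<rho>" for z i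
    unfolding \<phi>_def using \<rho>r[OF that] r(2) by (auto intro!: derivative_eq_intros dF)
  have d\<psi>: "((\<lambda>y. \<psi> y $ i) has_field_derivative Fs' y $ i) (at y)" if "y \<in> ball y0 \<rho>" for y i
    unfolding \<psi>_def using \<rho>r'[OF that] by (auto intro!: derivative_eq_intros dFs)
  \<comment> \<open>First integration, in \<open>z\<close>: both sides have the same derivative and
    vanish at \<open>z0\<close>.\<close>
  have Ndiff: "N z y - N z0 y = (\<Sum>i\<in>UNIV. \<phi> z $ i * Fs' y $ i)" if z: "z \<in> ball z0 \<rho>" and y: "y \<in> ball y0 \<rho>" for z y
  proof -
    have "\<exists>c. \<forall>z\<in>ball z0 \<rho>. N z y - (\<Sum>i\<in>UNIV. \<phi> z $ i * Fs' y $ i) = c"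
    proof (rule has_field_derivative_zero_constant)
      fix z assume "z \<in> ball z0 \<rho>"
      then have "((\<lambda>z. N z y - (\<Sum>i\<in>UNIV. \<phi> z $ i * Fs' y $ i)) has_field_derivative
         (\<Sum>i\<in>UNIV. F' z $ i * Fs' y $ i) - (\<Sum>i\<in>UNIV. F' z $ i * Fs' y $ i)) (at z)"
        by (intro DERIV_diff dN y DERIV_sum DERIV_cmult_right d\<phi>)
      then show "((\<lambda>z. N z y - (\<Sum>i\<in>UNIV. \<phi> z $ i * Fs' y $ i)) has_field_derivative 0) (at z within ball z0 \<rho>)"
        by (simp add: has_field_derivative_at_within)
    qed simp
    then have "N z y - (\<Sum>i\<in>UNIV. \<phi> z $ i * Fs' y $ i) = N z0 y - (\<Sum>i\<in>UNIV. \<phi> z0 $ i * Fs' y $ i)"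
      using z z0 by metis
    moreover have "(\<Sum>i\<in>UNIV. \<phi> z0 $ i * Fs' y $ i) = 0" by (simp add: \<phi>_def)
    ultimately show ?thesis by (simp add: algebra_simps)
  qed
  define K where "K z y = A (G z) (Gs y) / B (G z) (Gs y)" for z y
  have K0: "K z y \<noteq> 0" if "z \<in> ball z0 \<rho>" "y \<in> ball y0 \<rho>" for z y
    using rN[OF \<rho>r \<rho>r'] that by (simp add: K_def)
  have dK: "((\<lambda>y. K z y) has_field_derivative K z y * N z y) (at y)" if z: "z \<in> ball z0 \<rho>" and y: "y \<in> ball y0 \<rho>" for z y
  proof -
    have part: "((\<lambda>y. f (G z) (Gs y)) has_field_derivative (\<Sum>j\<in>UNIV. f2 j (G z) (Gs y) * Gs' y $ j)) (at y)"
      if "has_partials f f1 f2" for f f1 f2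
      using has_partials_compose_field[OF that, of "\<lambda>_. G z" 0 _ Gs "Gs' y"] dGs[OF \<rho>r'[OF y]] by simp
    have nzAB: "A (G z) (Gs y) \<noteq> 0" "B (G z) (Gs y) \<noteq> 0" using rN[OF \<rho>r[OF z] \<rho>r'[OF y]] by auto
    have Nz: "N z y = (\<Sum>k\<in>UNIV. A2 k (G z) (Gs y) * Gs' y $ k) / A (G z) (Gs y) - (\<Sum>k\<in>UNIV. B2 k (G z) (Gs y) * Gs' y $ k) / B (G z) (Gs y)"
      by (simp add: N_def sum_divide_distrib left_diff_distrib sum_subtractf)
    have alg: "(a' * b - a * b') / (b * b) = a / b * (a' / a - b' / b)" if "a \<noteq> 0" "b \<noteq> 0" for a a' b b' :: complex
      using that by (simp add: field_simps)
    show ?thesis unfolding K_def Nz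
      by (rule DERIV_cong[OF DERIV_divide[OF part[OF A] part[OF B] nzAB(2)] alg[OF nzAB]])
  qed
  have id: "exp (\<Sum>i\<in>UNIV. \<phi> z $ i * \<psi> y $ i) = K z y * K z0 y0 / (K z0 y * K z y0)"
    if z: "z \<in> ball z0 \<rho>" and y: "y \<in> ball y0 \<rho>" for z y
  proof -
    \<comment> \<open>Second integration, in \<open>y\<close>, carried out multiplicatively so that
      no branch of a logarithm is chosen: the logarithmic derivative of \<open>E\<close> is the
      difference that \<open>Ndiff\<close> shows to be zero.\<close>
    define E where "E y = K z y / K z0 y * exp (- (\<Sum>i\<in>UNIV. \<phi> z $ i * \<psi> y $ i))" for y
    have "\<exists>c. \<forall>y\<in>ball y0 \<rho>. E y = c"
    proof (rule has_field_derivative_zero_constant)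
      fix y assume y: "y \<in> ball y0 \<rho>"
      have "(E has_field_derivative (K z y * N z y * K z0 y - K z y * (K z0 y * N z0 y)) / (K z0 y * K z0 y) * exp (- (\<Sum>i\<in>UNIV. \<phi> z $ i * \<psi> y $ i))
         + exp (- (\<Sum>i\<in>UNIV. \<phi> z $ i * \<psi> y $ i)) * (- (\<Sum>i\<in>UNIV. \<phi> z $ i * Fs' y $ i)) * (K z y / K z0 y)) (at y)"
        unfolding E_def
        by (intro DERIV_mult DERIV_divide dK z y z0 K0 DERIV_chain2[OF DERIV_exp] DERIV_minus DERIV_sum DERIV_cmult d\<psi>)
      also have "(K z y * N z y * K z0 y - K z y * (K z0 y * N z0 y)) / (K z0 y * K z0 y) * exp (- (\<Sum>i\<in>UNIV. \<phi> z $ i * \<psi> y $ i))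
         + exp (- (\<Sum>i\<in>UNIV. \<phi> z $ i * \<psi> y $ i)) * (- (\<Sum>i\<in>UNIV. \<phi> z $ i * Fs' y $ i)) * (K z y / K z0 y)
         = E y * ((N z y - N z0 y) - (\<Sum>i\<in>UNIV. \<phi> z $ i * Fs' y $ i))"
        using K0[OF z0(1) y] by (simp add: E_def field_simps)
      also have "\<dots> = 0" by (simp add: Ndiff[OF z y])
      finally show "(E has_field_derivative 0) (at y within ball y0 \<rho>)"
        by (rule has_field_derivative_at_within)
    qed simp
    then have "E y = E y0" using y z0 by metis
    also have "E y0 = K z y0 / K z0 y0" by (simp add: E_def \<psi>_def)
    finally have "K z y / K z0 y * exp (- (\<Sum>i\<in>UNIV. \<phi> z $ i * \<psi> y $ i)) = K z y0 / K z0 y0" by (simp add: E_def)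
    then show ?thesis using K0[OF z y] K0[OF z0(1) y] K0[OF z z0(2)] K0[OF z0]
      by (simp add: exp_minus field_simps)
  qed
  have ratK: "(\<lambda>z. K z y) \<in> rat_along G (ball z0 \<rho>)" if y: "y \<in> ball y0 \<rho>" for y
  proof -
    obtain d where d: "(\<lambda>z. A (G z) (Gs y)) \<in> poly_along G d" using bipoly_poly_along[OF AB(1)] by blast
    obtain e where e: "(\<lambda>z. B (G z) (Gs y)) \<in> poly_along G e" using bipoly_poly_along[OF AB(2)] by blast
    have "(\<lambda>z. A (G z) (Gs y)) \<in> poly_along G (d + e)" "(\<lambda>z. B (G z) (Gs y)) \<in> poly_along G (d + e)"
      using poly_along_mono[OF d] poly_along_mono[OF e] by auto
    moreover have "\<forall>z\<in>ball z0 \<rho>. B (G z) (Gs y) \<noteq> 0 \<and> K z y * B (G z) (Gs y) = A (G z) (Gs y)"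
      using rN(2)[OF \<rho>r \<rho>r'[OF y]] by (auto simp: K_def)
    ultimately show ?thesis unfolding rat_along_def by blast
  qed
  have "(\<Sum>i\<in>UNIV. F' z0 $ i * Fs' y0 $ i) = 0"
  proof (rule exp_inner_rational_imp_critical[OF \<rho> d\<phi> _ d\<psi>])
    show "continuous_on (ball z0 \<rho>) (\<lambda>z. F' z $ i)" for i
      using holomorphic_on_imp_continuous_on[OF hol'(1)] r(2) \<rho>r by (metis continuous_on_subset subsetI subset_trans)
    fix y assume y: "y \<in> ball y0 \<rho>"
    have "(\<lambda>z. c) \<in> rat_along G (ball z0 \<rho>)" for c
      unfolding rat_along_def mem_Collect_eq
      by (rule exI[of _ 0], rule exI[of _ "\<lambda>_. c"], rule exI[of _ "\<lambda>_. 1"]) (simp add: poly_along_const)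
    then have "(\<lambda>z. K z y * (K z0 y0 / K z0 y) / K z y0) \<in> rat_along G (ball z0 \<rho>)"
      by (intro rat_along_divide rat_along_mult ratK y z0) (use K0[OF z0(1) y] K0[OF _ z0(2)] in auto)
    then show "(\<lambda>z. exp (\<Sum>i\<in>UNIV. \<phi> z $ i * \<psi> y $ i)) \<in> rat_along G (ball z0 \<rho>)"
      by (rule rat_along_cong) (subst id[OF _ y], auto)
  qed
  \<comment> \<open>At \<open>y0 = cnj z0\<close> the second factor is the conjugate of the first,
    which makes the bilinear sum a sum of squared moduli.\<close>
  then have "complex_of_real (\<Sum>i\<in>UNIV. (cmod (F' z0 $ i))\<^sup>2) = 0"
    by (simp add: Fs'_def y0_def complex_norm_square del: of_real_power)
  then have "(\<Sum>i\<in>UNIV. (cmod (F' z0 $ i))\<^sup>2) = 0" using of_real_eq_0_iff by blast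
  then have "F' z0 $ i = 0" by (simp add: sum_nonneg_eq_0_iff)
  then show ?thesis by (simp add: F'_def)
qed

section \<open>The kernel as a rational function of the symmetrized coordinates\<close>

text \<open>Positions counted from zero. The coordinate \<open>i\<close> of a symmetrized point has
  degree \<open>rk i + 1\<close>, while \<open>rk i\<close> itself serves as the exponent in
  Vandermonde matrices and as the degree of the entries of the Jacobian matrix.\<close>

definition rk :: "'n::{finite,wellorder} \<Rightarrow> nat" where
  "rk i = card {..<i}"

lemma rk_less_iff [simp]: "rk i < rk j \<longleftrightarrow> i < j"
proof
  assume "i < j"
  then show "rk i < rk j" unfolding rk_def by (intro psubset_card_mono) auto
next
  assume *: "rk i < rk j"
  show "i < j"
  proof (rule ccontr)
    assume "\<not> i < j"
    then have "rk j \<le> rk i" unfolding rk_def by (intro card_mono) auto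
    with * show False by simp
  qed
qed

lemma inj_rk: "inj rk"
  by (rule injI) (metis less_irrefl linorder_neqE rk_less_iff)

lemma rk_eq_iff [simp]: "rk i = rk j \<longleftrightarrow> i = j"
  using inj_rk by (auto simp: inj_def)

lemma rk_le_iff [simp]: "rk i \<le> rk j \<longleftrightarrow> i \<le> j"
  by (metis linorder_not_less rk_less_iff)

lemma rk_less_CARD: "rk (i :: 'n::{finite,wellorder}) < CARD('n)"
  unfolding rk_def by (intro psubset_card_mono) auto

lemma bij_rk: "bij_betw rk (UNIV :: 'n::{finite,wellorder} set) {..<CARD('n)}"
proof -
  have "rk ` (UNIV :: 'n set) = {..<CARD('n)}"
    by (rule card_subset_eq) (auto simp: rk_less_CARD card_image inj_rk)
  then show ?thesis by (simp add: bij_betw_def inj_rk)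
qed

lemma sum_rk: "(\<Sum>m<CARD('n). f m) = (\<Sum>i\<in>(UNIV :: 'n::{finite,wellorder} set). f (rk i))"
  using sum.reindex_bij_betw[OF bij_rk[where 'n = 'n], of f] by simp

lemma card_atMost_rk: "card {..i} = Suc (rk i)"
proof -
  have eq: "{..i} = insert i {..<i}" by auto
  show ?thesis unfolding eq rk_def by (rule card_insert_disjoint) auto
qed

text \<open>The coordinates of \<xi> as a sequence of coefficients, completed by \<open>1\<close> in
  degree zero and by \<open>0\<close> beyond \<open>CARD('n)\<close>; the sum has at most one
  term.\<close>

definition sym_coeff :: "complex ^ 'n::{finite,wellorder} \<Rightarrow> nat \<Rightarrow> complex" where
  "sym_coeff \<xi> k = (if k = 0 then 1 else \<Sum>i | Suc (rk i) = k. \<xi> $ i)"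

lemma elem_sym_0 [simp]: "elem_sym 0 x = 1"
proof -
  have "{J :: 'a set. J = {}} = {{}}" by auto
  then show ?thesis by (simp add: elem_sym_def)
qed

lemma elem_sym_eq_0: "CARD('n) < k \<Longrightarrow> elem_sym k (x :: complex ^ 'n) = 0"
proof -
  have "card J \<le> CARD('n)" for J :: "'n set" by (rule card_mono) auto
  moreover assume "CARD('n) < k"
  ultimately have "{J :: 'n set. card J = k} = {}" by (auto simp: not_less[symmetric])
  then show ?thesis by (simp add: elem_sym_def)
qed

lemma sym_coeff_symmetrization: "sym_coeff (symmetrization x) k = elem_sym k x"
  for x :: "complex ^ 'n::{finite,wellorder}"
proof (cases "k = 0 \<or> CARD('n) < k")
  case True
  then have "{i :: 'n. Suc (rk i) = k} = {}" if "k \<noteq> 0"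
    using that rk_less_CARD by (metis (mono_tags, lifting) Collect_empty_eq Suc_leI linorder_not_less)
  with True show ?thesis by (auto simp: sym_coeff_def elem_sym_eq_0)
next
  case False
  then have "k - 1 \<in> rk ` (UNIV :: 'n set)" using bij_rk[where 'n = 'n] by (auto simp: bij_betw_def)
  then obtain i :: 'n where i: "rk i = k - 1" by auto
  with False have "{j :: 'n. Suc (rk j) = k} = {i}" by (auto simp flip: rk_eq_iff)
  with False i show ?thesis by (simp add: sym_coeff_def symmetrization_def card_atMost_rk)
qed

lemma prod_linear_factors:
  fixes x :: "complex ^ 'n"
  shows "(\<Prod>i\<in>UNIV. y - x $ i * t) = (\<Sum>k\<le>CARD('n). (-1) ^ k * elem_sym k x * t ^ k * y ^ (CARD('n) - k))"
proof -
  have "(\<Prod>i\<in>UNIV. y - x $ i * t) = (\<Prod>i\<in>UNIV. - (x $ i * t) + y)" by simp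
  also have "\<dots> = (\<Sum>X\<in>Pow UNIV. (\<Prod>i\<in>X. - (x $ i * t)) * (\<Prod>i\<in>UNIV - X. y))"
    by (rule prod_add) simp
  also have "\<dots> = (\<Sum>X\<in>UNIV. (- t) ^ card X * (\<Prod>i\<in>X. x $ i) * y ^ (CARD('n) - card X))"
  proof (rule sum.cong)
    fix X :: "'n set"
    have "(\<Prod>i\<in>X. - (x $ i * t)) = (\<Prod>i\<in>X. (- t) * x $ i)" by (simp add: mult.commute)
    then show "(\<Prod>i\<in>X. - (x $ i * t)) * (\<Prod>i\<in>UNIV - X. y) = (- t) ^ card X * (\<Prod>i\<in>X. x $ i) * y ^ (CARD('n) - card X)"
      by (simp only: prod.distrib prod_constant) (simp add: card_Diff_subset)
  qed simp
  also have "\<dots> = (\<Sum>k\<le>CARD('n). \<Sum>X | X \<in> UNIV \<and> card X = k. (- t) ^ card X * (\<Prod>i\<in>X. x $ i) * y ^ (CARD('n) - card X))"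
    by (rule sum.group[symmetric]) (auto simp: card_mono)
  also have "\<dots> = (\<Sum>k\<le>CARD('n). (-1) ^ k * elem_sym k x * t ^ k * y ^ (CARD('n) - k))"
    by (rule sum.cong) (auto simp: elem_sym_def sum_distrib_left sum_distrib_right power_minus[of t] mult_ac intro!: sum.cong)
  finally show ?thesis .
qed

text \<open>\<open>quot_coeff \<xi> k l\<close> is the coefficient of \<open>t\<^sup>k\<close> in \<open>(\<Sum>\<^sub>j (-1)\<^sup>j \<xi>\<^sub>j t\<^sup>j) / (1 - l t)\<close>.\<close>

definition quot_coeff :: "complex ^ 'n::{finite,wellorder} \<Rightarrow> nat \<Rightarrow> complex \<Rightarrow> complex" where
  "quot_coeff \<xi> k l = (\<Sum>a\<le>k. (-1) ^ (k - a) * sym_coeff \<xi> (k - a) * l ^ a)"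

lemma quot_coeff_0 [simp]: "quot_coeff \<xi> 0 l = 1"
  by (simp add: quot_coeff_def sym_coeff_def)

lemma quot_coeff_Suc: "quot_coeff \<xi> (Suc k) l = l * quot_coeff \<xi> k l + (-1) ^ Suc k * sym_coeff \<xi> (Suc k)"
  unfolding quot_coeff_def by (subst sum.atMost_Suc_shift) (simp add: sum_distrib_left algebra_simps)

text \<open>Division by \<open>1 - l * t\<close> with a remainder. For \<open>N = CARD('n)\<close>
  the remainder coefficient is the monic polynomial with coefficients from \<xi>, evaluated at
  \<open>l\<close>, so it vanishes when \<open>l\<close> is a coordinate of a preimage of
  \<xi>.\<close>

lemma quot_coeff_telescope:
  "(1 - l * t) * (\<Sum>k<N. quot_coeff \<xi> k l * t ^ k) + quot_coeff \<xi> N l * t ^ N = (\<Sum>k\<le>N. (-1) ^ k * sym_coeff \<xi> k * t ^ k)"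
proof (induction N)
  case 0 then show ?case by (simp add: sym_coeff_def)
next
  case (Suc N)
  have "(1 - l * t) * (\<Sum>k<Suc N. quot_coeff \<xi> k l * t ^ k) + quot_coeff \<xi> (Suc N) l * t ^ Suc N =
    ((1 - l * t) * (\<Sum>k<N. quot_coeff \<xi> k l * t ^ k) + quot_coeff \<xi> N l * t ^ N) + (-1) ^ Suc N * sym_coeff \<xi> (Suc N) * t ^ Suc N"
    unfolding quot_coeff_Suc by (simp add: algebra_simps)
  then show ?case unfolding Suc.IH by simp
qed

lemma quot_coeff_root:
  fixes x :: "complex ^ 'n::{finite,wellorder}"
  shows "quot_coeff (symmetrization x) CARD('n) (x $ i) = 0"
proof -
  have "0 = (\<Prod>j\<in>UNIV. x $ i - x $ j * 1)"
    by (metis finite mult.right_neutral prod_zero_iff right_minus_eq UNIV_I)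
  also have "\<dots> = (\<Sum>k\<le>CARD('n). (-1) ^ k * elem_sym k x * x $ i ^ (CARD('n) - k))"
    unfolding prod_linear_factors by simp
  also have "\<dots> = (\<Sum>a\<le>CARD('n). (-1) ^ (CARD('n) - a) * elem_sym (CARD('n) - a) x * x $ i ^ a)"
    by (rule sum.reindex_bij_witness[of _ "\<lambda>a. CARD('n) - a" "\<lambda>a. CARD('n) - a"]) auto
  finally show ?thesis by (simp add: quot_coeff_def sym_coeff_symmetrization)
qed

definition rev_poly :: "complex ^ 'n::{finite,wellorder} \<Rightarrow> complex \<Rightarrow> complex" where
  "rev_poly \<xi> t = (\<Sum>k\<le>CARD('n). (-1) ^ k * sym_coeff \<xi> k * t ^ k)"

lemma rev_poly_symmetrization: "rev_poly (symmetrization x) t = (\<Prod>i\<in>UNIV. 1 - x $ i * t)"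
  unfolding prod_linear_factors by (simp add: rev_poly_def sym_coeff_symmetrization)

text \<open>For \<open>l = x $ i\<close> this is the product of the factors
  \<open>1 - x $ j * t\<close> over \<open>j \<noteq> i\<close>, written in terms of
  \<open>l\<close>, \<open>t\<close> and the symmetrized point alone, without naming the other
  coordinates.\<close>

definition cofactor_poly :: "complex ^ 'n::{finite,wellorder} \<Rightarrow> complex \<Rightarrow> complex \<Rightarrow> complex" where
  "cofactor_poly \<xi> l t = (\<Sum>k<CARD('n). quot_coeff \<xi> k l * t ^ k)"

lemma cofactor_poly_mult:
  fixes x :: "complex ^ 'n::{finite,wellorder}"
  shows "(1 - x $ i * t) * cofactor_poly (symmetrization x) (x $ i) t = (\<Prod>j\<in>UNIV. 1 - x $ j * t)"
  using quot_coeff_telescope[of "x $ i" t "symmetrization x" "CARD('n)"]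
  by (simp add: cofactor_poly_def quot_coeff_root flip: rev_poly_symmetrization) (simp add: rev_poly_def)

text \<open>\<open>red_coeff \<xi> c m\<close> is the coefficient of \<open>t\<^sup>m\<close> in the remainder of \<open>t\<^sup>c\<close> modulo the
  polynomial whose roots are the coordinates of a preimage of \<open>\<xi>\<close>.\<close>

fun red_coeff :: "complex ^ 'n::{finite,wellorder} \<Rightarrow> nat \<Rightarrow> nat \<Rightarrow> complex" where
  "red_coeff \<xi> 0 m = (if m = 0 then 1 else 0)"
| "red_coeff \<xi> (Suc c) m = (if m = 0 then 0 else red_coeff \<xi> c (m - 1)) -
     red_coeff \<xi> c (CARD('n::{finite,wellorder}) - 1) * ((-1) ^ (CARD('n::{finite,wellorder}) - m) * sym_coeff \<xi> (CARD('n::{finite,wellorder}) - m))"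

lemma red_coeff_power:
  fixes x :: "complex ^ 'n::{finite,wellorder}"
  shows "x $ i ^ c = (\<Sum>m<CARD('n). red_coeff (symmetrization x) c m * x $ i ^ m)"
proof (induction c)
  case 0
  have "(\<Sum>m<CARD('n). red_coeff (symmetrization x) 0 m * x $ i ^ m) = (\<Sum>m<CARD('n). if m = 0 then 1 else 0)"
    by (rule sum.cong) auto
  then show ?case by simp
next
  case (Suc c)
  let ?\<xi> = "symmetrization x" and ?l = "x $ i"
  obtain N where N: "CARD('n) = Suc N" by (metis Suc_pred finite_UNIV_card_ge_0 finite)
  have root: "?l ^ Suc N + (\<Sum>m\<le>N. (-1) ^ (Suc N - m) * sym_coeff ?\<xi> (Suc N - m) * ?l ^ m) = 0"
    using quot_coeff_root[of x i] by (simp add: N quot_coeff_def sym_coeff_def[of _ 0] algebra_simps)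
  have "?l ^ Suc c = (\<Sum>m\<le>N. red_coeff ?\<xi> c m * ?l ^ Suc m)"
    by (simp add: Suc.IH N lessThan_Suc_atMost sum_distrib_left mult_ac)
  also have "\<dots> = (\<Sum>m<N. red_coeff ?\<xi> c m * ?l ^ Suc m) + red_coeff ?\<xi> c N * ?l ^ Suc N"
    by (simp flip: lessThan_Suc_atMost)
  also have "(\<Sum>m<N. red_coeff ?\<xi> c m * ?l ^ Suc m) = (\<Sum>m\<le>N. (if m = 0 then 0 else red_coeff ?\<xi> c (m - 1)) * ?l ^ m)"
    by (simp add: lessThan_Suc_atMost[symmetric] sum.lessThan_Suc_shift del: sum.lessThan_Suc)
  \<comment> \<open>Only the top power leaves the range below \<open>CARD('n)\<close>; the
    polynomial equation satisfied by \<open>x $ i\<close> brings it back.\<close>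
  also have "red_coeff ?\<xi> c N * ?l ^ Suc N = - (\<Sum>m\<le>N. red_coeff ?\<xi> c N * ((-1) ^ (Suc N - m) * sym_coeff ?\<xi> (Suc N - m)) * ?l ^ m)"
  proof -
    have "?l ^ Suc N = - (\<Sum>m\<le>N. (-1) ^ (Suc N - m) * sym_coeff ?\<xi> (Suc N - m) * ?l ^ m)"
      using root by (simp add: eq_neg_iff_add_eq_0)
    then show ?thesis by (simp only: sum_distrib_left mult_minus_right mult.assoc)
  qed
  finally show ?case
    by (simp add: N lessThan_Suc_atMost left_diff_distrib sum_subtractf)
qed

lemma red_coeff_power_rk:
  fixes x :: "complex ^ 'n::{finite,wellorder}"
  shows "x $ i ^ c = (\<Sum>a\<in>(UNIV :: 'n set). red_coeff (symmetrization x) c (rk a) * x $ i ^ rk a)"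
  using red_coeff_power[of x i c] sum_rk[where 'n = 'n, of "\<lambda>m. red_coeff (symmetrization x) c m * x $ i ^ m"] by simp

lemma bipoly_minus: "bipoly f \<Longrightarrow> bipoly g \<Longrightarrow> bipoly (\<lambda>\<xi> \<eta>. f \<xi> \<eta> - g \<xi> \<eta>)"
  using bipoly.add[OF _ bipoly.mult[OF bipoly.const[of "-1"]], of f g] by simp

lemma bipoly_power: "bipoly f \<Longrightarrow> bipoly (\<lambda>\<xi> \<eta>. f \<xi> \<eta> ^ k)"
  by (induction k) (auto intro: bipoly.intros)

lemma bipoly_sym_coeff: "bipoly (\<lambda>\<xi> _. sym_coeff \<xi> k)" "bipoly (\<lambda>_ \<eta>. sym_coeff \<eta> k)"
  unfolding sym_coeff_def by (cases "k = 0"; auto intro!: bipoly.intros bipoly_sum)+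

lemma bipoly_red_coeff:
  "bipoly (\<lambda>\<xi> _ :: complex ^ 'n::{finite,wellorder}. red_coeff \<xi> c m)"
  "bipoly (\<lambda>_ \<eta> :: complex ^ 'n::{finite,wellorder}. red_coeff \<eta> c m)"
proof -
  have "(\<forall>m. bipoly (\<lambda>\<xi> _ :: complex ^ 'n::_. red_coeff \<xi> c m)) \<and> (\<forall>m. bipoly (\<lambda>_ \<eta> :: complex ^ 'n::_. red_coeff \<eta> c m))"
  proof (induction c)
    case 0
    then show ?case by (auto intro: bipoly.intros)
  next
    case (Suc c)
    have "bipoly (\<lambda>\<xi> _ :: complex ^ 'n::_. if m = 0 then 0 else red_coeff \<xi> c (m - 1))"
      "bipoly (\<lambda>_ \<eta> :: complex ^ 'n::_. if m = 0 then 0 else red_coeff \<eta> c (m - 1))" for m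
      using Suc by (cases "m = 0"; auto intro: bipoly.intros)+
    with Suc show ?case by (auto intro!: bipoly_minus bipoly.mult bipoly.const bipoly_sym_coeff)
  qed
  then show "bipoly (\<lambda>\<xi> _ :: complex ^ 'n::_. red_coeff \<xi> c m)" "bipoly (\<lambda>_ \<eta> :: complex ^ 'n::_. red_coeff \<eta> c m)" by auto
qed

lemma bipoly_det:
  assumes "\<And>i j. bipoly (f i j)" shows "bipoly (\<lambda>\<xi> \<eta>. det (\<chi> i j. f i j \<xi> \<eta>))"
  unfolding det_def by (auto intro!: bipoly_sum bipoly_prod bipoly.mult bipoly.const assms)

section \<open>Factoring the determinant of disc kernels through Vandermonde matrices\<close>

definition vander :: "complex ^ 'n::{finite,wellorder} \<Rightarrow> complex ^ 'n::_ ^ 'n::_" where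
  "vander x = (\<chi> i a. x $ i ^ rk a)"

text \<open>The coefficient of \<open>y $ j ^ rk b * x $ i ^ rk a\<close> in the square of the
  cofactor polynomial, after powers of \<open>x $ i\<close> and of \<open>y $ j\<close> have been
  reduced below \<open>CARD('n)\<close>. The same coefficients serve for all \<open>i\<close> and
  \<open>j\<close>, and the reduction makes the coefficient matrix square.\<close>

definition kernel_coeff :: "'n::{finite,wellorder} \<Rightarrow> 'n \<Rightarrow> complex ^ 'n::_ \<Rightarrow> complex ^ 'n::_ \<Rightarrow> complex" where
  "kernel_coeff b a \<xi> \<eta> = (\<Sum>k<CARD('n). \<Sum>k'<CARD('n). \<Sum>c\<le>k. \<Sum>c'\<le>k'.
     ((-1) ^ (k - c) * sym_coeff \<xi> (k - c)) * ((-1) ^ (k' - c') * sym_coeff \<xi> (k' - c')) *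
     red_coeff \<xi> (c + c') (rk a) * red_coeff \<eta> (k + k') (rk b))"

definition kernel_num :: "complex ^ 'n::{finite,wellorder} \<Rightarrow> complex ^ 'n::_ \<Rightarrow> complex" where
  "kernel_num \<xi> \<eta> = det (\<chi> b a. kernel_coeff b a \<xi> \<eta>)"

text \<open>The determinant is a resultant: its matrix represents multiplication by
  \<open>rev_poly \<xi>\<close> modulo the polynomial whose roots are the coordinates
  \<open>y $ j\<close> of a preimage of \<eta>. In this form it is visibly polynomial in \<eta>. The
  square matches the squares in the disc kernels.\<close>

definition kernel_den :: "complex ^ 'n::{finite,wellorder} \<Rightarrow> complex ^ 'n::_ \<Rightarrow> complex" where
  "kernel_den \<xi> \<eta> = (det (\<chi> (l :: 'n) (b :: 'n). \<Sum>k\<le>CARD('n). (-1) ^ k * sym_coeff \<xi> k * red_coeff \<eta> (k + rk b) (rk l)))\<^sup>2"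

lemma bipoly_kernel: "bipoly kernel_num" "bipoly kernel_den"
proof -
  have "bipoly (\<lambda>\<xi> \<eta>. kernel_num \<xi> \<eta>)" "bipoly (\<lambda>\<xi> \<eta>. kernel_den \<xi> \<eta>)"
    unfolding kernel_num_def kernel_den_def kernel_coeff_def
    by (intro bipoly_power bipoly_det bipoly_sum bipoly.mult bipoly.const bipoly_sym_coeff bipoly_red_coeff)+
  then show "bipoly kernel_num" "bipoly kernel_den" by simp_all
qed

lemma cofactor_poly_power2:
  fixes x y :: "complex ^ 'n::{finite,wellorder}"
  shows "(cofactor_poly (symmetrization x) (x $ i) (y $ j))\<^sup>2 =
    (\<Sum>b\<in>UNIV. \<Sum>a\<in>UNIV. y $ j ^ rk b * kernel_coeff b a (symmetrization x) (symmetrization y) * x $ i ^ rk a)"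
proof -
  let ?\<xi> = "symmetrization x" and ?\<eta> = "symmetrization y"
  let ?g = "\<lambda>k c. (-1) ^ (k - c) * sym_coeff ?\<xi> (k - c)"
  have swap: "(\<Sum>m\<in>S. \<Sum>b\<in>(UNIV :: 'n set). \<Sum>a\<in>(UNIV :: 'n set). h m b a) = (\<Sum>b\<in>UNIV. \<Sum>a\<in>UNIV. \<Sum>m\<in>S. h m b a)"
    for S :: "nat set" and h :: "nat \<Rightarrow> 'n \<Rightarrow> 'n \<Rightarrow> complex"
    by (subst sum.swap) (intro sum.cong refl sum.swap)
  have "(cofactor_poly ?\<xi> (x $ i) (y $ j))\<^sup>2 =
      (\<Sum>k<CARD('n). \<Sum>k'<CARD('n). \<Sum>c\<le>k. \<Sum>c'\<le>k'. ?g k c * ?g k' c' * (x $ i ^ (c + c')) * (y $ j ^ (k + k')))"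
    unfolding power2_eq_square cofactor_poly_def sum_product
  proof (intro sum.cong refl)
    fix k k'
    have "quot_coeff ?\<xi> k (x $ i) * y $ j ^ k * (quot_coeff ?\<xi> k' (x $ i) * y $ j ^ k') =
      quot_coeff ?\<xi> k (x $ i) * quot_coeff ?\<xi> k' (x $ i) * y $ j ^ (k + k')"
      by (simp add: power_add mult_ac)
    also have "\<dots> = (\<Sum>c\<le>k. \<Sum>c'\<le>k'. ?g k c * ?g k' c' * (x $ i ^ (c + c')) * (y $ j ^ (k + k')))"
      unfolding quot_coeff_def sum_product sum_distrib_right
      by (intro sum.cong refl) (simp add: power_add mult_ac sum_distrib_left)
    finally show "quot_coeff ?\<xi> k (x $ i) * y $ j ^ k * (quot_coeff ?\<xi> k' (x $ i) * y $ j ^ k') =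
      (\<Sum>c\<le>k. \<Sum>c'\<le>k'. ?g k c * ?g k' c' * (x $ i ^ (c + c')) * (y $ j ^ (k + k')))" .
  qed
  also have "\<dots> = (\<Sum>k<CARD('n). \<Sum>k'<CARD('n). \<Sum>c\<le>k. \<Sum>c'\<le>k'. \<Sum>b\<in>(UNIV :: 'n set). \<Sum>a\<in>(UNIV :: 'n set). ?g k c * ?g k' c' *
       (red_coeff ?\<xi> (c + c') (rk a) * x $ i ^ rk a) * (red_coeff ?\<eta> (k + k') (rk b) * y $ j ^ rk b))"
    by (intro sum.cong refl, subst red_coeff_power_rk[of x], subst red_coeff_power_rk[of y])
       (simp only: sum_distrib_left sum_distrib_right)
  also have "\<dots> = (\<Sum>b\<in>(UNIV :: 'n set). \<Sum>a\<in>(UNIV :: 'n set). \<Sum>k<CARD('n). \<Sum>k'<CARD('n). \<Sum>c\<le>k. \<Sum>c'\<le>k'. ?g k c * ?g k' c' *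
       (red_coeff ?\<xi> (c + c') (rk a) * x $ i ^ rk a) * (red_coeff ?\<eta> (k + k') (rk b) * y $ j ^ rk b))"
    by (simp only: swap)
  also have "\<dots> = (\<Sum>b\<in>UNIV. \<Sum>a\<in>UNIV. y $ j ^ rk b * kernel_coeff b a ?\<xi> ?\<eta> * x $ i ^ rk a)"
    unfolding kernel_coeff_def sum_distrib_right sum_distrib_left
    by (intro sum.cong refl) (simp add: mult_ac)
  finally show ?thesis .
qed

text \<open>The bilinear expansion of the entries is a product of three matrices, and determinants
  are multiplicative; this is the divisibility by both Vandermonde determinants with the quotient in
  hand.\<close>

lemma det_cofactor_matrix:
  fixes x y :: "complex ^ 'n::{finite,wellorder}"
  shows "det (\<chi> j i. (cofactor_poly (symmetrization x) (x $ i) (y $ j))\<^sup>2) =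
    det (vander y) * kernel_num (symmetrization x) (symmetrization y) * det (vander x)"
proof -
  let ?M = "\<chi> b a. kernel_coeff b a (symmetrization x) (symmetrization y)"
  have "(\<chi> j i. (cofactor_poly (symmetrization x) (x $ i) (y $ j))\<^sup>2) = vander y ** (?M ** transpose (vander x))"
    unfolding vec_eq_iff matrix_matrix_mult_def
    by (simp add: cofactor_poly_power2 vander_def transpose_def sum_distrib_left mult.assoc)
  then show ?thesis by (simp add: det_mul det_transpose kernel_num_def mult.assoc)
qed

text \<open>A vector in the kernel is the coefficient list of a polynomial of degree below
  \<open>CARD('n)\<close> that has \<open>CARD('n)\<close> distinct roots.\<close>

lemma det_vander_nonzero:
  fixes x :: "complex ^ 'n::{finite,wellorder}"
  assumes "inj (($) x)" shows "det (vander x) \<noteq> 0"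
proof -
  have "c = 0" if "vander x *v c = 0" for c
  proof -
    define p where "p = (\<Sum>a\<in>UNIV. monom (c $ a) (rk a))"
    have root: "poly p (x $ i) = 0" for i
    proof -
      have "poly p (x $ i) = (vander x *v c) $ i"
        by (simp add: p_def poly_sum poly_monom vander_def matrix_vector_mult_def mult.commute)
      then show ?thesis using that by simp
    qed
    have deg: "degree p < CARD('n)"
    proof -
      have "degree p \<le> CARD('n) - 1" unfolding p_def
      proof (rule degree_sum_le)
        show "degree (monom (c $ a) (rk a)) \<le> CARD('n) - 1" for a
          using degree_monom_le[of "c $ a" "rk a"] rk_less_CARD[of a] by linarith
      qed simp
      then show ?thesis by (meson finite finite_UNIV_card_ge_0 diff_less le_less_trans zero_less_one)
    qed
    have "p = 0"
    proof (rule ccontr)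
      assume p: "p \<noteq> 0"
      have "CARD('n) = card (range (($) x))" using assms by (simp add: card_image)
      also have "\<dots> \<le> card {z. poly p z = 0}" by (intro card_mono poly_roots_finite[OF p]) (use root in auto)
      also have "\<dots> \<le> degree p" by (rule card_poly_roots_bound[OF p])
      finally show False using deg by simp
    qed
    moreover have "coeff p (rk a) = c $ a" for a
      by (simp add: p_def coeff_sum)
    ultimately show "c = 0" by (simp add: vec_eq_iff)
  qed
  then show ?thesis using matrix_left_invertible_ker[of "vander x"] invertible_left_inverse invertible_det_nz by blast
qed

text \<open>Multiples of the distinct ranks separate equal coordinates immediately, and distinct
  coordinates stay apart because the perturbation tends to zero.\<close>

lemma eventually_distinct_coordinates:
  fixes x :: "complex ^ 'n::{finite,wellorder}"
  shows "\<forall>\<^sub>F k in sequentially. inj (($) (\<chi> i. x $ i + of_real (inverse (real (Suc k))) * of_nat (rk i)))"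
proof -
  have "\<forall>\<^sub>F k in sequentially. x $ i + of_real (inverse (real (Suc k))) * of_nat (rk i) \<noteq> x $ j + of_real (inverse (real (Suc k))) * of_nat (rk j)"
    if "i \<noteq> j" for i j
  proof (cases "x $ i = x $ j")
    case True
    have "of_real (inverse (real (Suc k))) \<noteq> (0 :: complex)" for k
      by (simp only: of_real_eq_0_iff inverse_nonzero_iff_nonzero of_nat_eq_0_iff)
    with True that show ?thesis
      by (simp only: add_left_cancel mult_cancel_left of_nat_eq_iff rk_eq_iff, simp?)
  next
    case False
    have "(\<lambda>k. (x $ i + of_real (inverse (real (Suc k))) * of_nat (rk i)) - (x $ j + of_real (inverse (real (Suc k))) * of_nat (rk j)))
       \<longlonglongrightarrow> (x $ i + of_real 0 * of_nat (rk i)) - (x $ j + of_real 0 * of_nat (rk j))"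
      by (intro tendsto_intros LIMSEQ_inverse_real_of_nat)
    then have "\<forall>\<^sub>F k in sequentially. (x $ i + of_real (inverse (real (Suc k))) * of_nat (rk i)) - (x $ j + of_real (inverse (real (Suc k))) * of_nat (rk j)) \<noteq> 0"
      using False by (intro tendsto_imp_eventually_ne) auto
    then show ?thesis by (rule eventually_mono) simp
  qed
  then have "\<forall>\<^sub>F k in sequentially. \<forall>i j. i \<noteq> j \<longrightarrow> x $ i + of_real (inverse (real (Suc k))) * of_nat (rk i) \<noteq> x $ j + of_real (inverse (real (Suc k))) * of_nat (rk j)"
    by (intro eventually_all_finite) (auto intro: eventually_mono)
  then show ?thesis by (rule eventually_mono) (auto simp: inj_def)
qed

lemma perturbed_tendsto:
  fixes x :: "complex ^ 'n::{finite,wellorder}"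
  shows "(\<lambda>k. \<chi> i. x $ i + of_real (inverse (real (Suc k))) * of_nat (rk i)) \<longlonglongrightarrow> x"
proof (rule vec_tendstoI)
  fix i
  have "(\<lambda>k. x $ i + of_real (inverse (real (Suc k))) * of_nat (rk i)) \<longlonglongrightarrow> x $ i + of_real 0 * of_nat (rk i)"
    by (intro tendsto_intros LIMSEQ_inverse_real_of_nat)
  then show "(\<lambda>k. (\<chi> i. x $ i + of_real (inverse (real (Suc k))) * of_nat (rk i)) $ i) \<longlonglongrightarrow> x $ i" by simp
qed

lemma continuous_on_symmetrization: "continuous_on S symmetrization"
  unfolding symmetrization_def elem_sym_def
  by (intro continuous_on_vec_lambda continuous_on_sum continuous_on_prod
      bounded_linear.continuous_on[OF bounded_linear_vec_nth] continuous_on_id)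

text \<open>The identity is clear where the Vandermonde determinant of \<open>y\<close> does not vanish, and
  extends by density.\<close>

lemma kernel_den_symmetrization:
  fixes x y :: "complex ^ 'n::{finite,wellorder}"
  shows "kernel_den (symmetrization x) (symmetrization y) = (\<Prod>j\<in>UNIV. \<Prod>i\<in>UNIV. 1 - x $ i * y $ j)\<^sup>2"
proof -
  define M :: "complex ^ 'n::_ \<Rightarrow> complex ^ 'n::_ ^ 'n::_" where
    "M y = (\<chi> l b. \<Sum>k\<le>CARD('n). (-1) ^ k * sym_coeff (symmetrization x) k * red_coeff (symmetrization y) (k + rk b) (rk l))" for y
  define P where "P y = (\<Prod>j\<in>UNIV. \<Prod>i\<in>UNIV. 1 - x $ i * y $ j)" for y :: "complex ^ 'n::_"
  have *: "det (M y) = P y" if "inj (($) y)" for y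
  proof -
    \<comment> \<open>Row \<open>j\<close> of \<open>vander y\<close> is a left eigenvector of
      \<open>M y\<close>, with eigenvalue
      \<open>rev_poly (symmetrization x) (y $ j)\<close>.\<close>
    have "rev_poly (symmetrization x) (y $ j) * y $ j ^ rk b = (vander y ** M y) $ j $ b" for j b
    proof -
      have "rev_poly (symmetrization x) (y $ j) * y $ j ^ rk b = (\<Sum>k\<le>CARD('n). (-1) ^ k * sym_coeff (symmetrization x) k * y $ j ^ (k + rk b))"
        by (simp add: rev_poly_def sum_distrib_right power_add mult.assoc)
      also have "\<dots> = (\<Sum>k\<le>CARD('n). \<Sum>l\<in>(UNIV :: 'n set). (-1) ^ k * sym_coeff (symmetrization x) k * (red_coeff (symmetrization y) (k + rk b) (rk l) * y $ j ^ rk l))"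
        by (subst red_coeff_power_rk[of y]) (simp only: sum_distrib_left)
      also have "\<dots> = (\<Sum>l\<in>(UNIV :: 'n set). \<Sum>k\<le>CARD('n). (-1) ^ k * sym_coeff (symmetrization x) k * (red_coeff (symmetrization y) (k + rk b) (rk l) * y $ j ^ rk l))"
        by (rule sum.swap)
      also have "\<dots> = (vander y ** M y) $ j $ b"
        by (simp add: matrix_matrix_mult_def vander_def M_def sum_distrib_left mult_ac)
      finally show ?thesis .
    qed
    then have "(\<chi> j. rev_poly (symmetrization x) (y $ j) *s vander y $ j) = vander y ** M y"
      by (simp add: vec_eq_iff vander_def)
    moreover have "det (\<chi> j. rev_poly (symmetrization x) (y $ j) *s vander y $ j) = (\<Prod>j\<in>UNIV. rev_poly (symmetrization x) (y $ j)) * det (vander y)"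
      using det_rows_mul[of "\<lambda>j. rev_poly (symmetrization x) (y $ j)" "\<lambda>j. vander y $ j"] by simp
    ultimately have "(\<Prod>j\<in>UNIV. rev_poly (symmetrization x) (y $ j)) * det (vander y) = det (vander y) * det (M y)"
      by (metis det_mul)
    then show ?thesis using det_vander_nonzero[OF that] by (simp add: P_def rev_poly_symmetrization)
  qed
  define s where "s k = (\<chi> i. y $ i + of_real (inverse (real (Suc k))) * of_nat (rk i))" for k
  have s: "s \<longlonglongrightarrow> y" unfolding s_def by (rule perturbed_tendsto)
  have "bipoly (\<lambda>_ \<eta>. det (\<chi> l b. \<Sum>k\<le>CARD('n). (-1) ^ k * sym_coeff (symmetrization x) k * red_coeff \<eta> (k + rk b) (rk l :: nat)))"
    by (intro bipoly_det bipoly_sum bipoly.mult bipoly.const bipoly_red_coeff)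
  from bipoly_continuous[OF this, of UNIV "\<lambda>_. 0" symmetrization]
  have "continuous_on UNIV (\<lambda>y. det (M y))"
    unfolding M_def by (auto intro!: bounded_linear.continuous_on[OF bounded_linear_vec_nth] continuous_on_symmetrization)
  then have "(\<lambda>k. det (M (s k))) \<longlonglongrightarrow> det (M y)"
    using s by (auto simp: continuous_on_eq_continuous_at intro: isCont_tendsto_compose)
  moreover have "\<forall>\<^sub>F k in sequentially. det (M (s k)) = P (s k)"
    unfolding s_def using eventually_distinct_coordinates[of y] by (rule eventually_mono) (rule *)
  ultimately have "(\<lambda>k. P (s k)) \<longlonglongrightarrow> det (M y)" by (rule Lim_transform_eventually)
  moreover have "(\<lambda>k. P (s k)) \<longlonglongrightarrow> P y"
    unfolding P_def by (intro tendsto_intros tendsto_vec_nth s)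
  ultimately have "det (M y) = P y" using LIMSEQ_unique by blast
  then show ?thesis by (simp add: kernel_den_def M_def P_def)
qed

text \<open>Multiplying row \<open>j\<close> by the square of the product of all
  \<open>1 - x $ i * y $ j\<close> clears its denominators and leaves squares of cofactor
  polynomials; the product of these row factors is \<open>kernel_den\<close>.\<close>

lemma det_kernel_matrix:
  fixes x y :: "complex ^ 'n::{finite,wellorder}"
  assumes "\<And>i j. 1 - x $ i * y $ j \<noteq> 0"
  shows "det (\<chi> j i. 1 / (1 - x $ i * y $ j)\<^sup>2) * kernel_den (symmetrization x) (symmetrization y) =
     det (vander y) * kernel_num (symmetrization x) (symmetrization y) * det (vander x)"
proof -
  let ?q = "\<lambda>j. (\<Prod>i\<in>UNIV. 1 - x $ i * y $ j)\<^sup>2"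
  have "(cofactor_poly (symmetrization x) (x $ i) (y $ j))\<^sup>2 = ?q j * (1 / (1 - x $ i * y $ j)\<^sup>2)" for i j
  proof -
    have "?q j = (1 - x $ i * y $ j)\<^sup>2 * (cofactor_poly (symmetrization x) (x $ i) (y $ j))\<^sup>2"
      by (simp only: cofactor_poly_mult[symmetric, where x = x and i = i] power_mult_distrib)
    then show ?thesis using assms[of i j] by simp
  qed
  then have "(\<chi> j i. (cofactor_poly (symmetrization x) (x $ i) (y $ j))\<^sup>2) = (\<chi> j. ?q j *s (\<chi> i. 1 / (1 - x $ i * y $ j)\<^sup>2))"
    by (simp add: vec_eq_iff)
  then have "det (\<chi> j i. (cofactor_poly (symmetrization x) (x $ i) (y $ j))\<^sup>2) = (\<Prod>j\<in>UNIV. ?q j) * det (\<chi> j i. 1 / (1 - x $ i * y $ j)\<^sup>2)"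
    by (simp only: det_rows_mul)
  moreover have "(\<Prod>j\<in>UNIV. ?q j) = kernel_den (symmetrization x) (symmetrization y)"
    by (simp only: kernel_den_symmetrization prod_power_distrib)
  ultimately show ?thesis
    by (simp only: det_cofactor_matrix mult.commute[of "kernel_den _ _"])
qed

section \<open>The symmetrization map\<close>

text \<open>The fundamental theorem of algebra: a preimage lists, with multiplicity, the roots of
  the monic polynomial whose coefficients are the signed coordinates of \<xi>.\<close>

lemma symmetrization_surj:
  fixes \<xi> :: "complex ^ 'n::{finite,wellorder}"
  obtains x where "symmetrization x = \<xi>"
proof -
  \<comment> \<open>Taking an arbitrary coefficient sequence allows the polynomial prescribed by
    \<xi> and the one built from the roots to be compared coefficient by coefficient.\<close>
  define P where "P s = (\<Sum>k\<le>CARD('n). monom ((-1) ^ k * s k) (CARD('n) - k))" for s :: "nat \<Rightarrow> complex"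
  have coeffP: "coeff (P s) (CARD('n) - k) = (-1) ^ k * s k" if "k \<le> CARD('n)" for s k
  proof -
    have "coeff (P s) (CARD('n) - k) = (\<Sum>j\<le>CARD('n). if j = k then (-1) ^ k * s k else 0)"
      unfolding P_def coeff_sum by (rule sum.cong) (use that in auto)
    then show ?thesis using that by simp
  qed
  let ?p = "P (sym_coeff \<xi>)"
  have deg: "degree ?p \<le> CARD('n)"
    unfolding P_def by (rule degree_sum_le) (auto intro: order_trans[OF degree_monom_le])
  moreover have lead: "coeff ?p CARD('n) = 1" using coeffP[of 0 "sym_coeff \<xi>"] by (simp add: sym_coeff_def)
  ultimately have deg: "degree ?p = CARD('n)" by (metis le_antisym le_degree one_neq_zero)
  then have lc: "lead_coeff ?p = 1" and nz: "?p \<noteq> 0" using lead by auto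
  obtain A where A0: "size A = degree ?p" "?p = smult (lead_coeff ?p) (\<Prod>x\<in>#A. [:- x, 1:])"
    using alg_closed_imp_factorization[OF nz] by blast
  have "?p = smult 1 (\<Prod>x\<in>#A. [:- x, 1:])" using A0(2) by (simp only: lc)
  then have A: "size A = CARD('n)" "?p = (\<Prod>x\<in>#A. [:- x, 1:])" using A0(1) deg by simp_all
  obtain xs where xs: "mset xs = A" using ex_mset by blast
  then have len: "length xs = CARD('n)" using A(1) by auto
  define x :: "complex ^ 'n::_" where "x = (\<chi> i. xs ! rk i)"
  have "poly ?p t = poly (P (\<lambda>k. elem_sym k x)) t" for t
  proof -
    have "poly ?p t = (\<Prod>x\<in>#mset xs. t - x)"
      by (simp add: A(2) xs poly_prod_mset)
    also have "\<dots> = (\<Prod>m<CARD('n). t - xs ! m)"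
    proof -
      have "(\<Prod>x\<in>#mset ys. t - x) = prod_list (map (\<lambda>x. t - x) ys)" for ys by (induction ys) auto
      then show ?thesis by (simp add: prod.list_conv_set_nth atLeast0LessThan len)
    qed
    also have "\<dots> = (\<Prod>i\<in>(UNIV :: 'n set). t - x $ i * 1)"
      using prod.reindex_bij_betw[OF bij_rk[where 'n = 'n], of "\<lambda>m. t - xs ! m"] by (simp add: x_def)
    also have "\<dots> = poly (P (\<lambda>k. elem_sym k x)) t"
      unfolding prod_linear_factors by (simp add: P_def poly_sum poly_monom)
    finally show ?thesis .
  qed
  then have eq: "?p = P (\<lambda>k. elem_sym k x)" by (simp add: poly_eq_poly_eq_iff[symmetric] fun_eq_iff)
  have "symmetrization x $ i = \<xi> $ i" for i
  proof -
    have k: "Suc (rk i) \<le> CARD('n)" using rk_less_CARD[of i] by simp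
    have "sym_coeff \<xi> (Suc (rk i)) = elem_sym (Suc (rk i)) x"
      using coeffP[OF k, of "sym_coeff \<xi>"] coeffP[OF k, of "\<lambda>k. elem_sym k x"] unfolding eq by simp
    moreover have "sym_coeff \<xi> (Suc (rk i)) = \<xi> $ i" by (simp add: sym_coeff_def)
    ultimately show ?thesis by (simp add: symmetrization_def card_atMost_rk)
  qed
  then have "symmetrization x = \<xi>" by (simp add: vec_eq_iff)
  then show ?thesis by (rule that)
qed

text \<open>The zeros of \<open>rev_poly\<close> are the reciprocals of the nonzero coordinates of a
  preimage. Membership thus becomes the absence of zeros in a compact disc, a condition on \<xi>
  that no longer mentions preimages and yields openness.\<close>

lemma sym_polydisc_iff_rev_poly:
  fixes \<xi> :: "complex ^ 'n::{finite,wellorder}"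
  shows "\<xi> \<in> sym_polydisc \<longleftrightarrow> (\<forall>t\<in>cball 0 1. rev_poly \<xi> t \<noteq> 0)"
proof
  assume "\<xi> \<in> sym_polydisc"
  then obtain x where x: "\<xi> = symmetrization x" "\<And>j. norm (x $ j) < 1" by (auto simp: sym_polydisc_def polydisc_def)
  have "1 - x $ j * t \<noteq> 0" if "norm t \<le> 1" for j t
  proof
    assume "1 - x $ j * t = 0"
    then have "norm (x $ j) * norm t = 1" by (metis norm_mult norm_one right_minus_eq)
    moreover have "norm (x $ j) * norm t \<le> norm (x $ j) * 1" by (rule mult_left_mono) (use that in auto)
    ultimately show False using x(2)[of j] by simp
  qed
  then show "\<forall>t\<in>cball 0 1. rev_poly \<xi> t \<noteq> 0" by (simp add: x(1) rev_poly_symmetrization)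
next
  assume *: "\<forall>t\<in>cball 0 1. rev_poly \<xi> t \<noteq> 0"
  obtain x where x: "symmetrization x = \<xi>" by (rule symmetrization_surj)
  have "norm (x $ j) < 1" for j
  proof (rule ccontr)
    assume "\<not> norm (x $ j) < 1"
    then have "norm (1 / x $ j) \<le> 1" "x $ j \<noteq> 0" by (auto simp: norm_divide divide_le_eq)
    then have "rev_poly (symmetrization x) (1 / x $ j) \<noteq> 0" unfolding x using * by auto
    then have "1 - x $ j * (1 / x $ j) \<noteq> 0"
      unfolding rev_poly_symmetrization by (metis UNIV_I finite prod_zero)
    then show False using \<open>x $ j \<noteq> 0\<close> by simp
  qed
  then show "\<xi> \<in> sym_polydisc" using x by (auto simp: sym_polydisc_def polydisc_def)
qed

text \<open>The complement is the projection, along the compact closed disc, of the closed set where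
  \<open>rev_poly\<close> vanishes.\<close>

lemma open_sym_polydisc: "open (sym_polydisc :: (complex ^ 'n::{finite,wellorder}) set)"
proof -
  have "continuous_on UNIV (\<lambda>p :: complex \<times> (complex ^ 'n::_). sym_coeff (snd p) k)" for k
    by (rule bipoly_continuous[OF bipoly_sym_coeff(1), of UNIV snd snd k])
       (intro bounded_linear.continuous_on[OF bounded_linear_vec_nth] continuous_on_snd continuous_on_id)+
  then have "continuous_on UNIV (\<lambda>p :: complex \<times> (complex ^ 'n::_). rev_poly (snd p) (fst p))"
    unfolding rev_poly_def
    by (intro continuous_on_sum continuous_on_mult continuous_on_const continuous_on_power continuous_on_fst continuous_on_id)
  then have "closed {p :: complex \<times> (complex ^ 'n::_). rev_poly (snd p) (fst p) = 0}"
    by (intro closed_Collect_eq continuous_on_const)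
  from closed_compact_projection[OF compact_cball this, of 0 1]
  have clo: "closed {\<xi> :: complex ^ 'n::_. \<exists>t. t \<in> cball 0 1 \<and> rev_poly \<xi> t = 0}" by simp
  have eq: "(sym_polydisc :: (complex ^ 'n::_) set) = - {\<xi> :: complex ^ 'n::_. \<exists>t. t \<in> cball 0 1 \<and> rev_poly \<xi> t = 0}"
    by (rule set_eqI) (simp only: sym_polydisc_iff_rev_poly Compl_iff mem_Collect_eq Ball_def, simp)
  show ?thesis unfolding eq by (rule open_Compl[OF clo])
qed

lemma bounded_polydisc: "bounded (polydisc :: (complex ^ 'n) set)"
proof -
  have "norm x \<le> real CARD('n)" if "x \<in> polydisc" for x :: "complex ^ 'n"
  proof -
    have "norm x \<le> (\<Sum>j\<in>UNIV. norm (x $ j))" unfolding norm_vec_def by (rule L2_set_le_sum) simp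
    also have "\<dots> \<le> (\<Sum>j\<in>(UNIV :: 'n set). 1)" by (rule sum_mono) (use that in \<open>auto simp: polydisc_def less_imp_le\<close>)
    finally show ?thesis by simp
  qed
  then show ?thesis by (auto simp: bounded_iff)
qed

lemma bounded_sym_polydisc: "bounded (sym_polydisc :: (complex ^ 'n::{finite,wellorder}) set)"
proof -
  have "compact (symmetrization ` closure (polydisc :: (complex ^ 'n::_) set))"
    by (intro compact_continuous_image continuous_on_symmetrization) (simp add: bounded_polydisc compact_closure)
  then show ?thesis
    unfolding sym_polydisc_def by (meson bounded_subset closure_subset compact_imp_bounded image_mono)
qed

lemma open_polydisc: "open (polydisc :: (complex ^ 'n) set)"
proof -
  have "polydisc = (\<Inter>j. (\<lambda>x :: complex ^ 'n. x $ j) -` ball 0 1)" by (auto simp: polydisc_def)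
  then show ?thesis
    by (elim ssubst) (intro open_INT ballI open_vimage open_ball finite bounded_linear.continuous_on[OF bounded_linear_vec_nth] continuous_on_id)
qed

lemma symmetrization_eq_imp_range_eq:
  fixes x y :: "complex ^ 'n::{finite,wellorder}"
  assumes "symmetrization x = symmetrization y" shows "range (($) x) = range (($) y)"
proof -
  have "elem_sym k x = elem_sym k y" for k
    using assms by (simp flip: sym_coeff_symmetrization)
  then have eq: "(\<Prod>i\<in>UNIV. t - x $ i * 1) = (\<Prod>i\<in>UNIV. t - y $ i * 1)" for t
    unfolding prod_linear_factors by simp
  have zero: "(\<Prod>i\<in>UNIV. t - z $ i * 1) = 0 \<longleftrightarrow> t \<in> range (($) z)" for t and z :: "complex ^ 'n::_"
    by (auto simp: prod_zero_iff)
  show ?thesis using eq zero by (metis subsetI subset_antisym)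
qed

section \<open>Permutation invariance and the Jacobian matrix of the symmetrization\<close>

lemma elem_sym_permute:
  fixes x :: "complex ^ 'n"
  assumes "p permutes UNIV" shows "elem_sym k (\<chi> i. x $ p i) = elem_sym k x"
proof -
  have inj: "inj p" using assms by (rule permutes_inj)
  have "bij_betw (image p) {J. card J = k} {J. card J = k}"
  proof (rule bij_betwI[where g = "image (inv p)"])
    have inj': "inj (inv p)" using assms permutes_inv permutes_inj by blast
    show "(`) p \<in> {J. card J = k} \<rightarrow> {J. card J = k}" "(`) (inv p) \<in> {J. card J = k} \<rightarrow> {J. card J = k}"
      using inj inj' by (auto simp: card_image inj_on_subset)
    show "inv p ` p ` J = J" "p ` inv p ` J = J" for J
      using permutes_inverses[OF assms] by (auto simp: image_image)
  qed
  then have "(\<Sum>J | card J = k. \<Prod>j\<in>J. x $ j) = (\<Sum>J | card J = k. \<Prod>j\<in>p ` J. x $ j)"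
    using sum.reindex_bij_betw[of "image p" "{J. card J = k}" "{J. card J = k}" "\<lambda>J. \<Prod>j\<in>J. x $ j"] by simp
  also have "\<dots> = (\<Sum>J | card J = k. \<Prod>j\<in>J. x $ p j)"
    by (intro sum.cong refl) (simp add: prod.reindex inj_on_subset[OF inj])
  finally show ?thesis by (simp add: elem_sym_def)
qed

lemma symmetrization_permute:
  "p permutes UNIV \<Longrightarrow> symmetrization (\<chi> i. x $ p i) = symmetrization x"
  unfolding symmetrization_def by (simp only: elem_sym_permute)

text \<open>The partial derivative of \<open>elem_sym (Suc k)\<close> in the direction of coordinate
  \<open>j\<close>.\<close>

definition elem_sym_omit :: "nat \<Rightarrow> complex ^ 'n \<Rightarrow> 'n \<Rightarrow> complex" where
  "elem_sym_omit k x j = (\<Sum>J | card J = k \<and> j \<notin> J. \<Prod>i\<in>J. x $ i)"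

lemma sum_containing:
  fixes f :: "'n::finite set \<Rightarrow> complex"
  shows "(\<Sum>J | card J = Suc k \<and> j \<in> J. f (J - {j})) = (\<Sum>J | card J = k \<and> j \<notin> J. f J)"
  by (rule sum.reindex_bij_witness[of _ "insert j" "\<lambda>J. J - {j}"]) (auto simp: insert_absorb)

lemma elem_sym_omit_Suc: "elem_sym_omit (Suc k) x j = elem_sym (Suc k) x - x $ j * elem_sym_omit k x j"
proof -
  have "elem_sym (Suc k) x = (\<Sum>J | card J = Suc k \<and> j \<in> J. \<Prod>i\<in>J. x $ i) + elem_sym_omit (Suc k) x j"
    unfolding elem_sym_def elem_sym_omit_def
    by (subst sum.union_disjoint[symmetric]) (auto intro: sum.cong)
  also have "(\<Sum>J | card J = Suc k \<and> j \<in> J. \<Prod>i\<in>J. x $ i) = (\<Sum>J | card J = Suc k \<and> j \<in> J. x $ j * (\<Prod>i\<in>J - {j}. x $ i))"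
    by (intro sum.cong refl) (auto simp: prod.remove)
  also have "\<dots> = (\<Sum>J | card J = k \<and> j \<notin> J. x $ j * (\<Prod>i\<in>J. x $ i))"
    by (rule sum_containing)
  also have "\<dots> = x $ j * elem_sym_omit k x j"
    by (simp add: elem_sym_omit_def sum_distrib_left)
  finally show ?thesis by simp
qed

text \<open>Both sides obey the same recursion in \<open>k\<close>. The right side is a polynomial
  in \<open>x $ j\<close> whose coefficients do not depend on \<open>j\<close>, which is why a
  Vandermonde matrix splits off from the Jacobian matrix.\<close>

lemma elem_sym_omit_quot_coeff:
  fixes x :: "complex ^ 'n::{finite,wellorder}"
  shows "elem_sym_omit k x j = (-1) ^ k * quot_coeff (symmetrization x) k (x $ j)"
proof (induction k)
  case 0
  have "{J. card J = 0 \<and> j \<notin> J} = {{}}" by auto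
  then show ?case by (simp add: elem_sym_omit_def)
next
  case (Suc k)
  then show ?case
    by (simp add: elem_sym_omit_Suc quot_coeff_Suc sym_coeff_symmetrization algebra_simps flip: power_mult_distrib)
qed

definition sym_jacobian :: "complex ^ 'n::{finite,wellorder} \<Rightarrow> complex ^ 'n::_ ^ 'n::_" where
  "sym_jacobian x = (\<chi> i j. elem_sym_omit (rk i) x j)"

lemma symmetrization_has_derivative:
  fixes x :: "complex ^ 'n::{finite,wellorder}"
  shows "(symmetrization has_derivative (\<lambda>h. sym_jacobian x *v h)) (at x)"
proof (rule has_derivative_vecI)
  fix i :: 'n
  have "((\<lambda>x. \<Sum>J | card J = Suc (rk i). \<Prod>j\<in>J. x $ j) has_derivative
     (\<lambda>h. \<Sum>J | card J = Suc (rk i). \<Sum>j\<in>J. h $ j * (\<Prod>l\<in>J - {j}. x $ l))) (at x)"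
    by (intro has_derivative_sum has_derivative_prod bounded_linear_imp_has_derivative bounded_linear_vec_nth)
  moreover have "(\<Sum>J | card J = Suc (rk i). \<Sum>j\<in>J. h $ j * (\<Prod>l\<in>J - {j}. x $ l)) = (sym_jacobian x *v h) $ i" for h :: "complex ^ 'n::_"
  proof -
    have inner: "(\<Sum>j\<in>J. g j) = (\<Sum>j\<in>UNIV. if j \<in> J then g j else 0)" for J :: "'n set" and g :: "'n \<Rightarrow> complex"
      by (simp add: sum.If_cases)
    have "(\<Sum>J | card J = Suc (rk i). \<Sum>j\<in>J. h $ j * (\<Prod>l\<in>J - {j}. x $ l)) =
      (\<Sum>J | card J = Suc (rk i). \<Sum>j\<in>UNIV. if j \<in> J then h $ j * (\<Prod>l\<in>J - {j}. x $ l) else 0)"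
      by (intro sum.cong[OF refl] inner)
    also have "\<dots> = (\<Sum>j\<in>UNIV. \<Sum>J | card J = Suc (rk i). if j \<in> J then h $ j * (\<Prod>l\<in>J - {j}. x $ l) else 0)"
      by (rule sum.swap)
    also have "\<dots> = (\<Sum>j\<in>UNIV. \<Sum>J | card J = Suc (rk i) \<and> j \<in> J. h $ j * (\<Prod>l\<in>J - {j}. x $ l))"
      by (rule sum.cong[OF refl], subst sum.inter_filter[symmetric]) simp_all
    also have "\<dots> = (\<Sum>j\<in>UNIV. \<Sum>J | card J = rk i \<and> j \<notin> J. h $ j * (\<Prod>l\<in>J. x $ l))"
      by (intro sum.cong refl sum_containing)
    also have "\<dots> = (sym_jacobian x *v h) $ i"
      by (simp add: sym_jacobian_def matrix_vector_mult_def elem_sym_omit_def sum_distrib_right sum_distrib_left mult.commute)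
    finally show ?thesis .
  qed
  ultimately show "((\<lambda>x. symmetrization x $ i) has_derivative (\<lambda>h. (sym_jacobian x *v h) $ i)) (at x)"
    by (simp add: symmetrization_def elem_sym_def card_atMost_rk)
qed

text \<open>The Jacobian matrix is a unitriangular matrix, up to signs, times the transposed Vandermonde matrix.\<close>

lemma norm_det_sym_jacobian:
  fixes x :: "complex ^ 'n::{finite,wellorder}"
  shows "norm (det (sym_jacobian x)) = norm (det (vander x))"
proof -
  define T :: "complex ^ 'n::_ ^ 'n::_" where
    "T = (\<chi> i a. if a \<le> i then (-1) ^ rk a * sym_coeff (symmetrization x) (rk i - rk a) else 0)"
  have "sym_jacobian x $ i $ j = (T ** transpose (vander x)) $ i $ j" for i j
  proof -
    let ?f = "\<lambda>a. if a \<le> rk i then (-1) ^ a * sym_coeff (symmetrization x) (rk i - a) * x $ j ^ a else 0"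
    have sgn: "(-1 :: complex) ^ k * (-1) ^ (k - a) = (-1) ^ a" if le: "a \<le> k" for k a
    proof -
      obtain b where "k = a + b" using le_Suc_ex[OF le] by blast
      then show ?thesis by (simp add: power_add mult.assoc flip: power_mult_distrib)
    qed
    have "sym_jacobian x $ i $ j = (\<Sum>a\<le>rk i. ((-1) ^ rk i * (-1) ^ (rk i - a)) * sym_coeff (symmetrization x) (rk i - a) * x $ j ^ a)"
      by (simp add: sym_jacobian_def elem_sym_omit_quot_coeff quot_coeff_def sum_distrib_left mult.assoc)
    also have "\<dots> = (\<Sum>a\<le>rk i. ?f a)"
      by (intro sum.cong refl) (simp add: sgn)
    also have "\<dots> = (\<Sum>a<CARD('n). ?f a)"
      using rk_less_CARD[of i] by (intro sum.mono_neutral_left) auto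
    also have "\<dots> = (\<Sum>a\<in>(UNIV :: 'n set). ?f (rk a))" by (rule sum_rk)
    also have "\<dots> = (T ** transpose (vander x)) $ i $ j"
      by (simp add: matrix_matrix_mult_def T_def transpose_def vander_def if_distrib[of "\<lambda>c. c * _"] cong: if_cong)
    finally show ?thesis .
  qed
  then have "sym_jacobian x = T ** transpose (vander x)" by (simp add: vec_eq_iff)
  then have "norm (det (sym_jacobian x)) = norm (det T) * norm (det (vander x))"
    by (simp add: det_mul det_transpose norm_mult)
  moreover have "det T = (\<Prod>i\<in>UNIV. T $ i $ i)" by (rule det_lowerdiagonal) (auto simp: T_def)
  then have "norm (det T) = 1"
    by (simp add: T_def sym_coeff_def norm_power flip: prod_norm)
  ultimately show ?thesis by simp
qed

section \<open>Change of variables for holomorphic maps\<close>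

text \<open>A row outside \<open>range e\<close> is a unit row, so in the Leibniz sum only
  permutations fixing every index outside \<open>range e\<close> survive, and these correspond to
  permutations of the smaller index type with equal sign. The entries of the other rows in columns
  outside \<open>range e\<close> never enter.\<close>

lemma det_extend_by_identity:
  fixes A :: "'a::comm_ring_1 ^ 'n ^ 'n" and e :: "'n \<Rightarrow> 'k::finite"
  assumes e: "inj e"
    and M1: "\<And>i j. M $ e i $ e j = A $ i $ j"
    and M2: "\<And>k l. k \<notin> range e \<Longrightarrow> M $ k $ l = (if k = l then 1 else 0)"
  shows "det (M :: 'a ^ 'k ^ 'k) = det A"
proof -
  have bij: "bij_betw (map_permutation UNIV e) {q. q permutes (UNIV :: 'n set)} {p. p permutes range e}"
  proof (rule bij_betwI[where g = "map_permutation (range e) (inv e)"])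
    have b: "bij_betw e UNIV (range e)" using e by (simp add: bij_betw_def)
    have b': "bij_betw (inv e) (range e) UNIV" using b by (rule bij_betw_inv_into)
    show "map_permutation UNIV e \<in> {q. q permutes UNIV} \<rightarrow> {p. p permutes range e}"
      using map_permutation_permutes[OF b] by auto
    show "map_permutation (range e) (inv e) \<in> {p. p permutes range e} \<rightarrow> {q. q permutes UNIV}"
      using map_permutation_permutes[OF b'] by auto
    show "map_permutation (range e) (inv e) (map_permutation UNIV e q) = q" if "q \<in> {q. q permutes UNIV}" for q
      using map_permutation_compose_inv[OF b, of q "inv e"] that e by auto
    show "map_permutation UNIV e (map_permutation (range e) (inv e) p) = p" if "p \<in> {p. p permutes range e}" for p
      using map_permutation_compose_inv[OF b', of p e] that e by (auto simp: f_inv_into_f)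
  qed
  have "det M = (\<Sum>p | p permutes range e. of_int (sign p) * (\<Prod>k\<in>UNIV. M $ k $ p k))"
    unfolding det_def
  proof (rule sum.mono_neutral_right)
    show "finite {p. p permutes (UNIV :: 'k set)}" by (simp add: finite_permutations)
    show "{p. p permutes range e} \<subseteq> {p. p permutes (UNIV :: 'k set)}" by (auto intro: permutes_subset)
    show "\<forall>p\<in>{p. p permutes UNIV} - {p. p permutes range e}. of_int (sign p) * (\<Prod>k\<in>UNIV. M $ k $ p k) = 0"
    proof
      fix p assume p: "p \<in> {p. p permutes (UNIV :: 'k set)} - {p. p permutes range e}"
      have "\<exists>k. k \<notin> range e \<and> p k \<noteq> k"
      proof (rule ccontr)
        assume "\<not> ?thesis"
        then have "p permutes range e" using p by (auto simp: permutes_def)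
        then show False using p by simp
      qed
      then obtain k where "k \<notin> range e" "p k \<noteq> k" by blast
      then have "M $ k $ p k = 0" using M2[of k "p k"] by auto
      then have "(\<Prod>k\<in>UNIV. M $ k $ p k) = 0" by (meson UNIV_I finite prod_zero)
      then show "of_int (sign p) * (\<Prod>k\<in>UNIV. M $ k $ p k) = 0" by simp
    qed
  qed
  also have "\<dots> = (\<Sum>q | q permutes (UNIV :: 'n set). of_int (sign (map_permutation UNIV e q)) * (\<Prod>k\<in>UNIV. M $ k $ map_permutation UNIV e q k))"
    by (rule sum.reindex_bij_betw[OF bij, symmetric])
  also have "\<dots> = (\<Sum>q | q permutes (UNIV :: 'n set). of_int (sign q) * (\<Prod>i\<in>UNIV. A $ i $ q i))"
  proof (rule sum.cong[OF refl])
    fix q assume "q \<in> {q. q permutes (UNIV :: 'n set)}"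
    then have q: "q permutes UNIV" by simp
    have m: "map_permutation UNIV e q (e i) = e (q i)" for i using map_permutation_apply[OF e] by simp
    have perm: "map_permutation UNIV e q permutes range e"
      by (rule map_permutation_permutes[OF _ q]) (use e in \<open>auto simp: bij_betw_def\<close>)
    have "(\<Prod>k\<in>UNIV. M $ k $ map_permutation UNIV e q k) = (\<Prod>k\<in>range e. M $ k $ map_permutation UNIV e q k)"
      by (rule prod.mono_neutral_right) (use perm in \<open>auto simp: M2 permutes_not_in\<close>)
    also have "\<dots> = (\<Prod>i\<in>UNIV. A $ i $ q i)"
      using e by (simp add: prod.reindex m M1)
    finally show "of_int (sign (map_permutation UNIV e q)) * (\<Prod>k\<in>UNIV. M $ k $ map_permutation UNIV e q k) = of_int (sign q) * (\<Prod>i\<in>UNIV. A $ i $ q i)"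
      using sign_map_permutation[OF e q] by simp
  qed
  finally show ?thesis by (simp add: det_def)
qed

text \<open>Real coordinates on \<open>\<complex>\<^sup>n\<close>.  The index type \<open>'n bit0\<close> has \<open>2 n\<close> elements and, as required by
  the change of variables theorem of the library, is well-ordered.\<close>

definition real_index :: "'n::finite bit0 \<Rightarrow> 'n \<times> bool" where
  "real_index = (SOME f. bij f)"

lemma bij_real_index: "bij (real_index :: 'n::finite bit0 \<Rightarrow> 'n \<times> bool)"
proof -
  have "card (UNIV :: 'n bit0 set) = card (UNIV :: ('n \<times> bool) set)"
    by (simp add: card_prod)
  then have "\<exists>f :: 'n bit0 \<Rightarrow> 'n \<times> bool. bij f"
    by (intro finite_same_card_bij) auto
  then show ?thesis unfolding real_index_def by (rule someI_ex)
qed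

definition to_real :: "complex ^ 'n::finite \<Rightarrow> real ^ 'n bit0" where
  "to_real x = (\<chi> k. if snd (real_index k) then Im (x $ fst (real_index k)) else Re (x $ fst (real_index k)))"

definition of_reals :: "real ^ 'n::finite bit0 \<Rightarrow> complex ^ 'n" where
  "of_reals y = (\<chi> i. Complex (y $ inv real_index (i, False)) (y $ inv real_index (i, True)))"

lemma real_index_inv [simp]: "real_index (inv real_index p) = p"
  by (rule surj_f_inv_f[OF bij_is_surj[OF bij_real_index]])

lemma inv_real_index [simp]: "inv real_index (real_index k) = k"
  by (rule inv_f_f[OF bij_is_inj[OF bij_real_index]])

lemma inv_real_index_eq_iff [simp]: "inv real_index p = inv real_index q \<longleftrightarrow> p = q"
  using bij_real_index by (metis real_index_inv)

lemma real_index_cases: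
  obtains i where "k = inv real_index (i, b)" "real_index k = (i, b)" | "snd (real_index k) \<noteq> b"
proof (cases "snd (real_index k) = b")
  case True
  then have "real_index k = (fst (real_index k), b)" by (simp add: prod_eq_iff)
  then have "inv real_index (real_index k) = inv real_index (fst (real_index k), b)" by (rule arg_cong)
  then have "k = inv real_index (fst (real_index k), b)" by (simp only: inv_real_index)
  then show ?thesis using \<open>real_index k = (fst (real_index k), b)\<close> by (rule that(1))
qed (rule that(2))

lemma of_reals_to_real [simp]: "of_reals (to_real x) = x"
  by (simp add: of_reals_def to_real_def vec_eq_iff complex_eq_iff)

lemma to_real_of_reals [simp]: "to_real (of_reals y) = y"
proof -
  have "to_real (of_reals y) $ k = y $ k" for k
  proof -
    obtain i b where p: "real_index k = (i, b)" by (rule prod.exhaust)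
    then have "inv real_index (real_index k) = inv real_index (i, b)" by (rule arg_cong)
    then have "k = inv real_index (i, b)" by (simp only: inv_real_index)
    then show ?thesis by (cases b) (simp_all add: of_reals_def to_real_def)
  qed
  then show ?thesis by (simp add: vec_eq_iff)
qed

lemma linear_to_real: "linear to_real"
  by (rule linearI) (auto simp: to_real_def vec_eq_iff)

lemma linear_of_reals: "linear of_reals"
  by (rule linearI) (auto simp: of_reals_def vec_eq_iff complex_eq_iff)

lemma sum_real_index:
  fixes f :: "'n::finite \<times> bool \<Rightarrow> 'a::comm_monoid_add"
  shows "(\<Sum>k\<in>UNIV. f (real_index k)) = (\<Sum>i\<in>UNIV. f (i, False) + f (i, True))"
proof -
  have "(\<Sum>k\<in>UNIV. f (real_index k)) = (\<Sum>p\<in>UNIV. f p)"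
    using sum.reindex_bij_betw[OF bij_real_index, of f] by simp
  also have "\<dots> = (\<Sum>i\<in>UNIV. \<Sum>b\<in>UNIV. f (i, b))"
    unfolding sum.cartesian_product UNIV_Times_UNIV by (rule sum.cong) auto
  finally show ?thesis by (simp add: UNIV_bool)
qed

lemma inner_to_real: "to_real x \<bullet> to_real y = x \<bullet> y"
proof -
  let ?f = "\<lambda>(i, b). (if b then Im (x $ i) else Re (x $ i)) * (if b then Im (y $ i) else Re (y $ i))"
  have "to_real x \<bullet> to_real y = (\<Sum>k\<in>UNIV. ?f (real_index k))"
    by (simp add: inner_vec_def to_real_def case_prod_beta)
  also have "\<dots> = x \<bullet> y" by (subst sum_real_index) (simp add: inner_vec_def inner_complex_def)
  finally show ?thesis .
qed

lemma to_real_Basis: "to_real ` (Basis :: (complex ^ 'n) set) = Basis"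
proof -
  have ax: "to_real (axis i (if b then \<i> else 1)) = axis (inv real_index (i, b)) 1" for i :: 'n and b
  proof -
    have "k = inv real_index (i, b) \<longleftrightarrow> real_index k = (i, b)" for k
      by (metis inv_real_index real_index_inv)
    then show ?thesis by (auto simp: to_real_def axis_def vec_eq_iff prod_eq_iff)
  qed
  have B: "(Basis :: (complex ^ 'n) set) = {axis i (if b then \<i> else 1) | i b. True}"
    by (auto simp: Basis_vec_def Basis_complex_def)
  have "to_real ` (Basis :: (complex ^ 'n) set) = {axis (inv real_index (i, b)) 1 | i b. True}"
    unfolding B by (auto simp: ax image_iff) (metis ax)+
  also have "\<dots> = Basis"
  proof -
    have "\<exists>i b. k = inv real_index (i :: 'n, b)" for k by (metis inv_real_index surj_pair)
    then have "\<exists>i b. axis k (1 :: real) = axis (inv real_index (i :: 'n, b)) 1" for k by metis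
    then show ?thesis by (auto simp: Basis_vec_def)
  qed
  finally show ?thesis .
qed

lemma continuous_to_real: "continuous_on S to_real"
  using linear_to_real linear_conv_bounded_linear linear_continuous_on by blast

lemma continuous_of_reals: "continuous_on S of_reals"
  using linear_of_reals linear_conv_bounded_linear linear_continuous_on by blast

text \<open>The coordinate map is isometric and carries the standard basis to the standard basis,
  hence boxes to boxes of equal volume, and boxes determine Lebesgue measure.\<close>

lemma lborel_distr_of_reals: "lborel = distr lborel borel (of_reals :: real ^ 'n::finite bit0 \<Rightarrow> complex ^ 'n)"
proof (rule lborel_eqI)
  have meas: "of_reals \<in> borel_measurable (lborel :: (real ^ 'n bit0) measure)"
    using borel_measurable_continuous_onI[OF continuous_of_reals] by simp
  fix l u :: "complex ^ 'n" assume lu: "\<And>b. b \<in> Basis \<Longrightarrow> l \<bullet> b \<le> u \<bullet> b"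
  have inj: "inj to_real" by (metis inj_onI of_reals_to_real)
  have inn: "y \<bullet> to_real b = of_reals y \<bullet> b" for y and b :: "complex ^ 'n"
    by (metis inner_to_real to_real_of_reals)
  have "of_reals -` box l u = box (to_real l) (to_real u)"
    by (auto simp: box_def to_real_Basis[symmetric] inn)
  then have "emeasure (distr lborel borel of_reals) (box l u) = emeasure lborel (box (to_real l) (to_real u))"
    using meas by (simp add: emeasure_distr)
  also have "\<dots> = (\<Prod>b\<in>Basis. (to_real u - to_real l) \<bullet> b)"
    by (subst emeasure_lborel_box) (auto simp: to_real_Basis[symmetric] inner_to_real lu)
  also have "\<dots> = (\<Prod>b\<in>Basis. (u - l) \<bullet> b)"
    unfolding to_real_Basis[symmetric]
    by (simp add: prod.reindex[OF inj_on_subset[OF inj subset_UNIV]] inner_diff_left inner_to_real)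
  finally show "emeasure (distr lborel borel of_reals) (box l u) = (\<Prod>b\<in>Basis. (u - l) \<bullet> b)" .
qed simp

text \<open>Over \<open>\<complex>\<close> the real matrix of \<open>A\<close> is conjugate to the block diagonal matrix of \<open>A\<close> and \<open>cnj A\<close>.\<close>

lemma det_real_matrix:
  fixes A :: "complex ^ 'n ^ 'n"
  shows "det (matrix (\<lambda>y. to_real (A *v of_reals y))) = (norm (det A))\<^sup>2"
proof -
  let ?ix = "real_index :: 'n bit0 \<Rightarrow> 'n \<times> bool"
  define R where "R = matrix (\<lambda>y. to_real (A *v of_reals y))"
  define C :: "complex ^ 'n bit0 ^ 'n bit0" where "C = (\<chi> k l. of_real (R $ k $ l))"
  define ent where "ent p q = (let a = A $ fst p $ fst q in
     if snd p then (if snd q then Re a else Im a) else (if snd q then - Im a else Re a))" for p q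
  have Rent: "R $ k $ l = ent (?ix k) (?ix l)" for k l
  proof -
    have ofr: "of_reals (axis l 1) $ i = (if fst (?ix l) = i then (if snd (?ix l) then \<i> else 1) else 0)" for i
    proof -
      have "inv ?ix (i, b) = l \<longleftrightarrow> ?ix l = (i, b)" for b by (metis inv_real_index real_index_inv)
      then show ?thesis by (cases "?ix l") (simp add: of_reals_def axis_def complex_eq_iff)
    qed
    have "(A *v of_reals (axis l 1)) $ i = A $ i $ fst (?ix l) * (if snd (?ix l) then \<i> else 1)" for i
      by (simp add: matrix_vector_mult_def ofr if_distrib[of "\<lambda>c. _ * c"] cong: if_cong)
    then show ?thesis by (simp add: R_def matrix_def to_real_def ent_def Let_def)
  qed
  \<comment> \<open>\<open>J\<close> passes from real and imaginary parts to the coordinates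
    \<open>z\<close> and \<open>cnj z\<close>, and \<open>W\<close> is the inverse passage. In the
    new coordinates \<open>A\<close> acts on \<open>z\<close> and its conjugate on
    \<open>cnj z\<close>, which is the matrix \<open>B\<close>.\<close>
  define J :: "complex ^ 'n bit0 ^ 'n bit0" where
    "J = (\<chi> k l. if fst (?ix k) = fst (?ix l) then (if snd (?ix l) then (if snd (?ix k) then - \<i> else \<i>) else 1) else 0)"
  define W :: "complex ^ 'n bit0 ^ 'n bit0" where
    "W = (\<chi> k l. if fst (?ix k) = fst (?ix l) then (if snd (?ix k) then (if snd (?ix l) then \<i> / 2 else - \<i> / 2) else 1 / 2) else 0)"
  define B :: "complex ^ 'n bit0 ^ 'n bit0" where
    "B = (\<chi> k l. if snd (?ix k) = snd (?ix l) then (if snd (?ix k) then cnj (A $ fst (?ix k) $ fst (?ix l)) else A $ fst (?ix k) $ fst (?ix l)) else 0)"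
  \<comment> \<open>The two diagonal blocks of \<open>B\<close> are separated, each completed by an
    identity block, so that \<open>det_extend_by_identity\<close> evaluates them one at a
    time.\<close>
  define B1 :: "complex ^ 'n bit0 ^ 'n bit0" where
    "B1 = (\<chi> k l. if snd (?ix k) then (if k = l then 1 else 0) else if snd (?ix l) then 0 else A $ fst (?ix k) $ fst (?ix l))"
  define B2 :: "complex ^ 'n bit0 ^ 'n bit0" where
    "B2 = (\<chi> k l. if \<not> snd (?ix k) then (if k = l then 1 else 0) else if \<not> snd (?ix l) then 0 else cnj (A $ fst (?ix k) $ fst (?ix l)))"
  have ix_eq: "k = l \<longleftrightarrow> fst (?ix k) = fst (?ix l) \<and> snd (?ix k) = snd (?ix l)" for k l
  proof
    assume "fst (?ix k) = fst (?ix l) \<and> snd (?ix k) = snd (?ix l)"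
    then have "?ix k = ?ix l" by (simp add: prod_eq_iff)
    then have "inv ?ix (?ix k) = inv ?ix (?ix l)" by (rule arg_cong)
    then show "k = l" by simp
  qed simp
  have prod_entry: "(X ** Y) $ k $ l = (\<Sum>i\<in>UNIV. x (?ix k) (i, False) * y (i, False) (?ix l) + x (?ix k) (i, True) * y (i, True) (?ix l))"
    if "X = (\<chi> k l. x (?ix k) (?ix l))" "Y = (\<chi> k l. y (?ix k) (?ix l))" for X Y :: "complex ^ 'n bit0 ^ 'n bit0" and x y :: "'n \<times> bool \<Rightarrow> 'n \<times> bool \<Rightarrow> complex" and k l
  proof -
    have "(X ** Y) $ k $ l = (\<Sum>m\<in>UNIV. x (?ix k) (?ix m) * y (?ix m) (?ix l))"
      by (simp add: that matrix_matrix_mult_def)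
    also have "\<dots> = (\<Sum>i\<in>UNIV. x (?ix k) (i, False) * y (i, False) (?ix l) + x (?ix k) (i, True) * y (i, True) (?ix l))"
      by (rule sum_real_index[of "\<lambda>p. x (?ix k) p * y p (?ix l)"])
    finally show ?thesis .
  qed
  \<comment> \<open>The same matrices as functions of pairs, so that a sum over the real index type
    splits into a sum over \<open>'n\<close> with two terms each.\<close>
  define Jx where "Jx p q = (if fst p = fst q then (if snd q then (if snd p then - \<i> else \<i>) else 1) else 0)" for p q :: "'n \<times> bool"
  define Wx where "Wx p q = (if fst p = fst q then (if snd p then (if snd q then \<i> / 2 else - \<i> / 2) else 1 / 2) else 0)" for p q :: "'n \<times> bool"
  define Bx where "Bx p q = (if snd p = snd q then (if snd p then cnj (A $ fst p $ fst q) else A $ fst p $ fst q) else 0)" for p q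
  define B1x where "B1x p q = (if snd p then (if p = q then 1 else 0) else if snd q then 0 else A $ fst p $ fst q)" for p q
  define B2x where "B2x p q = (if \<not> snd p then (if p = q then 1 else 0) else if \<not> snd q then 0 else cnj (A $ fst p $ fst q))" for p q
  have C: "C = (\<chi> k l. complex_of_real (ent (?ix k) (?ix l)))" by (simp add: C_def Rent)
  have J: "J = (\<chi> k l. Jx (?ix k) (?ix l))" by (simp add: J_def Jx_def)
  have W: "W = (\<chi> k l. Wx (?ix k) (?ix l))" by (simp add: W_def Wx_def)
  have Bm: "B = (\<chi> k l. Bx (?ix k) (?ix l))" by (simp add: B_def Bx_def)
  have B1m: "B1 = (\<chi> k l. B1x (?ix k) (?ix l))" by (simp add: B1_def B1x_def vec_eq_iff ix_eq prod_eq_iff)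
  have B2m: "B2 = (\<chi> k l. B2x (?ix k) (?ix l))" by (simp add: B2_def B2x_def vec_eq_iff ix_eq prod_eq_iff)
  have d1: "(\<Sum>i\<in>UNIV. if a = i then h i else 0) = h a" "(\<Sum>i\<in>UNIV. if i = a then h i else 0) = h a"
    for a :: 'n and h :: "'n \<Rightarrow> complex"
    by simp_all
  have pJ: "(\<Sum>i\<in>UNIV. Jx (a, s) (i, False) * f i + Jx (a, s) (i, True) * g i) = f a + (if s then - \<i> else \<i>) * g a"
    and Jp: "(\<Sum>i\<in>UNIV. f i * Jx (i, False) (a, s) + g i * Jx (i, True) (a, s)) =
      (if s then \<i> * f a - \<i> * g a else f a + g a)" for a s f g
  proof -
    have "(\<Sum>i\<in>UNIV. Jx (a, s) (i, False) * f i + Jx (a, s) (i, True) * g i) =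
        (\<Sum>i\<in>UNIV. if a = i then f i + (if s then - \<i> else \<i>) * g i else 0)"
      by (intro sum.cong refl) (simp add: Jx_def)
    then show "(\<Sum>i\<in>UNIV. Jx (a, s) (i, False) * f i + Jx (a, s) (i, True) * g i) = f a + (if s then - \<i> else \<i>) * g a"
      by (simp only: d1)
    have "(\<Sum>i\<in>UNIV. f i * Jx (i, False) (a, s) + g i * Jx (i, True) (a, s)) =
        (\<Sum>i\<in>UNIV. if i = a then (if s then \<i> * f i - \<i> * g i else f i + g i) else 0)"
      by (intro sum.cong refl) (simp add: Jx_def)
    then show "(\<Sum>i\<in>UNIV. f i * Jx (i, False) (a, s) + g i * Jx (i, True) (a, s)) =
      (if s then \<i> * f a - \<i> * g a else f a + g a)"
      by (simp only: d1)
  qed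
  have JC: "J ** C = B ** J"
  proof -
    have "(J ** C) $ k $ l = (B ** J) $ k $ l" for k l
    proof -
      obtain a s c t where kl: "?ix k = (a, s)" "?ix l = (c, t)" by (metis surj_pair)
      show ?thesis unfolding prod_entry[OF J C] prod_entry[OF Bm J] kl pJ Jp
        by (cases s; cases t; simp add: ent_def Bx_def Let_def complex_eq_iff)
    qed
    then show ?thesis by (simp add: vec_eq_iff)
  qed
  have WJ: "W ** J = mat 1"
  proof -
    have "(W ** J) $ k $ l = (mat 1 :: complex ^ 'n bit0 ^ 'n bit0) $ k $ l" for k l
    proof -
      obtain a s c t where kl: "?ix k = (a, s)" "?ix l = (c, t)" by (metis surj_pair)
      show ?thesis unfolding prod_entry[OF W J] kl Jp mat_def
        by (cases s; cases t; simp add: Wx_def ix_eq kl)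
    qed
    then show ?thesis by (simp add: vec_eq_iff)
  qed
  have "det W * det J = 1" using det_mul[of W J] by (simp add: WJ)
  then have "det J \<noteq> 0" by auto
  moreover have "det J * det C = det B * det J" using arg_cong[OF JC, of det] by (simp add: det_mul)
  ultimately have "det C = det B" by simp
  also have "B = B1 ** B2"
  proof -
    have "B $ k $ l = (B1 ** B2) $ k $ l" for k l
    proof -
      obtain a s c t where kl: "?ix k = (a, s)" "?ix l = (c, t)" by (metis surj_pair)
      have "(\<Sum>i\<in>UNIV. B1x (a, s) (i, False) * B2x (i, False) (c, t) + B1x (a, s) (i, True) * B2x (i, True) (c, t)) =
        (\<Sum>i\<in>UNIV. if (if s then a = i else i = c) then Bx (a, s) (c, t) else 0)"
        by (intro sum.cong refl) (cases s; cases t; simp add: B1x_def B2x_def Bx_def)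
      then have "(B1 ** B2) $ k $ l = Bx (a, s) (c, t)"
        unfolding prod_entry[OF B1m B2m] kl by (cases s) simp_all
      then show ?thesis by (simp add: Bm kl)
    qed
    then show ?thesis by (simp add: vec_eq_iff)
  qed
  then have "det B = det B1 * det B2" by (simp add: det_mul)
  also have "det B1 = det A"
  proof (rule det_extend_by_identity[of "\<lambda>i. inv ?ix (i, False)"])
    show "inj (\<lambda>i. inv ?ix (i, False))" by (rule injI) simp
    show "B1 $ k $ l = (if k = l then 1 else 0)" if "k \<notin> range (\<lambda>i. inv ?ix (i, False))" for k l
      using that by (cases k rule: real_index_cases[of _ False]) (auto simp: B1_def)
  qed (simp add: B1_def)
  also have "det B2 = det (\<chi> i j. cnj (A $ i $ j))"
  proof (rule det_extend_by_identity[of "\<lambda>i. inv ?ix (i, True)"])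
    show "inj (\<lambda>i. inv ?ix (i, True))" by (rule injI) simp
    show "B2 $ k $ l = (if k = l then 1 else 0)" if "k \<notin> range (\<lambda>i. inv ?ix (i, True))" for k l
      using that by (cases k rule: real_index_cases[of _ True]) (auto simp: B2_def)
  qed (simp add: B2_def)
  also have "\<dots> = cnj (det A)" by (simp add: det_def)
  finally have "det C = of_real ((norm (det A))\<^sup>2)" by (simp only: complex_norm_square)
  moreover have "det C = of_real (det R)" by (simp add: C_def det_def)
  ultimately have "det R = (norm (det A))\<^sup>2" by (simp only: of_real_eq_iff)
  then show ?thesis by (simp add: R_def)
qed

section \<open>Integrals in real coordinates and the complex change of variables\<close>

lemma borel_measurable_to_real: "of_reals \<in> borel_measurable borel" "to_real \<in> borel_measurable borel"
  by (auto intro: borel_measurable_continuous_onI continuous_of_reals continuous_to_real)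

lemma integral_of_reals:
  fixes h :: "complex ^ 'n::finite \<Rightarrow> 'b::{banach, second_countable_topology}"
  assumes "h \<in> borel_measurable borel"
  shows "integrable lborel h \<longleftrightarrow> integrable lborel (\<lambda>y. h (of_reals y))"
    and "integral\<^sup>L lborel h = (\<integral>y. h (of_reals y) \<partial>lborel)"
  by (subst lborel_distr_of_reals, simp add: integrable_distr_eq integral_distr borel_measurable_to_real assms)+

text \<open>The change of variables theorem concerns absolute integrability of vector-valued
  functions in the gauge sense. This translates it, for values in \<open>real ^ 1\<close>, into
  Lebesgue integrals with an indicator.\<close>

lemma absolutely_integrable_on_iff_lborel:
  fixes u :: "'a::euclidean_space \<Rightarrow> real"
  assumes "(\<lambda>x. indicator X x * u x) \<in> borel_measurable borel"
  shows "(\<lambda>x. vec (u x) :: real ^ 1) absolutely_integrable_on X \<longleftrightarrow> integrable lborel (\<lambda>x. indicator X x * u x)"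
    and "integrable lborel (\<lambda>x. indicator X x * u x) \<Longrightarrow> integral X (\<lambda>x. vec (u x) :: real ^ 1) = vec (\<integral>x. indicator X x * u x \<partial>lborel)"
proof -
  have 1: "u absolutely_integrable_on X \<longleftrightarrow> integrable lborel (\<lambda>x. indicator X x * u x)"
    unfolding set_integrable_def using integrable_completion[of "\<lambda>x. indicator X x * u x" lborel] assms by simp
  show "(\<lambda>x. vec (u x) :: real ^ 1) absolutely_integrable_on X \<longleftrightarrow> integrable lborel (\<lambda>x. indicator X x * u x)"
    unfolding 1[symmetric] absolutely_integrable_on_1_iff by simp
  assume int: "integrable lborel (\<lambda>x. indicator X x * u x)"
  then have "integral X u = (LINT x:X|lebesgue. u x)"
    using set_lebesgue_integral_eq_integral(2) 1 by metis
  also have "\<dots> = (\<integral>x. indicator X x * u x \<partial>lborel)"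
    unfolding set_lebesgue_integral_def using integral_completion[of "\<lambda>x. indicator X x * u x" lborel] assms by simp
  finally show "integral X (\<lambda>x. vec (u x) :: real ^ 1) = vec (\<integral>x. indicator X x * u x \<partial>lborel)"
    by (simp add: integral_on_1_eq vec_eq_iff)
qed

text \<open>In real coordinates the Jacobian determinant of a map with complex linear derivative is
  the squared modulus of the complex one; it is nonnegative, so no absolute value remains.\<close>

lemma change_of_variables_complex_real:
  fixes g :: "complex ^ 'n \<Rightarrow> complex ^ 'n" and u :: "complex ^ 'n \<Rightarrow> real" and A :: "complex ^ 'n \<Rightarrow> complex ^ 'n ^ 'n"
  assumes S: "open S" and inj: "inj_on g S"
    and der: "\<And>x. x \<in> S \<Longrightarrow> (g has_derivative (*v) (A x)) (at x)"
    and U: "(\<lambda>x. indicator (g ` S) x * u x) \<in> borel_measurable borel"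
    and V: "(\<lambda>x. indicator S x * ((norm (det (A x)))\<^sup>2 * u (g x))) \<in> borel_measurable borel"
  shows "integrable lborel (\<lambda>x. indicator S x * ((norm (det (A x)))\<^sup>2 * u (g x))) \<longleftrightarrow> integrable lborel (\<lambda>x. indicator (g ` S) x * u x)"
    and "integrable lborel (\<lambda>x. indicator (g ` S) x * u x) \<Longrightarrow>
      (\<integral>x. indicator S x * ((norm (det (A x)))\<^sup>2 * u (g x)) \<partial>lborel) = (\<integral>x. indicator (g ` S) x * u x \<partial>lborel)"
proof -
  define S' where "S' = of_reals -` S"
  define g' where "g' y = to_real (g (of_reals y))" for y
  define D where "D y = (\<lambda>h. to_real (A (of_reals y) *v of_reals h))" for y
  have oS': "open S'" unfolding S'_def using S continuous_of_reals by (rule open_vimage)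
  have lin: "bounded_linear (of_reals :: real ^ 'n bit0 \<Rightarrow> complex ^ 'n)" "bounded_linear (to_real :: complex ^ 'n \<Rightarrow> real ^ 'n bit0)"
    using linear_of_reals linear_to_real linear_conv_bounded_linear by blast+
  have der': "(g' has_derivative D y) (at y within S')" if "y \<in> S'" for y
  proof -
    have "(g has_derivative (*v) (A (of_reals y))) (at (of_reals y))" using der that by (simp add: S'_def)
    from has_derivative_compose[OF bounded_linear_imp_has_derivative[OF lin(1)] this]
    have "((\<lambda>y. g (of_reals y)) has_derivative (\<lambda>h. A (of_reals y) *v of_reals h)) (at y)" .
    from bounded_linear.has_derivative[OF lin(2) this] show ?thesis
      unfolding g'_def D_def by (rule has_derivative_at_withinI)
  qed
  have inj': "inj_on g' S'"
    using inj by (auto simp: inj_on_def g'_def S'_def) (metis of_reals_to_real to_real_of_reals)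
  have img: "g' ` S' = of_reals -` (g ` S)"
  proof (intro set_eqI iffI)
    fix y assume "y \<in> of_reals -` (g ` S)"
    then obtain x where x: "x \<in> S" "of_reals y = g x" by auto
    then have "g' (to_real x) = y" unfolding g'_def by (metis of_reals_to_real to_real_of_reals)
    moreover have "to_real x \<in> S'" using x by (simp add: S'_def)
    ultimately show "y \<in> g' ` S'" by blast
  qed (auto simp: g'_def S'_def)
  define f where "f y = (vec (u (of_reals y)) :: real ^ 1)" for y
  have detD: "\<bar>det (matrix (D y))\<bar> = (norm (det (A (of_reals y))))\<^sup>2" for y
    by (simp add: D_def det_real_matrix)
  have cov: "(\<lambda>y. vec ((norm (det (A (of_reals y))))\<^sup>2 * u (g (of_reals y))) :: real ^ 1) absolutely_integrable_on S' \<and>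
      integral S' (\<lambda>y. vec ((norm (det (A (of_reals y))))\<^sup>2 * u (g (of_reals y))) :: real ^ 1) = b \<longleftrightarrow>
    f absolutely_integrable_on (g' ` S') \<and> integral (g' ` S') f = b" for b
  proof -
    have "S' \<in> sets lebesgue" using oS' by auto
    from has_absolute_integral_change_of_variables[OF this der' inj', of f b]
    have "(\<lambda>x. \<bar>det (matrix (D x))\<bar> *\<^sub>R f (g' x)) absolutely_integrable_on S' \<and>
      integral S' (\<lambda>x. \<bar>det (matrix (D x))\<bar> *\<^sub>R f (g' x)) = b \<longleftrightarrow> f absolutely_integrable_on (g' ` S') \<and> integral (g' ` S') f = b" .
    moreover have "\<bar>det (matrix (D x))\<bar> *\<^sub>R f (g' x) = vec ((norm (det (A (of_reals x))))\<^sup>2 * u (g (of_reals x)))" for x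
      unfolding detD by (simp add: f_def g'_def vec_eq_iff)
    ultimately show ?thesis by simp
  qed
  let ?V = "\<lambda>x. indicator S x * ((norm (det (A x)))\<^sup>2 * u (g x))" and ?U = "\<lambda>x. indicator (g ` S) x * u x"
  let ?v = "\<lambda>y. (norm (det (A (of_reals y))))\<^sup>2 * u (g (of_reals y))"
  have V': "(\<lambda>y. indicator S' y * ?v y) = (\<lambda>y. ?V (of_reals y))" by (auto simp: S'_def indicator_def)
  have U': "(\<lambda>y. indicator (g' ` S') y * u (of_reals y)) = (\<lambda>y. ?U (of_reals y))" by (auto simp: img indicator_def)
  have mV: "(\<lambda>y. indicator S' y * ?v y) \<in> borel_measurable borel"
    unfolding V' using measurable_compose[OF borel_measurable_to_real(1) V] .
  have mU: "(\<lambda>y. indicator (g' ` S') y * u (of_reals y)) \<in> borel_measurable borel"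
    unfolding U' using measurable_compose[OF borel_measurable_to_real(1) U] .
  note iV = absolutely_integrable_on_iff_lborel[OF mV] and iU = absolutely_integrable_on_iff_lborel[OF mU]
  have cov': "integrable lborel (\<lambda>y. ?V (of_reals y)) \<and> integral S' (\<lambda>y. vec (?v y) :: real ^ 1) = b \<longleftrightarrow>
     integrable lborel (\<lambda>y. ?U (of_reals y)) \<and> integral (g' ` S') (\<lambda>y. vec (u (of_reals y)) :: real ^ 1) = b" for b
    using cov[of b] unfolding f_def iV(1) iU(1) V' U' .
  then have eqi: "integrable lborel (\<lambda>y. ?V (of_reals y)) \<longleftrightarrow> integrable lborel (\<lambda>y. ?U (of_reals y))" by blast
  then show "integrable lborel ?V \<longleftrightarrow> integrable lborel ?U"
    using integral_of_reals(1)[OF V] integral_of_reals(1)[OF U] by simp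
  assume "integrable lborel ?U"
  then have intU: "integrable lborel (\<lambda>y. ?U (of_reals y))" using integral_of_reals(1)[OF U] by simp
  with eqi have intV: "integrable lborel (\<lambda>y. ?V (of_reals y))" by simp
  have "integral S' (\<lambda>y. vec (?v y) :: real ^ 1) = integral (g' ` S') (\<lambda>y. vec (u (of_reals y)) :: real ^ 1)"
    using cov' intU intV by blast
  then have "vec (\<integral>y. ?V (of_reals y) \<partial>lborel) = (vec (\<integral>y. ?U (of_reals y) \<partial>lborel) :: real ^ 1)"
    using iV(2) iU(2) intU intV unfolding V' U' by simp
  then have "(\<integral>y. ?V (of_reals y) \<partial>lborel) = (\<integral>y. ?U (of_reals y) \<partial>lborel)" by (simp add: vec_eq_iff)
  then show "integral\<^sup>L lborel ?V = integral\<^sup>L lborel ?U"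
    using integral_of_reals(2)[OF V] integral_of_reals(2)[OF U] by simp
qed

lemma change_of_variables_complex:
  fixes g :: "complex ^ 'n \<Rightarrow> complex ^ 'n" and f :: "complex ^ 'n \<Rightarrow> complex" and A :: "complex ^ 'n \<Rightarrow> complex ^ 'n ^ 'n"
  assumes S: "open S" "inj_on g S" "\<And>x. x \<in> S \<Longrightarrow> (g has_derivative (*v) (A x)) (at x)"
    and U: "(\<lambda>x. indicator (g ` S) x * f x) \<in> borel_measurable borel"
    and V: "(\<lambda>x. indicator S x * ((norm (det (A x)))\<^sup>2 * f (g x))) \<in> borel_measurable borel"
    and int: "integrable lborel (\<lambda>x. indicator (g ` S) x * f x)"
  shows "(\<integral>x. indicator S x * ((norm (det (A x)))\<^sup>2 * f (g x)) \<partial>lborel) = (\<integral>x. indicator (g ` S) x * f x \<partial>lborel)"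
proof -
  let ?V = "\<lambda>x. indicator S x * (complex_of_real ((norm (det (A x)))\<^sup>2) * f (g x))" and ?U = "\<lambda>x. indicator (g ` S) x * f x"
  have ind: "indicator X x = complex_of_real (indicator X x)" for X and x :: "complex ^ 'n" by (simp add: indicator_def)
  have re: "Re (?U x) = indicator (g ` S) x * Re (f x)" "Im (?U x) = indicator (g ` S) x * Im (f x)"
    "Re (?V x) = indicator S x * ((norm (det (A x)))\<^sup>2 * Re (f (g x)))" "Im (?V x) = indicator S x * ((norm (det (A x)))\<^sup>2 * Im (f (g x)))" for x
    unfolding ind by (simp_all only: Re_complex_of_real Im_complex_of_real times_complex.simps) simp_all
  have V': "?V \<in> borel_measurable borel" using V by simp
  note mR = measurable_compose[OF U borel_measurable_Re, unfolded re] measurable_compose[OF V' borel_measurable_Re, unfolded re]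
  note mI = measurable_compose[OF U borel_measurable_Im, unfolded re] measurable_compose[OF V' borel_measurable_Im, unfolded re]
  have iR: "integrable lborel (\<lambda>x. indicator (g ` S) x * Re (f x))" and iI: "integrable lborel (\<lambda>x. indicator (g ` S) x * Im (f x))"
    using integrable_Re[OF int] integrable_Im[OF int] unfolding re by auto
  have vR: "integrable lborel (\<lambda>x. Re (?V x))" and vI: "integrable lborel (\<lambda>x. Im (?V x))"
    unfolding re using change_of_variables_complex_real(1)[OF S mR] iR change_of_variables_complex_real(1)[OF S mI] iI by auto
  have "integrable lborel (\<lambda>x. complex_of_real (Re (?V x)) + \<i> * complex_of_real (Im (?V x)))"
    using integrable_of_real[OF vR] integrable_of_real[OF vI]
    by (rule Bochner_Integration.integrable_add[OF _ integrable_mult_right])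
  then have vV: "integrable lborel ?V" by (simp only: complex_eq[symmetric])
  have "integral\<^sup>L lborel ?V = integral\<^sup>L lborel ?U"
  proof (rule complex_eqI)
    show "Re (integral\<^sup>L lborel ?V) = Re (integral\<^sup>L lborel ?U)"
      using change_of_variables_complex_real(2)[OF S mR iR] by (simp only: integral_Re[OF vV, symmetric] integral_Re[OF int, symmetric] re)
    show "Im (integral\<^sup>L lborel ?V) = Im (integral\<^sup>L lborel ?U)"
      using change_of_variables_complex_real(2)[OF S mI iI] by (simp only: integral_Im[OF vV, symmetric] integral_Im[OF int, symmetric] re)
  qed
  then show ?thesis by simp
qed

section \<open>The Bergman kernel of the disc\<close>

text \<open>Identifies Lebesgue measure with the product over the complex coordinates, so that
  integration can proceed one disc variable at a time.\<close>

lemma lborel_vec: "lborel = distr (\<Pi>\<^sub>M i\<in>UNIV. lborel) borel (\<lambda>f. (\<chi> i. f i) :: complex ^ 'n)"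
proof (rule lborel_eqI)
  interpret product_sigma_finite "\<lambda>_ :: 'n. lborel :: complex measure" ..
  have meas: "(\<lambda>f. \<chi> i. f i) \<in> measurable (\<Pi>\<^sub>M i\<in>(UNIV :: 'n set). (lborel :: complex measure)) borel"
    by (subst borel_measurable_euclidean_space) (auto simp: Basis_vec_def inner_axis)
  fix l u :: "complex ^ 'n" assume lu: "\<And>b. b \<in> Basis \<Longrightarrow> l \<bullet> b \<le> u \<bullet> b"
  have comp: "l $ i \<bullet> b \<le> u $ i \<bullet> b" if "b \<in> Basis" for i b
    using lu[of "axis i b"] that by (auto simp: Basis_vec_def inner_axis)
  have "(\<lambda>f. \<chi> i. f i) -` box l u \<inter> space (\<Pi>\<^sub>M i\<in>(UNIV :: 'n set). (lborel :: complex measure)) = (\<Pi>\<^sub>E i\<in>UNIV. box (l $ i) (u $ i))"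
    by (auto simp: space_PiM box_def Basis_vec_def inner_axis)
  then have "emeasure (distr (\<Pi>\<^sub>M i\<in>(UNIV :: 'n set). (lborel :: complex measure)) borel (\<lambda>f. \<chi> i. f i)) (box l u) =
      emeasure (\<Pi>\<^sub>M i\<in>UNIV. lborel) (\<Pi>\<^sub>E i\<in>UNIV. box (l $ i) (u $ i))"
    using meas by (simp add: emeasure_distr)
  also have "\<dots> = (\<Prod>i\<in>UNIV. emeasure lborel (box (l $ i) (u $ i)))"
    by (rule emeasure_PiM) auto
  also have "\<dots> = (\<Prod>i\<in>UNIV. ennreal (\<Prod>b\<in>Basis. (u $ i - l $ i) \<bullet> b))"
    by (rule prod.cong[OF refl], rule emeasure_lborel_box) (use comp in auto)
  also have "\<dots> = ennreal (\<Prod>i\<in>UNIV. \<Prod>b\<in>Basis. (u $ i - l $ i) \<bullet> b)"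
    by (rule prod_ennreal) (auto intro!: prod_nonneg simp: inner_diff_left comp)
  also have "(\<Prod>i\<in>UNIV. \<Prod>b\<in>Basis. (u $ i - l $ i) \<bullet> b) = (\<Prod>b\<in>Basis. (u - l) \<bullet> b)"
  proof -
    have "(\<Prod>i\<in>UNIV. \<Prod>b\<in>Basis. (u $ i - l $ i) \<bullet> b) = (\<Prod>(i, b)\<in>UNIV \<times> Basis. (u $ i - l $ i) \<bullet> b)"
      by (simp add: prod.cartesian_product)
    also have "\<dots> = (\<Prod>b\<in>Basis. (u - l) \<bullet> b)"
    proof -
      have bij: "bij_betw (\<lambda>(i, b). axis i b) (UNIV \<times> Basis) (Basis :: (complex ^ 'n) set)"
      proof (rule bij_betw_imageI)
        show "inj_on (\<lambda>(i, b). axis i b :: complex ^ 'n) (UNIV \<times> Basis)"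
          by (auto simp: inj_on_def axis_eq_axis nonzero_Basis)
        show "(\<lambda>(i, b). axis i b) ` (UNIV \<times> Basis) = (Basis :: (complex ^ 'n) set)"
          unfolding Basis_vec_def by force
      qed
      show ?thesis
        by (subst prod.reindex_bij_betw[OF bij, symmetric]) (auto intro!: prod.cong simp: inner_axis)
    qed
    finally show ?thesis .
  qed
  finally show "emeasure (distr (\<Pi>\<^sub>M i\<in>UNIV. lborel) borel (\<lambda>f. (\<chi> i. f i) :: complex ^ 'n)) (box l u) = (\<Prod>b\<in>Basis. (u - l) \<bullet> b)" .
qed simp

lemma integral_vec:
  fixes h :: "complex ^ 'n::finite \<Rightarrow> complex"
  assumes "h \<in> borel_measurable borel"
  shows "integrable lborel h \<longleftrightarrow> integrable (\<Pi>\<^sub>M i\<in>UNIV. lborel) (\<lambda>f. h (\<chi> i. f i))"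
    and "integral\<^sup>L lborel h = (\<integral>f. h (\<chi> i. f i) \<partial>(\<Pi>\<^sub>M i\<in>UNIV. lborel))"
proof -
  have meas: "(\<lambda>f. \<chi> i. f i) \<in> measurable (\<Pi>\<^sub>M i\<in>(UNIV :: 'n set). (lborel :: complex measure)) borel"
    by (subst borel_measurable_euclidean_space) (auto simp: Basis_vec_def inner_axis)
  show "integrable lborel h \<longleftrightarrow> integrable (\<Pi>\<^sub>M i\<in>UNIV. lborel) (\<lambda>f. h (\<chi> i. f i))"
    "integral\<^sup>L lborel h = (\<integral>f. h (\<chi> i. f i) \<partial>(\<Pi>\<^sub>M i\<in>UNIV. lborel))"
    by (subst lborel_vec, simp add: integrable_distr_eq integral_distr meas assms)+
qed

text \<open>Treats the plane as \<open>complex ^ 1\<close>, so that the change of variables on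
  complex vectors applies to functions of a single complex variable.\<close>

lemma integral_complex_1:
  fixes h :: "complex \<Rightarrow> complex"
  assumes h: "h \<in> borel_measurable borel"
  shows "integrable lborel (\<lambda>x :: complex ^ 1. h (x $ 1)) \<longleftrightarrow> integrable lborel h"
    and "(\<integral>x. h ((x :: complex ^ 1) $ 1) \<partial>lborel) = integral\<^sup>L lborel h"
proof -
  interpret product_sigma_finite "\<lambda>_ :: 1. lborel :: complex measure" ..
  have m: "(\<lambda>x :: complex ^ 1. h (x $ 1)) \<in> borel_measurable borel"
    by (rule measurable_compose[OF _ h]) (intro borel_measurable_continuous_onI bounded_linear.continuous_on[OF bounded_linear_vec_nth] continuous_on_id)
  have U: "(UNIV :: 1 set) = {1}" by (auto simp: num1_eq1)
  have d: "distr (\<Pi>\<^sub>M i\<in>{1 :: 1}. lborel) lborel (\<lambda>f. f 1) = (lborel :: complex measure)" by (rule distr_singleton)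
  show "integrable lborel (\<lambda>x :: complex ^ 1. h (x $ 1)) \<longleftrightarrow> integrable lborel h"
    unfolding integral_vec(1)[OF m] U by (subst (2) d[symmetric], subst integrable_distr_eq) (auto simp: h)
  show "(\<integral>x. h ((x :: complex ^ 1) $ 1) \<partial>lborel) = integral\<^sup>L lborel h"
    unfolding integral_vec(2)[OF m] U by (subst (2) d[symmetric], subst integral_distr) (auto simp: h)
qed

lemma integral_rotation:
  fixes h :: "complex \<Rightarrow> complex"
  assumes h: "h \<in> borel_measurable borel" and int: "integrable lborel h" and c: "norm c = 1"
  shows "(\<integral>z. h (c * z) \<partial>lborel) = integral\<^sup>L lborel h"
proof -
  define A :: "complex ^ 1 ^ 1" where "A = mat c"
  define g :: "complex ^ 1 \<Rightarrow> complex ^ 1" where "g x = A *v x" for x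
  have g: "g x = c *s x" for x by (simp add: g_def A_def vec_eq_iff matrix_vector_mult_def mat_def num1_eq1)
  have "c \<noteq> 0" using c by auto
  have inj: "inj_on g UNIV" using \<open>c \<noteq> 0\<close> by (auto simp: inj_on_def g vec_eq_iff)
  have "x = g (inverse c *s x)" for x using \<open>c \<noteq> 0\<close> by (simp add: g vec_eq_iff)
  then have img: "range g = UNIV" by blast
  have der: "(g has_derivative (*v) A) (at x)" for x
    unfolding g_def[abs_def] by (rule bounded_linear_imp_has_derivative[OF bounded_linear_complex_matrix])
  have mh: "(\<lambda>x :: complex ^ 1. h (x $ 1)) \<in> borel_measurable borel"
    by (rule measurable_compose[OF _ h]) (intro borel_measurable_continuous_onI bounded_linear.continuous_on[OF bounded_linear_vec_nth] continuous_on_id)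
  have mc: "(\<lambda>z. h (c * z)) \<in> borel_measurable borel"
    by (rule measurable_compose[OF _ h]) auto
  have mhc: "(\<lambda>x :: complex ^ 1. h (c * x $ 1)) \<in> borel_measurable borel"
    by (rule measurable_compose[OF _ mc]) (intro borel_measurable_continuous_onI bounded_linear.continuous_on[OF bounded_linear_vec_nth] continuous_on_id)
  have det: "norm (det A) = 1" using c by (simp add: A_def mat_def det_diagonal)
  have "(\<integral>x. indicator UNIV x * ((norm (det A))\<^sup>2 * h (g x $ 1)) \<partial>lborel) = (\<integral>x. indicator (range g) x * h (x $ 1) \<partial>lborel)"
  proof (rule change_of_variables_complex[OF open_UNIV inj der])
    show "(\<lambda>x. indicator (range g) x * h (x $ 1)) \<in> borel_measurable borel" unfolding img using mh by simp
    show "(\<lambda>x. indicator UNIV x * ((norm (det A))\<^sup>2 * h (g x $ 1))) \<in> borel_measurable borel"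
      unfolding det using mhc by (simp add: g)
    show "integrable lborel (\<lambda>x. indicator (range g) x * h (x $ 1))"
      unfolding img using int by (simp add: integral_complex_1(1)[OF h])
  qed
  then have "(\<integral>x. h (c * (x :: complex ^ 1) $ 1) \<partial>lborel) = (\<integral>x. h ((x :: complex ^ 1) $ 1) \<partial>lborel)"
    unfolding img det by (simp add: g)
  then show ?thesis unfolding integral_complex_1(2)[OF h] integral_complex_1(2)[OF mc] .
qed

section \<open>Moments of monomials on a disc\<close>

lemma integrable_on_ball:
  fixes h :: "complex \<Rightarrow> complex"
  assumes "(\<lambda>z. indicator (ball 0 r) z * h z) \<in> borel_measurable borel" "\<And>z. z \<in> ball 0 r \<Longrightarrow> norm (h z) \<le> C"
  shows "integrable lborel (\<lambda>z. indicator (ball 0 r) z * h z)"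
proof (rule Bochner_Integration.integrable_bound)
  show "integrable lborel (\<lambda>z :: complex. indicat_real (ball 0 r) z * C)"
    using emeasure_bounded_finite[OF bounded_ball, of "0 :: complex" r]
    by (intro integrable_mult_left integrable_real_indicator) auto
  show "AE z in lborel. norm (indicator (ball 0 r) z * h z) \<le> norm (indicat_real (ball 0 r) z * C)"
    using assms(2) by (intro AE_I2) (force simp: indicator_def)
qed (use assms(1) in simp)

text \<open>The rotation by the angle \<open>pi / (real k - real l)\<close> multiplies the integrand
  by \<open>-1\<close> and preserves the integral.\<close>

lemma integral_ball_power_diff:
  assumes "k \<noteq> l"
  shows "(\<integral>z. indicator (ball 0 r) z * (z ^ k * cnj z ^ l) \<partial>lborel) = 0"
proof -
  define h where "h z = indicator (ball 0 r) z * (z ^ k * cnj z ^ l)" for z :: complex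
  have m: "h \<in> borel_measurable borel"
    unfolding h_def by (intro borel_measurable_times borel_measurable_indicator borel_measurable_continuous_onI continuous_intros) auto
  have int: "integrable lborel h"
  proof (cases "r > 0")
    case True
    show ?thesis unfolding h_def
    proof (rule integrable_on_ball)
      fix z :: complex assume "z \<in> ball 0 r"
      then have "norm z ^ k * norm z ^ l \<le> r ^ k * r ^ l" using True by (intro mult_mono power_mono) auto
      then show "norm (z ^ k * cnj z ^ l) \<le> r ^ k * r ^ l" by (simp add: norm_mult norm_power)
    qed (use m in \<open>simp add: h_def[abs_def]\<close>)
  next
    case False
    then have E: "ball (0 :: complex) r = {}" by simp
    have "indicator (ball 0 r) z = (0 :: complex)" for z :: complex unfolding E by simp
    then have "h = (\<lambda>_. 0)" by (simp only: h_def fun_eq_iff) simp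
    then show ?thesis by simp
  qed
  define \<theta> where "\<theta> = pi / (real k - real l)"
  have "cis \<theta> ^ k * cnj (cis \<theta>) ^ l = cis (real k * \<theta> - real l * \<theta>)"
    by (simp add: cis_cnj Complex.DeMoivre cis_mult)
  also have "real k * \<theta> - real l * \<theta> = (real k - real l) * \<theta>" by (simp add: left_diff_distrib)
  also have "\<dots> = pi" using assms by (simp add: \<theta>_def)
  finally have c: "cis \<theta> ^ k * cnj (cis \<theta>) ^ l = -1" by (simp add: cis_conv_exp)
  have "h (cis \<theta> * z) = - h z" for z
  proof -
    have "h (cis \<theta> * z) = (cis \<theta> ^ k * cnj (cis \<theta>) ^ l) * h z"
      by (simp add: h_def indicator_def norm_mult power_mult_distrib)
    then show ?thesis by (simp add: c)
  qed
  then have "- integral\<^sup>L lborel h = integral\<^sup>L lborel h"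
    using integral_rotation[OF m int, of "cis \<theta>"] by simp
  then show ?thesis by (simp add: h_def[abs_def])
qed

text \<open>Polar coordinates are replaced by a distribution: on the disc, the image of area under
  the squared modulus is \<open>pi\<close> times length on the interval from \<open>0\<close> to
  \<open>r\<^sup>2\<close>. The moment is then the integral of \<open>x ^ k\<close> over that
  interval.\<close>

lemma integral_ball_power_same:
  assumes r: "r > 0"
  shows "(\<integral>z. indicator (ball 0 r) z * (z ^ k * cnj z ^ k) \<partial>lborel) = of_real (pi * r ^ (2 * k + 2) / real (k + 1))"
proof -
  define M where "M = distr (density lborel (\<lambda>z. ennreal (indicator (ball 0 r) z))) borel (\<lambda>z :: complex. (norm z)\<^sup>2)"
  define N where "N = density lborel (\<lambda>x :: real. ennreal (pi * indicator {0..r\<^sup>2} x))"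
  have area: "emeasure lborel (ball (0 :: complex) s) = ennreal (pi * s\<^sup>2)" "emeasure lborel (cball (0 :: complex) s) = ennreal (pi * s\<^sup>2)" if "s \<ge> 0" for s
    using that by (simp_all add: emeasure_ball emeasure_cball unit_ball_vol_2)
  \<comment> \<open>For \<open>a\<close> between \<open>0\<close> and \<open>r\<^sup>2\<close> the
    preimage of the half-line is an annulus, a difference of two discs. The two maxima account for
    negative \<open>a\<close> and for \<open>a\<close> beyond \<open>r\<^sup>2\<close>. Finite
    measures agreeing on these half-lines are equal.\<close>
  have emM: "emeasure M {a<..} = emeasure N {a<..}" for a
  proof -
    have "emeasure M {a<..} = emeasure lborel ({z :: complex. a < (norm z)\<^sup>2} \<inter> ball 0 r)"
    proof -
      have "emeasure M {a<..} = emeasure (density lborel (\<lambda>z. ennreal (indicator (ball 0 r) z))) {z :: complex. a < (norm z)\<^sup>2}"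
        unfolding M_def by (subst emeasure_distr) (auto simp: vimage_def)
      also have "\<dots> = (\<integral>\<^sup>+z. ennreal (indicator (ball 0 r) z) * indicator {z :: complex. a < (norm z)\<^sup>2} z \<partial>lborel)"
        by (subst emeasure_density) (auto intro!: borel_measurable_indicator)
      also have "\<dots> = (\<integral>\<^sup>+z. indicator ({z :: complex. a < (norm z)\<^sup>2} \<inter> ball 0 r) z \<partial>lborel)"
        by (intro nn_integral_cong) (auto simp: indicator_def)
      also have "\<dots> = emeasure lborel ({z :: complex. a < (norm z)\<^sup>2} \<inter> ball 0 r)"
        by (subst nn_integral_indicator) auto
      finally show ?thesis .
    qed
    also have "\<dots> = ennreal (pi * max 0 (r\<^sup>2 - max 0 a))"
    proof (cases "a < 0")
      case True
      then have "{z :: complex. a < (norm z)\<^sup>2} \<inter> ball 0 r = ball 0 r"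
        by (auto intro: less_le_trans)
      then show ?thesis using True r area(1)[of r] by simp
    next
      case False
      show ?thesis
      proof (cases "a < r\<^sup>2")
        case a: True
        have "{z :: complex. a < (norm z)\<^sup>2} \<inter> ball 0 r = ball 0 r - cball 0 (sqrt a)"
          using False by (auto simp: not_le real_less_rsqrt real_sqrt_less_iff) (metis norm_ge_zero not_less real_le_lsqrt real_sqrt_le_iff real_sqrt_unique sqrt_le_D)+
        moreover have "cball 0 (sqrt a) \<subseteq> ball (0 :: complex) r"
        proof -
          have "sqrt a < r" by (rule real_less_lsqrt) (use a r False in auto)
          then show ?thesis by (auto intro: le_less_trans)
        qed
        ultimately have "emeasure lborel ({z :: complex. a < (norm z)\<^sup>2} \<inter> ball 0 r) = emeasure lborel (ball (0 :: complex) r) - emeasure lborel (cball (0 :: complex) (sqrt a))"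
          using area(2)[of "sqrt a"] False by (simp only:, intro emeasure_Diff) auto
        also have "\<dots> = ennreal (pi * r\<^sup>2) - ennreal (pi * a)" using r False area by simp
        also have "\<dots> = ennreal (pi * r\<^sup>2 - pi * a)" using False by (simp add: ennreal_minus)
        finally show ?thesis using a False by (simp add: right_diff_distrib)
      next
        case a: False
        have "norm z < r \<Longrightarrow> (norm z)\<^sup>2 < r\<^sup>2" for z :: complex by (rule power_strict_mono) auto
        then have "{z :: complex. a < (norm z)\<^sup>2} \<inter> ball 0 r = {}" using a by force
        then show ?thesis using a False by (simp add: max_def)
      qed
    qed
    also have "\<dots> = emeasure N {a<..}"
    proof -
      have "emeasure N {a<..} = (\<integral>\<^sup>+x. ennreal pi * indicator ({0..r\<^sup>2} \<inter> {a<..}) x \<partial>lborel)"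
        unfolding N_def by (subst emeasure_density) (auto intro!: nn_integral_cong simp: indicator_def)
      also have "\<dots> = ennreal pi * emeasure lborel ({0..r\<^sup>2} \<inter> {a<..})" by (subst nn_integral_cmult_indicator) auto
      also have "emeasure lborel ({0..r\<^sup>2} \<inter> {a<..}) = ennreal (max 0 (r\<^sup>2 - max 0 a))"
      proof (cases "a < 0")
        case True
        then have "{0..r\<^sup>2} \<inter> {a<..} = {0..r\<^sup>2}" by auto
        then show ?thesis using True by simp
      next
        case False
        then have "{0..r\<^sup>2} \<inter> {a<..} = {a<..r\<^sup>2}" by auto
        then show ?thesis using False by (cases "a \<le> r\<^sup>2") (simp_all add: max_def)
      qed
      finally show ?thesis by (simp add: ennreal_mult)
    qed
    finally show ?thesis .
  qed
  have finN: "emeasure N {a<..} < \<infinity>" for a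
  proof -
    have "emeasure N {a<..} \<le> emeasure N UNIV" by (rule emeasure_mono) (auto simp: N_def)
    also have "\<dots> = (\<integral>\<^sup>+x. ennreal pi * indicator {0..r\<^sup>2} x \<partial>lborel)"
      unfolding N_def by (subst emeasure_density) (auto intro!: nn_integral_cong simp: indicator_def)
    also have "\<dots> < \<infinity>" by (subst nn_integral_cmult_indicator) (auto simp: ennreal_mult_less_top)
    finally show ?thesis .
  qed
  have MN: "M = N"
    by (rule measure_eqI_lessThan) (use emM finN in \<open>auto simp: M_def N_def\<close>)
  have rr: "(r\<^sup>2) ^ (k + 1) = r ^ (2 * k + 2)"
  proof -
    have "2 * k + 2 = 2 * (k + 1)" by simp
    then show ?thesis by (simp only: power_mult)
  qed
  have "(\<integral>z. indicator (ball 0 r) z * (norm z) ^ (2 * k) \<partial>(lborel :: complex measure)) = (\<integral>x. x ^ k \<partial>M)"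
    unfolding M_def by (subst integral_distr, simp, simp, subst integral_density) (auto intro!: borel_measurable_indicator simp: power_mult)
  also have "\<dots> = (\<integral>x. pi * indicator {0..r\<^sup>2} x * x ^ k \<partial>lborel)"
    unfolding MN N_def by (subst integral_density) auto
  also have "\<dots> = pi * (\<integral>x. indicator {0..r\<^sup>2} x *\<^sub>R x ^ k \<partial>lborel)"
    by (simp add: mult.assoc)
  also have "(\<integral>x. indicator {0..r\<^sup>2} x *\<^sub>R x ^ k \<partial>lborel) = (r\<^sup>2) ^ (k + 1) / real (k + 1) - 0 ^ (k + 1) / real (k + 1)"
  proof (rule integral_FTC_Icc[of 0 "r\<^sup>2" "\<lambda>x. x ^ (k + 1) / real (k + 1)"])
    fix x :: real
    have "((\<lambda>x. x ^ (k + 1) / real (k + 1)) has_real_derivative x ^ k) (at x within {0..r\<^sup>2})"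
      by (rule DERIV_cong[OF DERIV_cdivide[OF DERIV_pow]]) simp
    then show "((\<lambda>x. x ^ (k + 1) / real (k + 1)) has_vector_derivative x ^ k) (at x within {0..r\<^sup>2})"
      by (simp only: has_real_derivative_iff_has_vector_derivative)
  qed (auto intro!: continuous_intros)
  finally have *: "(\<integral>z. indicator (ball 0 r) z * (norm z) ^ (2 * k) \<partial>(lborel :: complex measure)) = pi * r ^ (2 * k + 2) / real (k + 1)"
    unfolding rr by (simp only: diff_zero zero_power2 power_zero_numeral times_divide_eq_right) simp
  have "z ^ k * cnj z ^ k = complex_of_real (norm z ^ (2 * k))" for z
    by (simp add: power_mult power_mult_distrib[symmetric] complex_norm_square[symmetric] del: of_real_power) (simp add: of_real_power)
  then have "indicator (ball 0 r) z * (z ^ k * cnj z ^ k) = complex_of_real (indicator (ball 0 r) z * norm z ^ (2 * k))" for z :: complex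
    by (simp add: indicator_def)
  then show ?thesis by (simp only: integral_complex_of_real *)
qed

text \<open>The Bergman kernel of the disc of radius \<open>r\<close> at \<open>(\<mu>, z)\<close>,
  that is the conjugate of its value at \<open>(z, \<mu>)\<close>, cut off outside the disc. The
  radius is kept as a parameter because functions on the unit disc are first integrated over smaller
  discs, where they are bounded.\<close>

definition disc_kernel :: "real \<Rightarrow> complex \<Rightarrow> complex \<Rightarrow> complex" where
  "disc_kernel r \<mu> z = indicator (ball 0 r) z * (of_real (r\<^sup>2) / (of_real pi * (of_real (r\<^sup>2) - \<mu> * cnj z)\<^sup>2))"

section \<open>Integrating Taylor series against the disc kernel\<close>

lemma sums_Suc_mult_power:
  fixes q :: complex
  assumes "norm q < 1"
  shows "(\<lambda>l. of_nat (Suc l) * q ^ l) sums (1 / (1 - q)\<^sup>2)" "summable (\<lambda>l. real (Suc l) * norm q ^ l)"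
proof -
  show "(\<lambda>l. of_nat (Suc l) * q ^ l) sums (1 / (1 - q)\<^sup>2)" using geometric_deriv_sums[OF assms] .
  have "norm (norm q) < 1" using assms by simp
  from geometric_deriv_sums[OF this] show "summable (\<lambda>l. real (Suc l) * norm q ^ l)"
    by (simp add: sums_iff)
qed

lemma borel_measurable_indicator_ball_mult:
  fixes h :: "complex \<Rightarrow> complex"
  assumes "continuous_on (ball 0 r) h"
  shows "(\<lambda>z. indicator (ball 0 r) z * h z) \<in> borel_measurable borel"
proof -
  have "(\<lambda>z. indicator (ball 0 r) z * h z) = (\<lambda>z. indicat_real (ball 0 r) z *\<^sub>R h z)"
    by (rule ext) (simp add: indicator_def)
  then show ?thesis using borel_measurable_continuous_on_indicator[OF _ assms] by simp
qed

text \<open>By orthogonality of monomials only the Taylor coefficient of index \<open>l\<close>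
  contributes. Holomorphy on a larger disc makes the Taylor series converge absolutely at radius
  \<open>r\<close>, which dominates all partial sums on the disc of integration.\<close>

lemma integral_ball_cnj_power:
  assumes h: "h holomorphic_on ball 0 R" and r: "0 < r" "r < R"
  shows "(\<integral>z. indicator (ball 0 r) z * (h z * cnj z ^ l) \<partial>lborel) =
    ((deriv ^^ l) h 0 / fact l) * of_real (pi * r ^ (2 * l + 2) / real (l + 1))"
proof -
  define a where "a k = (deriv ^^ k) h 0 / fact k" for k
  have ps: "(\<lambda>k. a k * z ^ k) sums h z" if "z \<in> ball 0 R" for z
    using holomorphic_power_series[OF h that] by (simp add: a_def)
  define \<rho> where "\<rho> = (r + R) / 2"
  have \<rho>: "r < \<rho>" "\<rho> < R" "0 < \<rho>" using r by (auto simp: \<rho>_def)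
  have "summable (\<lambda>k. a k * of_real \<rho> ^ k)" using ps[of "of_real \<rho>"] \<rho> by (auto simp: sums_iff)
  then have sa: "summable (\<lambda>k. norm (a k * of_real r ^ k))"
    by (rule powser_insidea) (use r \<rho> in auto)
  define C where "C = (\<Sum>k. norm (a k * of_real r ^ k))"
  define s where "s N z = indicator (ball 0 r) z * ((\<Sum>k<N. a k * z ^ k) * cnj z ^ l)" for N z
  have bound: "norm (\<Sum>k<N. a k * z ^ k) \<le> C" if "z \<in> ball 0 r" for N z
  proof -
    have "norm (\<Sum>k<N. a k * z ^ k) \<le> (\<Sum>k<N. norm (a k * of_real r ^ k))"
      using that r by (intro sum_norm_le) (auto simp: norm_mult norm_power intro!: mult_left_mono power_mono)
    also have "\<dots> \<le> C" unfolding C_def by (rule sum_le_suminf[OF sa]) auto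
    finally show ?thesis .
  qed
  have C0: "C \<ge> 0" unfolding C_def by (rule suminf_nonneg[OF sa]) auto
  have ms: "s N \<in> borel_measurable borel" for N
    unfolding s_def by (rule borel_measurable_indicator_ball_mult) (intro continuous_intros)
  have hcont: "continuous_on (ball 0 r) h"
    using holomorphic_on_imp_continuous_on[OF h] by (rule continuous_on_subset) (use r in auto)
  have lim: "(\<lambda>N. integral\<^sup>L lborel (s N)) \<longlonglongrightarrow> (\<integral>z. indicator (ball 0 r) z * (h z * cnj z ^ l) \<partial>lborel)"
  proof (rule integral_dominated_convergence[where w = "\<lambda>z. indicat_real (ball 0 r) z * (C * r ^ l)"])
    show "(\<lambda>z. indicator (ball 0 r) z * (h z * cnj z ^ l)) \<in> borel_measurable lborel"
      using borel_measurable_indicator_ball_mult[of r "\<lambda>z. h z * cnj z ^ l"] by (simp add: continuous_intros hcont)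
    show "s N \<in> borel_measurable lborel" for N using ms by simp
    show "integrable lborel (\<lambda>z :: complex. indicat_real (ball 0 r) z * (C * r ^ l))"
      using emeasure_bounded_finite[OF bounded_ball, of "0 :: complex" r]
      by (intro integrable_mult_left integrable_real_indicator) auto
    show "AE z in lborel. (\<lambda>N. s N z) \<longlonglongrightarrow> indicator (ball 0 r) z * (h z * cnj z ^ l)"
    proof (intro AE_I2)
      fix z :: complex
      show "(\<lambda>N. s N z) \<longlonglongrightarrow> indicator (ball 0 r) z * (h z * cnj z ^ l)"
      proof (cases "z \<in> ball 0 r")
        case True
        then have "(\<lambda>N. \<Sum>k<N. a k * z ^ k) \<longlonglongrightarrow> h z" using ps[of z] r by (simp add: sums_def)
        then show ?thesis unfolding s_def by (intro tendsto_intros)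
      qed (simp add: s_def)
    qed
    show "AE z in lborel. norm (s N z) \<le> indicat_real (ball 0 r) z * (C * r ^ l)" for N
    proof (intro AE_I2)
      fix z :: complex
      show "norm (s N z) \<le> indicat_real (ball 0 r) z * (C * r ^ l)"
      proof (cases "z \<in> ball 0 r")
        case True
        then have "norm (\<Sum>k<N. a k * z ^ k) * norm z ^ l \<le> C * r ^ l"
          using bound[OF True, of N] C0 by (intro mult_mono power_mono) auto
        then show ?thesis using True by (simp add: s_def norm_mult norm_power)
      qed (simp add: s_def)
    qed
  qed
  have imom: "integrable lborel (\<lambda>z. indicator (ball 0 r) z * (z ^ k * cnj z ^ l))" for k
  proof (rule integrable_on_ball)
    show "(\<lambda>z. indicator (ball 0 r) z * (z ^ k * cnj z ^ l)) \<in> borel_measurable borel"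
      by (rule borel_measurable_indicator_ball_mult) (intro continuous_intros)
    fix z :: complex assume "z \<in> ball 0 r"
    then have "norm z ^ k * norm z ^ l \<le> r ^ k * r ^ l" using r by (intro mult_mono power_mono) auto
    then show "norm (z ^ k * cnj z ^ l) \<le> r ^ k * r ^ l" by (simp add: norm_mult norm_power)
  qed
  \<comment> \<open>As soon as the partial sum contains the term of index \<open>l\<close>, its
    integral no longer changes.\<close>
  have val: "integral\<^sup>L lborel (s N) = a l * of_real (pi * r ^ (2 * l + 2) / real (l + 1))" if "N > l" for N
  proof -
    have "s N = (\<lambda>z. \<Sum>k<N. a k * (indicator (ball 0 r) z * (z ^ k * cnj z ^ l)))"
      by (simp add: s_def fun_eq_iff sum_distrib_left sum_distrib_right mult_ac)
    then have "integral\<^sup>L lborel (s N) = (\<Sum>k<N. a k * (\<integral>z. indicator (ball 0 r) z * (z ^ k * cnj z ^ l) \<partial>lborel))"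
      using imom by (simp add: Bochner_Integration.integral_sum)
    also have "\<dots> = (\<Sum>k<N. if k = l then a l * of_real (pi * r ^ (2 * l + 2) / real (l + 1)) else 0)"
    proof (intro sum.cong refl)
      fix k
      show "a k * (\<integral>z. indicator (ball 0 r) z * (z ^ k * cnj z ^ l) \<partial>lborel) = (if k = l then a l * of_real (pi * r ^ (2 * l + 2) / real (l + 1)) else 0)"
        using integral_ball_power_same[OF r(1), of l] integral_ball_power_diff[of k l r] by (cases "k = l") (simp_all only: if_True if_False mult_zero_right simp_thms)
    qed
    also have "\<dots> = a l * of_real (pi * r ^ (2 * l + 2) / real (l + 1))" using that by simp
    finally show ?thesis .
  qed
  have "(\<lambda>N. integral\<^sup>L lborel (s N)) \<longlonglongrightarrow> a l * of_real (pi * r ^ (2 * l + 2) / real (l + 1))"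
    by (rule tendsto_eventually) (use val in \<open>auto simp: eventually_at_top_dense\<close>)
  with lim show ?thesis unfolding a_def by (rule LIMSEQ_unique)
qed

text \<open>The kernel is expanded as a series in \<open>\<mu> * cnj z\<close>, by differentiating
  the geometric series; the weight \<open>Suc l\<close> cancels the denominator of the moment of
  index \<open>l\<close>, and the Taylor series of \<open>h\<close> at \<mu> remains. On the disc
  the ratio of the series is at most \<open>norm \<mu> / r < 1\<close>, which gives the dominating
  function.\<close>

lemma disc_reproducing:
  assumes h: "h holomorphic_on ball 0 R" and r: "0 < r" "r < R" and \<mu>: "norm \<mu> < r"
  shows "(\<integral>z. h z * disc_kernel r \<mu> z \<partial>lborel) = h \<mu>"
proof -
  define a where "a k = (deriv ^^ k) h 0 / fact k" for k
  have ps: "(\<lambda>k. a k * z ^ k) sums h z" if "z \<in> ball 0 R" for z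
    using holomorphic_power_series[OF h that] by (simp add: a_def)
  have hcont: "continuous_on (ball 0 r) h"
    using holomorphic_on_imp_continuous_on[OF h] by (rule continuous_on_subset) (use r in auto)
  have "continuous_on (cball 0 r) h"
    using holomorphic_on_imp_continuous_on[OF h] by (rule continuous_on_subset) (use r in auto)
  then have "bounded (h ` cball 0 r)" by (intro compact_imp_bounded compact_continuous_image) auto
  then obtain M where M: "\<And>z. z \<in> cball 0 r \<Longrightarrow> norm (h z) \<le> M" unfolding bounded_iff by blast
  then have M0: "M \<ge> 0" using norm_ge_zero[of "h 0"] r by (meson centre_in_cball less_imp_le order_trans)
  define t where "t N z = indicator (ball 0 r) z * (h z * ((\<Sum>l<N. of_nat (Suc l) * (\<mu> * cnj z / of_real (r\<^sup>2)) ^ l) / of_real (pi * r\<^sup>2)))" for N z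
  define q where "q = norm \<mu> / r"
  have q: "q < 1" "q \<ge> 0" using \<mu> r by (auto simp: q_def)
  define S where "S = (\<Sum>l. real (Suc l) * q ^ l)"
  have sq: "summable (\<lambda>l. real (Suc l) * q ^ l)"
    using sums_Suc_mult_power(2)[of "of_real q"] q by simp
  have S0: "S \<ge> 0" unfolding S_def by (rule suminf_nonneg[OF sq]) (use q in auto)
  have nz: "norm (\<mu> * cnj z / of_real (r\<^sup>2)) \<le> q" if "z \<in> ball 0 r" for z
  proof -
    have "norm \<mu> * norm z \<le> norm \<mu> * r" by (rule mult_left_mono) (use that in auto)
    then show ?thesis using r by (simp add: norm_mult norm_divide norm_power q_def field_simps power2_eq_square)
  qed
  have bound: "norm (\<Sum>l<N. of_nat (Suc l) * (\<mu> * cnj z / of_real (r\<^sup>2)) ^ l) \<le> S" if "z \<in> ball 0 r" for N z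
  proof -
    have "norm (\<Sum>l<N. of_nat (Suc l) * (\<mu> * cnj z / of_real (r\<^sup>2)) ^ l) \<le> (\<Sum>l<N. real (Suc l) * q ^ l)"
      by (intro sum_norm_le) (use nz[OF that] in \<open>auto simp only: norm_mult norm_power norm_of_nat intro!: mult_left_mono power_mono\<close>, auto)
    also have "\<dots> \<le> S" unfolding S_def by (rule sum_le_suminf[OF sq]) (use q in auto)
    finally show ?thesis .
  qed
  have mt: "t N \<in> borel_measurable borel" for N
    unfolding t_def using r by (intro borel_measurable_indicator_ball_mult continuous_intros hcont) auto
  have dk: "h z * disc_kernel r \<mu> z = indicator (ball 0 r) z * (h z * (1 / (1 - \<mu> * cnj z / of_real (r\<^sup>2))\<^sup>2 / of_real (pi * r\<^sup>2)))" for z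
  proof -
    define c where "c = complex_of_real (r\<^sup>2)"
    have c: "c \<noteq> 0" using r by (simp add: c_def)
    have "c / (of_real pi * (c - w)\<^sup>2) = 1 / (1 - w / c)\<^sup>2 / (of_real pi * c)" for w
    proof -
      have "c - w = c * (1 - w / c)" using c by (simp add: right_diff_distrib)
      then have "(c - w)\<^sup>2 = c * c * (1 - w / c)\<^sup>2" by (simp add: power_mult_distrib power2_eq_square)
      moreover have "c / (p * (c * c * u)) = 1 / u / (p * c)" for p u
        using c by (cases "u = 0"; cases "p = 0"; simp add: field_simps)
      ultimately show ?thesis by simp
    qed
    then show ?thesis by (simp only: disc_kernel_def c_def of_real_mult mult.left_commute)
  qed
  have lim: "(\<lambda>N. integral\<^sup>L lborel (t N)) \<longlonglongrightarrow> (\<integral>z. h z * disc_kernel r \<mu> z \<partial>lborel)"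
  proof (rule integral_dominated_convergence[where w = "\<lambda>z. indicat_real (ball 0 r) z * (M * (S / (pi * r\<^sup>2)))"])
    have pt: "(\<lambda>N. t N z) \<longlonglongrightarrow> h z * disc_kernel r \<mu> z" for z
    proof (cases "z \<in> ball 0 r")
      case True
      then have "norm (\<mu> * cnj z / of_real (r\<^sup>2)) < 1" using nz[OF True] q by linarith
      from sums_Suc_mult_power(1)[OF this]
      have "(\<lambda>N. \<Sum>l<N. of_nat (Suc l) * (\<mu> * cnj z / of_real (r\<^sup>2)) ^ l) \<longlonglongrightarrow> 1 / (1 - \<mu> * cnj z / of_real (r\<^sup>2))\<^sup>2"
        by (simp only: sums_def)
      then show ?thesis unfolding t_def dk by (intro tendsto_mult tendsto_divide tendsto_const) (use r in auto)
    qed (simp add: t_def dk)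
    then show "AE z in lborel. (\<lambda>N. t N z) \<longlonglongrightarrow> h z * disc_kernel r \<mu> z" by simp
    show "t N \<in> borel_measurable lborel" for N using mt by simp
    show "(\<lambda>z. h z * disc_kernel r \<mu> z) \<in> borel_measurable lborel"
      using borel_measurable_LIMSEQ_metric[of t borel "\<lambda>z. h z * disc_kernel r \<mu> z"] mt pt by simp
    show "integrable lborel (\<lambda>z :: complex. indicat_real (ball 0 r) z * (M * (S / (pi * r\<^sup>2))))"
      using emeasure_bounded_finite[OF bounded_ball, of "0 :: complex" r]
      by (intro integrable_mult_left integrable_real_indicator) auto
    show "AE z in lborel. norm (t N z) \<le> indicat_real (ball 0 r) z * (M * (S / (pi * r\<^sup>2)))" for N
    proof (intro AE_I2)
      fix z :: complex
      show "norm (t N z) \<le> indicat_real (ball 0 r) z * (M * (S / (pi * r\<^sup>2)))"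
      proof (cases "z \<in> ball 0 r")
        case True
        have "norm (of_real (pi * r\<^sup>2) :: complex) = pi * r\<^sup>2" using r by (simp only: norm_of_real) simp
        then have "norm (t N z) = norm (h z) * (norm (\<Sum>l<N. of_nat (Suc l) * (\<mu> * cnj z / of_real (r\<^sup>2)) ^ l) / (pi * r\<^sup>2))"
          using True by (simp only: t_def norm_mult norm_divide indicator_simps norm_one mult_1_left)
        also have "\<dots> \<le> M * (S / (pi * r\<^sup>2))"
          using True r by (intro mult_mono divide_right_mono bound M) (auto simp: M0)
        finally show ?thesis using True by simp
      qed (simp add: t_def)
    qed
  qed
  have mom: "(\<integral>z. indicator (ball 0 r) z * (h z * cnj z ^ l) \<partial>lborel) = a l * of_real (pi * r ^ (2 * l + 2) / real (l + 1))" for l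
    using integral_ball_cnj_power[OF h r] by (simp only: a_def)
  have imom: "integrable lborel (\<lambda>z. indicator (ball 0 r) z * (h z * cnj z ^ l))" for l
  proof (rule integrable_on_ball)
    show "(\<lambda>z. indicator (ball 0 r) z * (h z * cnj z ^ l)) \<in> borel_measurable borel"
      by (intro borel_measurable_indicator_ball_mult continuous_intros hcont)
    fix z :: complex assume "z \<in> ball 0 r"
    then have "norm (h z) * norm z ^ l \<le> M * r ^ l" using M0 by (intro mult_mono power_mono M) auto
    then show "norm (h z * cnj z ^ l) \<le> M * r ^ l" by (simp add: norm_mult norm_power)
  qed
  have val: "integral\<^sup>L lborel (t N) = (\<Sum>l<N. a l * \<mu> ^ l)" for N
  proof -
    define c where "c l = of_nat (Suc l) * \<mu> ^ l / (of_real (r\<^sup>2) ^ l * of_real (pi * r\<^sup>2))" for l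
    have "t N = (\<lambda>z. \<Sum>l<N. c l * (indicator (ball 0 r) z * (h z * cnj z ^ l)))"
      unfolding t_def c_def sum_distrib_left sum_divide_distrib
      by (intro ext sum.cong refl) (simp add: power_mult_distrib power_divide)
    then have "integral\<^sup>L lborel (t N) = (\<Sum>l<N. c l * (\<integral>z. indicator (ball 0 r) z * (h z * cnj z ^ l) \<partial>lborel))"
      using imom by (simp add: Bochner_Integration.integral_sum)
    also have "\<dots> = (\<Sum>l<N. a l * \<mu> ^ l)"
    proof (intro sum.cong refl)
      fix l
      have gen: "(n * m / X) * (b * (X / n)) = b * m" if "X \<noteq> 0" "n \<noteq> 0" for n m X b :: complex
        using that by (simp add: field_simps)
      have e: "complex_of_real (pi * r ^ (2 * l + 2) / real (l + 1)) = (of_real (r\<^sup>2) ^ l * of_real (pi * r\<^sup>2)) / of_nat (Suc l)"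
      proof -
        have "r ^ (2 * l + 2) = (r\<^sup>2) ^ l * r\<^sup>2" by (simp only: power_add power_mult)
        then show ?thesis by simp
      qed
      have n1: "of_real (r\<^sup>2) ^ l * of_real (pi * r\<^sup>2) \<noteq> (0 :: complex)" using r by simp
      have n2: "of_nat (Suc l) \<noteq> (0 :: complex)" by (simp only: of_nat_eq_0_iff)
      show "c l * (\<integral>z. indicator (ball 0 r) z * (h z * cnj z ^ l) \<partial>lborel) = a l * \<mu> ^ l"
        unfolding mom c_def e by (rule gen[OF n1 n2])
    qed
    finally show ?thesis .
  qed
  have "(\<lambda>N. integral\<^sup>L lborel (t N)) \<longlonglongrightarrow> h \<mu>"
    using ps[of \<mu>] \<mu> r by (simp add: val sums_def)
  with lim show ?thesis by (rule LIMSEQ_unique)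
qed

section \<open>The reproducing property on the polydisc\<close>

lemma borel_measurable_disc_kernel: "disc_kernel r \<mu> \<in> borel_measurable borel"
proof -
  have "(\<lambda>z. of_real (r\<^sup>2) / (of_real pi * (of_real (r\<^sup>2) - \<mu> * cnj z)\<^sup>2)) \<in> borel_measurable borel"
    by (intro borel_measurable_divide borel_measurable_continuous_onI continuous_intros)
  then show ?thesis unfolding disc_kernel_def[abs_def]
    by (intro borel_measurable_times borel_measurable_indicator) auto
qed

lemma norm_disc_kernel_le:
  assumes "0 < r" "r \<le> 1" "q < r" "norm \<mu> \<le> q"
  shows "norm (disc_kernel r \<mu> z) \<le> indicat_real (ball 0 r) z * (1 / (pi * (r - q)\<^sup>2))"
proof (cases "z \<in> ball 0 r")
  case True
  have "norm \<mu> * norm z \<le> q * r" using True assms by (intro mult_mono) (auto intro: order_trans[OF norm_ge_zero])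
  then have "r\<^sup>2 - q * r \<le> norm (complex_of_real (r\<^sup>2) - \<mu> * cnj z)"
    using norm_triangle_ineq2[of "complex_of_real (r\<^sup>2)" "\<mu> * cnj z"] assms by (simp add: norm_mult norm_power)
  then have "r * (r - q) \<le> norm (complex_of_real (r\<^sup>2) - \<mu> * cnj z)" by (simp add: algebra_simps power2_eq_square)
  then have "(r * (r - q))\<^sup>2 \<le> (norm (complex_of_real (r\<^sup>2) - \<mu> * cnj z))\<^sup>2" using assms by (intro power_mono) auto
  moreover have "0 < (r * (r - q))\<^sup>2" using assms by simp
  ultimately have "r\<^sup>2 / (pi * (norm (complex_of_real (r\<^sup>2) - \<mu> * cnj z))\<^sup>2) \<le> r\<^sup>2 / (pi * (r * (r - q))\<^sup>2)"
    by (intro divide_left_mono mult_left_mono mult_pos_pos) auto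
  also have "\<dots> = 1 / (pi * (r - q)\<^sup>2)" using assms by (simp add: power_mult_distrib)
  finally show ?thesis using True by (simp add: disc_kernel_def norm_divide norm_mult norm_power)
qed (simp add: disc_kernel_def)

lemma vec_merge_measurable:
  fixes \<mu> :: "complex ^ 'n::finite"
  shows "(\<lambda>f. \<chi> j. if j \<in> I then f j else \<mu> $ j) \<in> measurable (\<Pi>\<^sub>M i\<in>I. (lborel :: complex measure)) borel"
proof (subst borel_measurable_euclidean_space, intro ballI)
  fix b :: "complex ^ 'n" assume "b \<in> Basis"
  then obtain j c where b: "b = axis j c" by (auto simp: Basis_vec_def)
  have "(\<lambda>f. (if j \<in> I then f j else \<mu> $ j) \<bullet> c) \<in> borel_measurable (\<Pi>\<^sub>M i\<in>I. (lborel :: complex measure))"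
    by (cases "j \<in> I") auto
  then show "(\<lambda>f. (\<chi> j. if j \<in> I then f j else \<mu> $ j) \<bullet> b) \<in> borel_measurable (\<Pi>\<^sub>M i\<in>I. (lborel :: complex measure))"
    by (simp add: b inner_axis)
qed

text \<open>Induction on the set of coordinates that are integrated, the others being frozen at
  \<mu>; each step is the formula on a disc. Since \<open>r < 1\<close>, boundedness of
  \<open>F\<close> on the closed smaller polydisc and of the kernels makes the integrand integrable,
  so that Fubini applies.\<close>

lemma polydisc_reproducing_partial:
  fixes F :: "complex ^ 'n::finite \<Rightarrow> complex" and \<mu> :: "complex ^ 'n"
  assumes r: "0 < r" "r < 1" and \<mu>: "\<And>j. norm (\<mu> $ j) < r"
    and meas: "F \<in> borel_measurable borel"
    and bound: "\<And>x. (\<And>j. norm (x $ j) \<le> r) \<Longrightarrow> norm (F x) \<le> C"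
    and hol: "\<And>x i. (\<And>j. norm (x $ j) < 1) \<Longrightarrow> (\<lambda>y. F (\<chi> j. if j = i then y else x $ j)) holomorphic_on ball 0 1"
  shows "(\<integral>f. F (\<chi> j. if j \<in> I then f j else \<mu> $ j) * (\<Prod>i\<in>I. disc_kernel r (\<mu> $ i) (f i)) \<partial>(\<Pi>\<^sub>M i\<in>I. lborel)) = F \<mu>"
  using finite[of I]
proof (induction I rule: finite_induct)
  case empty
  have "(\<chi> j. \<mu> $ j) = \<mu>" by (simp add: vec_eq_iff)
  then show ?case by (simp add: PiM_empty lebesgue_integral_count_space_finite)
next
  case (insert i I)
  interpret product_sigma_finite "\<lambda>_ :: 'n. lborel :: complex measure" ..
  define P where "P J f = (\<Prod>i\<in>J. disc_kernel r (\<mu> $ i) (f i))" for J f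
  define X where "X J f = (\<chi> j. if j \<in> J then f j else \<mu> $ j)" for J and f :: "'n \<Rightarrow> complex"
  define q where "q = Max (range (\<lambda>j. norm (\<mu> $ j)))"
  have q: "norm (\<mu> $ j) \<le> q" "q < r" for j using \<mu> by (auto simp: q_def)
  have C0: "C \<ge> 0" using bound[of 0] r by (auto intro: order_trans[OF norm_ge_zero])
  let ?B = "1 / (pi * (r - q)\<^sup>2)"
  have mP: "P J \<in> borel_measurable (\<Pi>\<^sub>M i\<in>J. lborel)" for J
    unfolding P_def by (intro borel_measurable_prod measurable_compose[OF _ borel_measurable_disc_kernel])
       (simp add: measurable_component_singleton)
  have mX: "(\<lambda>f. F (X J f)) \<in> borel_measurable (\<Pi>\<^sub>M i\<in>J. lborel)" for J
    unfolding X_def by (rule measurable_compose[OF vec_merge_measurable meas])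
  let ?G = "\<lambda>f. F (X (insert i I) f) * P (insert i I) f"
  have int: "integrable (\<Pi>\<^sub>M i\<in>insert i I. lborel) ?G"
  proof (rule Bochner_Integration.integrable_bound)
    have ib: "integrable lborel (\<lambda>z :: complex. indicat_real (ball 0 r) z * ?B)"
      using emeasure_bounded_finite[OF bounded_ball, of "0 :: complex" r]
      by (intro integrable_mult_left integrable_real_indicator) auto
    have "finite (insert i I)" using insert.hyps by simp
    note pi = product_integrable_prod[OF this, of "\<lambda>_ z. indicat_real (ball 0 r) z * ?B", OF ib]
    show "integrable (\<Pi>\<^sub>M i\<in>insert i I. lborel) (\<lambda>f :: 'n \<Rightarrow> complex. C * (\<Prod>j\<in>insert i I. indicat_real (ball 0 r) (f j) * ?B))"
      by (rule Bochner_Integration.integrable_mult_right) (rule pi)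
    show "?G \<in> borel_measurable (\<Pi>\<^sub>M i\<in>insert i I. lborel)" by (intro borel_measurable_times mX mP)
    show "AE f in \<Pi>\<^sub>M i\<in>insert i I. lborel. norm (?G f) \<le> norm (C * (\<Prod>j\<in>insert i I. indicat_real (ball 0 r) (f j) * ?B))"
    proof (intro AE_I2)
      fix f
      show "norm (?G f) \<le> norm (C * (\<Prod>j\<in>insert i I. indicat_real (ball 0 r) (f j) * ?B))"
      proof (cases "\<forall>j\<in>insert i I. f j \<in> ball 0 r")
        case True
        have "norm (F (X (insert i I) f)) \<le> C"
        proof (rule bound)
          show "norm (X (insert i I) f $ j) \<le> r" for j
            using True \<mu>[of j] by (auto simp: X_def less_imp_le)
        qed
        moreover have "norm (P (insert i I) f) \<le> (\<Prod>j\<in>insert i I. indicat_real (ball 0 r) (f j) * ?B)"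
          unfolding P_def prod_norm[symmetric]
          by (rule prod_mono) (use norm_disc_kernel_le[OF r(1) _ q(2) q(1)] r in auto)
        ultimately have "norm (?G f) \<le> C * (\<Prod>j\<in>insert i I. indicat_real (ball 0 r) (f j) * ?B)"
          unfolding norm_mult by (rule mult_mono) (use C0 in auto)
        then show ?thesis by simp
      next
        case False
        then obtain j where j: "j \<in> insert i I" "f j \<notin> ball 0 r" by blast
        have "disc_kernel r (\<mu> $ j) (f j) = 0"
          unfolding disc_kernel_def using j(2) by (simp only: indicator_simps mult_zero_left simp_thms)
        then have "P (insert i I) f = 0"
          unfolding P_def using insert.hyps(1) j(1) by (intro prod_zero bexI[of _ j]) simp_all
        then show ?thesis by simp
      qed
    qed
  qed
  have "(\<integral>f. ?G f \<partial>(\<Pi>\<^sub>M i\<in>insert i I. lborel)) = (\<integral>f. (\<integral>y. ?G (f(i := y)) \<partial>lborel) \<partial>(\<Pi>\<^sub>M i\<in>I. lborel))"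
    by (rule product_integral_insert[OF insert.hyps int])
  also have "\<dots> = (\<integral>f. F (X I f) * P I f \<partial>(\<Pi>\<^sub>M i\<in>I. lborel))"
  proof (rule Bochner_Integration.integral_cong[OF refl])
    fix f
    have P': "P (insert i I) (f(i := y)) = disc_kernel r (\<mu> $ i) y * P I f" for y
    proof -
      have "(\<Prod>j\<in>I. disc_kernel r (\<mu> $ j) ((f(i := y)) j)) = P I f"
        unfolding P_def by (rule prod.cong) (use insert.hyps in auto)
      then show ?thesis using insert.hyps by (simp add: P_def)
    qed
    have X': "X (insert i I) (f(i := y)) = (\<chi> j. if j = i then y else X I f $ j)" for y
      using insert.hyps by (auto simp: X_def vec_eq_iff)
    show "(\<integral>y. ?G (f(i := y)) \<partial>lborel) = F (X I f) * P I f"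
    proof (cases "\<forall>j\<in>I. f j \<in> ball 0 r")
      case True
      have "norm (X I f $ j) < 1" for j
        using True \<mu>[of j] r by (auto simp: X_def intro: less_trans)
      then have h: "(\<lambda>y. F (\<chi> j. if j = i then y else X I f $ j)) holomorphic_on ball 0 1" by (rule hol)
      have "(\<integral>y. ?G (f(i := y)) \<partial>lborel) = (\<integral>y. (F (\<chi> j. if j = i then y else X I f $ j) * disc_kernel r (\<mu> $ i) y) * P I f \<partial>lborel)"
        by (simp only: P' X' mult.assoc)
      also have "\<dots> = (\<integral>y. F (\<chi> j. if j = i then y else X I f $ j) * disc_kernel r (\<mu> $ i) y \<partial>lborel) * P I f"
        by simp
      also have "\<dots> = F (\<chi> j. if j = i then \<mu> $ i else X I f $ j) * P I f"
        by (subst disc_reproducing[OF h r \<mu>]) simp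
      also have "(\<chi> j. if j = i then \<mu> $ i else X I f $ j) = X I f"
        using insert.hyps by (auto simp: X_def vec_eq_iff)
      finally show ?thesis .
    next
      case False
        then obtain j where j: "j \<in> I" "f j \<notin> ball 0 r" by blast
        have "disc_kernel r (\<mu> $ j) (f j) = 0"
          unfolding disc_kernel_def using j(2) by (simp only: indicator_simps mult_zero_left simp_thms)
        then have "P I f = 0"
          unfolding P_def using insert.hyps(1) j(1) by (intro prod_zero bexI[of _ j]) simp_all
      then show ?thesis by (simp add: P')
    qed
  qed
  also have "\<dots> = F \<mu>" using insert.IH by (simp add: P_def X_def)
  finally show ?case by (simp only: P_def X_def)
qed

section \<open>Holomorphic functions on the full polydisc\<close>

lemma several_holomorphic_slice:
  fixes F :: "complex ^ 'n \<Rightarrow> complex"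
  assumes F: "several_holomorphic_on F \<Omega>" and sub: "\<And>y. y \<in> S \<Longrightarrow> (\<chi> j. if j = i then y else x $ j) \<in> \<Omega>"
  shows "(\<lambda>y. F (\<chi> j. if j = i then y else x $ j)) holomorphic_on S"
proof -
  have "\<exists>d. ((\<lambda>y. F (\<chi> j. if j = i then y else x $ j)) has_field_derivative d) (at y)" if y: "y \<in> S" for y
  proof -
    obtain f' where f': "(F has_derivative f') (at (\<chi> j. if j = i then y else x $ j))" "\<And>c v. f' (c *s v) = c * f' v"
      using F sub[OF y] unfolding several_holomorphic_on_def by blast
    have "((\<lambda>y. \<chi> j. if j = i then y else x $ j) has_derivative (\<lambda>h. h *s axis i 1)) (at y)"
    proof (rule has_derivative_vecI)
      fix j
      show "((\<lambda>y. (\<chi> j. if j = i then y else x $ j) $ j) has_derivative (\<lambda>h. (h *s axis i 1) $ j)) (at y)"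
        by (cases "j = i") (auto simp: axis_def)
    qed
    from has_derivative_compose[OF this f'(1)] f'(2)
    have "((\<lambda>y. F (\<chi> j. if j = i then y else x $ j)) has_derivative (\<lambda>h. h * f' (axis i 1))) (at y)" by simp
    moreover have "(\<lambda>h. h * f' (axis i 1)) = (*) (f' (axis i 1))" by (rule ext) (rule mult.commute)
    ultimately show ?thesis unfolding has_field_derivative_def by metis
  qed
  then show ?thesis
    unfolding holomorphic_on_def field_differentiable_def by (blast intro: has_field_derivative_at_within)
qed

lemma several_holomorphic_continuous:
  "several_holomorphic_on F \<Omega> \<Longrightarrow> continuous_on \<Omega> F"
  unfolding several_holomorphic_on_def
  by (intro continuous_at_imp_continuous_on ballI) (blast intro: has_derivative_continuous)

lemma borel_measurable_indicator_mult:
  fixes F :: "'a::euclidean_space \<Rightarrow> complex"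
  assumes "open \<Omega>" "continuous_on \<Omega> F"
  shows "(\<lambda>x. indicator \<Omega> x * F x) \<in> borel_measurable borel"
proof -
  have "(\<lambda>x. indicator \<Omega> x * F x) = (\<lambda>x. indicat_real \<Omega> x *\<^sub>R F x)"
    by (rule ext) (simp add: indicator_def)
  then show ?thesis using borel_measurable_continuous_on_indicator[OF _ assms(2)] assms(1) by simp
qed

text \<open>\<open>F\<close> may be unbounded near the boundary, so the formula is taken on
  polydiscs of radius \<open>r m < 1\<close> and \<open>r m\<close> is sent to \<open>1\<close>. The
  kernels stay uniformly bounded, and a constant multiple of the integrable function
  \<open>norm (F0 x)\<close> dominates.\<close>

lemma polydisc_reproducing:
  fixes F :: "complex ^ 'n::finite \<Rightarrow> complex" and \<mu> :: "complex ^ 'n"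
  assumes F: "several_holomorphic_on F polydisc" and int: "integrable lborel (\<lambda>x. indicator polydisc x * F x)"
    and \<mu>: "\<mu> \<in> polydisc"
  shows "(\<integral>x. (indicator polydisc x * F x) * (\<Prod>i\<in>UNIV. disc_kernel 1 (\<mu> $ i) (x $ i)) \<partial>lborel) = F \<mu>"
proof -
  define F0 where "F0 x = indicator polydisc x * F x" for x
  have mF0: "F0 \<in> borel_measurable borel"
    unfolding F0_def[abs_def] by (rule borel_measurable_indicator_mult[OF open_polydisc several_holomorphic_continuous[OF F]])
  define q where "q = Max (range (\<lambda>j. norm (\<mu> $ j)))"
  have q1: "norm (\<mu> $ j) \<le> q" "q < 1" for j using \<mu> by (auto simp: q_def polydisc_def)
  have q0: "q \<ge> 0" using q1(1) order_trans[OF norm_ge_zero] by blast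
  \<comment> \<open>The radii start at the midpoint of \<open>q\<close> and \<open>1\<close> and
    tend to \<open>1\<close>; the gap to \<open>q\<close>, a bound for the moduli of the coordinates
    of \<mu>, never falls below \<open>(1 - q) / 2\<close>.\<close>
  define r where "r m = 1 - (1 - q) / 2 * inverse (real (Suc m))" for m
  have r: "(1 + q) / 2 \<le> r m" "r m < 1" for m
  proof -
    have e: "inverse (real (Suc m)) \<le> 1" "0 < inverse (real (Suc m))"
      by (auto intro!: inverse_le_1_iff[THEN iffD2] simp del: of_nat_Suc)
    obtain X where X: "(1 - q) / 2 * inverse (real (Suc m)) = X" by blast
    have "X \<le> (1 - q) / 2 * 1"
      unfolding X[symmetric] by (rule mult_left_mono[OF e(1)]) (use q1(2) in simp)
    moreover have "0 < X"
      unfolding X[symmetric] by (rule mult_pos_pos[OF _ e(2)]) (use q1(2) in simp)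
    ultimately show "(1 + q) / 2 \<le> r m" "r m < 1" unfolding r_def X by (simp_all add: field_simps)
  qed
  have qm: "q < (1 + q) / 2" "0 < (1 + q) / 2" using q1(2) q0 by simp_all
  have rq: "q < r m" "0 < r m" for m
    using less_le_trans[OF qm(1) r(1)[of m]] less_le_trans[OF qm(2) r(1)[of m]] by simp_all
  have rlim: "r \<longlonglongrightarrow> 1"
  proof -
    have "r \<longlonglongrightarrow> 1 - (1 - q) / 2 * 0" unfolding r_def by (intro tendsto_intros LIMSEQ_inverse_real_of_nat)
    then show ?thesis by simp
  qed
  define K where "K \<rho> x = (\<Prod>i\<in>UNIV. disc_kernel \<rho> (\<mu> $ i) (x $ i))" for \<rho> x
  have mK: "K \<rho> \<in> borel_measurable borel" for \<rho>
    unfolding K_def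
    by (intro borel_measurable_prod measurable_compose[OF _ borel_measurable_disc_kernel])
       (auto intro!: borel_measurable_continuous_onI bounded_linear.continuous_on[OF bounded_linear_vec_nth] continuous_intros)
  have val: "(\<integral>x. F0 x * K (r m) x \<partial>lborel) = F \<mu>" for m
  proof -
    let ?Q = "{x :: complex ^ 'n. \<forall>j. norm (x $ j) \<le> r m}"
    have sub: "?Q \<subseteq> polydisc" using r(2)[of m] by (auto simp: polydisc_def intro: le_less_trans)
    have "?Q = (\<Inter>j. (\<lambda>x. x $ j) -` cball 0 (r m))" by auto
    then have "closed ?Q"
      by (elim ssubst) (intro closed_INT ballI closed_vimage closed_cball bounded_linear.continuous_on[OF bounded_linear_vec_nth] continuous_on_id)
    then have "compact ?Q" using bounded_subset[OF bounded_polydisc sub] by (simp add: compact_eq_bounded_closed)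
    then have "compact (F ` ?Q)"
      by (rule compact_continuous_image[rotated]) (rule continuous_on_subset[OF several_holomorphic_continuous[OF F] sub])
    then have "bounded (F ` ?Q)" by (rule compact_imp_bounded)
    then obtain C where C: "\<forall>y\<in>F ` ?Q. norm y \<le> C" unfolding bounded_iff by (rule exE)
    have bound: "norm (F0 x) \<le> C" if "\<And>j. norm (x $ j) \<le> r m" for x
    proof -
      have Q: "x \<in> ?Q" using that by simp
      then have "norm (F x) \<le> C" using C by blast
      moreover have "x \<in> polydisc" using Q sub by blast
      ultimately show ?thesis by (simp add: F0_def)
    qed
    have hol: "(\<lambda>y. F0 (\<chi> j. if j = i then y else x $ j)) holomorphic_on ball 0 1" if x: "\<And>j. norm (x $ j) < 1" for x i
    proof -
      have pd: "(\<chi> j. if j = i then y else x $ j) \<in> polydisc" if y: "y \<in> ball 0 1" for y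
        unfolding polydisc_def mem_Collect_eq
      proof
        fix j
        show "(\<chi> j. if j = i then y else x $ j) $ j \<in> ball 0 1" using y x[of j] by (cases "j = i") simp_all
      qed
      have "(\<lambda>y. F (\<chi> j. if j = i then y else x $ j)) holomorphic_on ball 0 1"
        by (rule several_holomorphic_slice[OF F pd])
      then show ?thesis by (rule holomorphic_transform) (simp add: F0_def pd del: mem_ball mem_ball_0)
    qed
    have "norm (\<mu> $ j) < r m" for j using q1(1)[of j] rq(1)[of m] by linarith
    from polydisc_reproducing_partial[OF rq(2) r(2) this mF0 bound hol, of UNIV]
    have "(\<integral>f. F0 (\<chi> j. f j) * (\<Prod>i\<in>UNIV. disc_kernel (r m) (\<mu> $ i) (f i)) \<partial>(\<Pi>\<^sub>M i\<in>UNIV. lborel)) = F0 \<mu>" by simp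
    moreover have "(\<lambda>x. F0 x * K (r m) x) \<in> borel_measurable borel" using mF0 mK by simp
    ultimately show ?thesis using \<mu> by (simp add: integral_vec(2) K_def F0_def)
  qed
  have lim: "(\<lambda>m. \<integral>x. F0 x * K (r m) x \<partial>lborel) \<longlonglongrightarrow> (\<integral>x. F0 x * K 1 x \<partial>lborel)"
  proof (rule integral_dominated_convergence[where w = "\<lambda>x. norm (F0 x) * (1 / (pi * ((1 - q) / 2)\<^sup>2)) ^ CARD('n)"])
    show "(\<lambda>x. F0 x * K 1 x) \<in> borel_measurable lborel" "(\<lambda>x. F0 x * K (r m) x) \<in> borel_measurable lborel" for m
      using mF0 mK by simp_all
    show "integrable lborel (\<lambda>x. norm (F0 x) * (1 / (pi * ((1 - q) / 2)\<^sup>2)) ^ CARD('n))"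
      using int unfolding F0_def[abs_def] by (intro integrable_mult_left integrable_norm)
    show "AE x in lborel. (\<lambda>m. F0 x * K (r m) x) \<longlonglongrightarrow> F0 x * K 1 x"
    proof (intro AE_I2)
      fix x
      show "(\<lambda>m. F0 x * K (r m) x) \<longlonglongrightarrow> F0 x * K 1 x"
      proof (cases "x \<in> polydisc")
        case True
        have "(\<lambda>m. disc_kernel (r m) (\<mu> $ i) (x $ i)) \<longlonglongrightarrow> disc_kernel 1 (\<mu> $ i) (x $ i)" for i
        proof -
          have xi: "norm (x $ i) < 1" using True by (auto simp: polydisc_def)
          have "\<mu> $ i * cnj (x $ i) \<noteq> 1"
          proof
            assume "\<mu> $ i * cnj (x $ i) = 1"
            then have "norm (\<mu> $ i) * norm (x $ i) = 1" by (metis complex_mod_cnj norm_mult norm_one)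
            moreover have "norm (\<mu> $ i) * norm (x $ i) \<le> q * 1" using q1(1)[of i] xi q0 by (intro mult_mono) auto
            ultimately show False using q1(2) by simp
          qed
          then have "(\<lambda>m. of_real ((r m)\<^sup>2) / (of_real pi * (of_real ((r m)\<^sup>2) - \<mu> $ i * cnj (x $ i))\<^sup>2))
             \<longlonglongrightarrow> complex_of_real (1\<^sup>2) / (of_real pi * (of_real (1\<^sup>2) - \<mu> $ i * cnj (x $ i))\<^sup>2)"
            by (intro tendsto_intros rlim) auto
          moreover have "\<forall>\<^sub>F m in sequentially. norm (x $ i) < r m"
            using order_tendstoD(1)[OF rlim xi] .
          then have "\<forall>\<^sub>F m in sequentially. of_real ((r m)\<^sup>2) / (of_real pi * (of_real ((r m)\<^sup>2) - \<mu> $ i * cnj (x $ i))\<^sup>2) = disc_kernel (r m) (\<mu> $ i) (x $ i)"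
            by (rule eventually_mono) (simp add: disc_kernel_def)
          ultimately have "(\<lambda>m. disc_kernel (r m) (\<mu> $ i) (x $ i)) \<longlonglongrightarrow> complex_of_real (1\<^sup>2) / (of_real pi * (of_real (1\<^sup>2) - \<mu> $ i * cnj (x $ i))\<^sup>2)"
            by (rule Lim_transform_eventually)
          then show ?thesis using xi by (simp add: disc_kernel_def)
        qed
        then show ?thesis unfolding K_def by (intro tendsto_mult tendsto_const tendsto_prod)
      qed (simp add: F0_def)
    qed
    show "AE x in lborel. norm (F0 x * K (r m) x) \<le> norm (F0 x) * (1 / (pi * ((1 - q) / 2)\<^sup>2)) ^ CARD('n)" for m
    proof (intro AE_I2)
      fix x
      have "norm (disc_kernel (r m) (\<mu> $ i) (x $ i)) \<le> 1 / (pi * ((1 - q) / 2)\<^sup>2)" for i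
      proof -
        have "norm (disc_kernel (r m) (\<mu> $ i) (x $ i)) \<le> indicat_real (ball 0 (r m)) (x $ i) * (1 / (pi * (r m - q)\<^sup>2))"
          by (rule norm_disc_kernel_le) (use rq[of m] r[of m] q1(1) in auto)
        also have "\<dots> \<le> 1 / (pi * (r m - q)\<^sup>2)" by (auto simp: indicator_def)
        also have "\<dots> \<le> 1 / (pi * ((1 - q) / 2)\<^sup>2)"
        proof -
          have "(1 - q) / 2 \<le> r m - q" using r(1)[of m] by (simp add: field_simps)
          then have "((1 - q) / 2)\<^sup>2 \<le> (r m - q)\<^sup>2" using q1(2) by (intro power_mono) auto
          then show ?thesis using q1(2) by (intro divide_left_mono mult_left_mono mult_pos_pos) auto
        qed
        finally show ?thesis .
      qed
      then have "norm (K (r m) x) \<le> (\<Prod>i\<in>(UNIV :: 'n set). 1 / (pi * ((1 - q) / 2)\<^sup>2))"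
        unfolding K_def prod_norm[symmetric] by (intro prod_mono) auto
      then show "norm (F0 x * K (r m) x) \<le> norm (F0 x) * (1 / (pi * ((1 - q) / 2)\<^sup>2)) ^ CARD('n)"
        unfolding norm_mult by (intro mult_left_mono) auto
    qed
  qed
  have "(\<lambda>m. F \<mu>) \<longlonglongrightarrow> (\<integral>x. F0 x * K 1 x \<partial>lborel)" using lim by (simp only: val)
  then have "(\<integral>x. F0 x * K 1 x \<partial>lborel) = F \<mu>" using LIMSEQ_unique tendsto_const by blast
  then show ?thesis by (simp only: F0_def K_def)
qed

section \<open>Fundamental domain of the symmetric group\<close>

definition permv :: "('n \<Rightarrow> 'n) \<Rightarrow> 'a ^ 'n \<Rightarrow> 'a ^ 'n" where
  "permv p x = (\<chi> i. x $ p i)"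

lemma permv_nth [simp]: "permv p x $ i = x $ p i"
  by (simp add: permv_def)

lemma permv_permv [simp]: "permv p (permv q x) = permv (q \<circ> p) x"
  by (simp add: vec_eq_iff)

lemma permv_id [simp]: "permv id x = x"
  by (simp add: vec_eq_iff)

lemma permv_inverse:
  assumes "p permutes UNIV"
  shows "permv p (permv (inv p) x) = x" "permv (inv p) (permv p x) = x"
  using permutes_inv_o[OF assms] by simp_all

lemma inner_permv:
  fixes x y :: "complex ^ 'n"
  assumes "p permutes UNIV" shows "permv p x \<bullet> permv p y = x \<bullet> y"
  using sum.permute[OF assms, of "\<lambda>i. x $ i \<bullet> y $ i"] by (simp add: inner_vec_def o_def)

lemma permv_Basis:
  assumes p: "p permutes UNIV" shows "permv p ` (Basis :: (complex ^ 'n) set) = Basis"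
proof -
  have sub: "permv q ` (Basis :: (complex ^ 'n) set) \<subseteq> Basis" if "q permutes UNIV" for q
  proof
    fix b assume "b \<in> permv q ` (Basis :: (complex ^ 'n) set)"
    then obtain i c where c: "c \<in> Basis" "b = permv q (axis i c)" by (auto simp: Basis_vec_def)
    have "permv q (axis i c) = axis (inv q i) c"
    proof -
      have "x = inv q i \<longleftrightarrow> q x = i" for x using permutes_inv_eq[OF that, of i x] by auto
      then show ?thesis by (simp add: vec_eq_iff axis_def)
    qed
    then show "b \<in> Basis" using c by (auto simp: Basis_vec_def)
  qed
  have "Basis = permv p ` permv (inv p) ` (Basis :: (complex ^ 'n) set)"
    by (simp add: image_image permv_inverse[OF p] del: permv_permv)
  also have "\<dots> \<subseteq> permv p ` Basis" using sub[OF permutes_inv[OF p]] by (rule image_mono)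
  finally show ?thesis using sub[OF p] by blast
qed

lemma continuous_permv: "continuous_on S (permv p :: complex ^ 'n \<Rightarrow> _)"
  unfolding permv_def by (intro continuous_on_vec_lambda bounded_linear.continuous_on[OF bounded_linear_vec_nth] continuous_on_id)

lemma borel_measurable_permv: "(permv p :: complex ^ 'n \<Rightarrow> _) \<in> borel_measurable borel"
  by (rule borel_measurable_continuous_onI[OF continuous_permv])

lemma lborel_distr_permv:
  assumes p: "p permutes UNIV" shows "lborel = distr lborel borel (permv p :: complex ^ 'n \<Rightarrow> _)"
proof (rule lborel_eqI)
  let ?q = "inv p"
  have q: "?q permutes UNIV" by (rule permutes_inv[OF p])
  fix l u :: "complex ^ 'n" assume lu: "\<And>b. b \<in> Basis \<Longrightarrow> l \<bullet> b \<le> u \<bullet> b"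
  have inj: "inj (permv ?q :: complex ^ 'n \<Rightarrow> _)"
    by (rule inj_on_inverseI[of _ "permv p"]) (rule permv_inverse(1)[OF p])
  have inn: "y \<bullet> permv ?q b = permv p y \<bullet> b" for y b :: "complex ^ 'n"
    using inner_permv[OF p, of y "permv ?q b"] permv_inverse(1)[OF p, of b] by (simp del: permv_permv)
  have ball: "(\<forall>b\<in>permv ?q ` Basis. P b) \<longleftrightarrow> (\<forall>b\<in>Basis. P (permv ?q b))" for P :: "complex ^ 'n \<Rightarrow> bool"
    by blast
  have "y \<in> permv p -` box l u \<longleftrightarrow> y \<in> box (permv ?q l) (permv ?q u)" for y :: "complex ^ 'n"
    using ball[of "\<lambda>b. permv ?q l \<bullet> b < y \<bullet> b \<and> y \<bullet> b < permv ?q u \<bullet> b"]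
    unfolding permv_Basis[OF q] mem_box inn vimage_eq permv_inverse(1)[OF p] by (rule sym)
  then have "permv p -` box l u = box (permv ?q l) (permv ?q u)" by (rule set_eqI)
  then have "emeasure (distr lborel borel (permv p)) (box l u) = emeasure lborel (box (permv ?q l) (permv ?q u))"
    using borel_measurable_permv[of p] by (simp add: emeasure_distr)
  also have "\<dots> = (\<Prod>b\<in>Basis. (permv ?q u - permv ?q l) \<bullet> b)"
  proof (rule emeasure_lborel_box)
    fix b :: "complex ^ 'n" assume b: "b \<in> Basis"
    have "b \<in> permv ?q ` Basis" unfolding permv_Basis[OF q] by (rule b)
    then obtain b0 where b0: "b0 \<in> Basis" "b = permv ?q b0" by (elim imageE)
    then show "permv ?q l \<bullet> b \<le> permv ?q u \<bullet> b" using lu[OF b0(1)] by (simp only: inner_permv[OF q])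
  qed
  also have "(\<Prod>b\<in>Basis. (permv ?q u - permv ?q l) \<bullet> b) = (\<Prod>b\<in>permv ?q ` Basis. (permv ?q u - permv ?q l) \<bullet> b)"
    by (simp only: permv_Basis[OF q])
  also have "\<dots> = (\<Prod>b\<in>Basis. (permv ?q u - permv ?q l) \<bullet> permv ?q b)"
    using prod.reindex[OF inj_on_subset[OF inj subset_UNIV], of "\<lambda>b. (permv ?q u - permv ?q l) \<bullet> b" Basis] by (simp only: o_def)
  also have "\<dots> = (\<Prod>b\<in>Basis. (u - l) \<bullet> b)"
    by (simp only: inner_diff_left inner_permv[OF q])
  finally show "emeasure (distr lborel borel (permv p)) (box l u) = (\<Prod>b\<in>Basis. (u - l) \<bullet> b)" .
qed simp

lemma integral_permv:
  fixes h :: "complex ^ 'n \<Rightarrow> 'b::{banach, second_countable_topology}"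
  assumes p: "p permutes UNIV" and h: "h \<in> borel_measurable borel"
  shows "integrable lborel (\<lambda>x. h (permv p x)) \<longleftrightarrow> integrable lborel h"
    and "(\<integral>x. h (permv p x) \<partial>lborel) = integral\<^sup>L lborel h"
proof -
  have m: "(permv p :: complex ^ 'n \<Rightarrow> _) \<in> borel_measurable lborel" using borel_measurable_permv[of p] by simp
  have "integrable (distr lborel borel (permv p)) h = integrable lborel (\<lambda>x. h (permv p x))"
    by (rule integrable_distr_eq[OF m h])
  then show "integrable lborel (\<lambda>x. h (permv p x)) \<longleftrightarrow> integrable lborel h"
    by (simp only: lborel_distr_permv[OF p, symmetric])
  have "integral\<^sup>L (distr lborel borel (permv p)) h = (\<integral>x. h (permv p x) \<partial>lborel)"
    by (rule integral_distr[OF m h])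
  then show "(\<integral>x. h (permv p x) \<partial>lborel) = integral\<^sup>L lborel h"
    by (simp only: lborel_distr_permv[OF p, symmetric])
qed

text \<open>A fundamental domain for the action of the symmetric group on the polydisc, up to a null set.\<close>

definition ordered_polydisc :: "(complex ^ 'n::{finite,wellorder}) set" where
  "ordered_polydisc = {x \<in> polydisc. \<forall>i j. i < j \<longrightarrow> Re (x $ i) < Re (x $ j)}"

text \<open>Real parts are compared, not the coordinates themselves: real parts can be ordered, and
  each coincidence is a real hyperplane, hence a null set.\<close>

definition coincident :: "(complex ^ 'n::{finite,wellorder}) set" where
  "coincident = {x. \<exists>i j. i \<noteq> j \<and> Re (x $ i) = Re (x $ j)}"

lemma open_ordered_polydisc: "open (ordered_polydisc :: (complex ^ 'n::{finite,wellorder}) set)"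
proof -
  have "ordered_polydisc = polydisc \<inter> (\<Inter>i. \<Inter>j\<in>{i<..}. {x :: complex ^ 'n::_. Re (x $ i) < Re (x $ j)})"
    by (auto simp: ordered_polydisc_def)
  moreover have "open {x :: complex ^ 'n::_. Re (x $ i) < Re (x $ j)}" for i j
    by (intro open_Collect_less continuous_on_Re bounded_linear.continuous_on[OF bounded_linear_vec_nth] continuous_on_id)
  then have "open (polydisc \<inter> (\<Inter>i. \<Inter>j\<in>{i<..}. {x :: complex ^ 'n::_. Re (x $ i) < Re (x $ j)}))"
    by (intro open_Int open_INT open_polydisc) auto
  ultimately show ?thesis by (simp only:)
qed

lemma negligible_coincident: "negligible (coincident :: (complex ^ 'n::{finite,wellorder}) set)"
proof -
  have "negligible {x :: complex ^ 'n::_. Re (x $ i) = Re (x $ j)}" if "i \<noteq> j" for i j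
  proof -
    define a :: "complex ^ 'n::_" where "a = axis i 1 - axis j 1"
    have "a $ i \<noteq> 0" using that by (simp add: a_def axis_def)
    then have "a \<noteq> 0" by auto
    moreover have "a \<bullet> x = Re (x $ i) - Re (x $ j)" for x
      by (simp add: a_def inner_diff_left inner_axis' inner_complex_def)
    then have "{x :: complex ^ 'n::_. Re (x $ i) = Re (x $ j)} = {x. a \<bullet> x = 0}" by auto
    ultimately show ?thesis using negligible_hyperplane[of a 0] by simp
  qed
  then have "negligible (\<Union>(i, j)\<in>{(i, j). i \<noteq> j}. {x :: complex ^ 'n::_. Re (x $ i) = Re (x $ j)})"
    by (intro negligible_Union finite_imageI) auto
  moreover have "coincident = (\<Union>(i, j)\<in>{(i, j). i \<noteq> j}. {x :: complex ^ 'n::_. Re (x $ i) = Re (x $ j)})"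
    by (auto simp: coincident_def)
  ultimately show ?thesis by simp
qed

lemma AE_not_negligible:
  fixes N :: "'a::euclidean_space set"
  assumes "negligible N" shows "AE x in lborel. x \<notin> N"
proof -
  have "N \<in> null_sets lebesgue" using assms by (simp add: negligible_iff_null_sets)
  then have "AE x in lebesgue. x \<notin> N" by (rule AE_not_in)
  then show ?thesis by (simp add: AE_completion_iff)
qed

lemma polydisc_permv: "p permutes UNIV \<Longrightarrow> permv p x \<in> polydisc \<longleftrightarrow> x \<in> polydisc"
proof -
  assume p: "p permutes UNIV"
  have fwd: "permv q y \<in> polydisc" if "y \<in> polydisc" for q and y :: "complex ^ 'a"
    using that by (auto simp: polydisc_def)
  show "permv p x \<in> polydisc \<longleftrightarrow> x \<in> polydisc"
    using fwd[of x p] fwd[of "permv p x" "inv p"] unfolding permv_inverse(2)[OF p] by blast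
qed

lemma ordered_polydisc_less_iff:
  assumes "z \<in> ordered_polydisc" shows "Re (z $ m) < Re (z $ i) \<longleftrightarrow> m < i"
proof -
  have o: "Re (z $ a) < Re (z $ b)" if "a < b" for a b using assms that by (auto simp: ordered_polydisc_def)
  show ?thesis
    using o[of m i] o[of i m] by (cases m i rule: linorder_cases) auto
qed

text \<open>A sorting permutation is determined by counting smaller real parts; this gives its
  uniqueness.\<close>

lemma ordered_permutation_rank:
  fixes x :: "complex ^ 'n::{finite,wellorder}"
  assumes p: "p permutes UNIV" and o: "permv p x \<in> ordered_polydisc"
  shows "card {l. Re (x $ l) < Re (x $ p i)} = rk i"
proof -
  have mono: "Re (x $ p m) < Re (x $ p i) \<longleftrightarrow> m < i" for m i
    using ordered_polydisc_less_iff[OF o] by simp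
  have "{l. Re (x $ l) < Re (x $ p i)} = p ` {..<i}"
  proof (intro set_eqI iffI)
    fix l assume "l \<in> {l. Re (x $ l) < Re (x $ p i)}"
    moreover obtain m where "l = p m" using permutes_surj[OF p] by (rule surjE)
    ultimately show "l \<in> p ` {..<i}" using mono by auto
  qed (auto simp: mono)
  then show ?thesis using permutes_inj[OF p] by (simp add: rk_def card_image inj_on_subset)
qed

text \<open>Away from coincidences exactly one permutation sorts the real parts, so the sum counts
  one when \<open>x\<close> lies in the polydisc.\<close>

lemma sum_indicator_ordered:
  fixes x :: "complex ^ 'n::{finite,wellorder}"
  assumes x: "x \<notin> coincident"
  shows "(\<Sum>p | p permutes (UNIV :: 'n set). indicat_real ordered_polydisc (permv p x)) = indicat_real polydisc x"
proof (cases "x \<in> polydisc")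
  case False
  then have "permv p x \<notin> ordered_polydisc" if "p permutes UNIV" for p
    using polydisc_permv[OF that, of x] by (auto simp: ordered_polydisc_def)
  then show ?thesis using False by simp
next
  case True
  \<comment> \<open>\<open>\<rho> j\<close> is the place that coordinate \<open>j\<close> takes
    after sorting; inverting it on ranks produces the sorting permutation.\<close>
  define \<rho> where "\<rho> j = card {l. Re (x $ l) < Re (x $ j)}" for j
  have \<rho>_less: "\<rho> j < CARD('n)" for j
    unfolding \<rho>_def by (intro psubset_card_mono) auto
  have \<rho>_mono: "\<rho> i < \<rho> j" if "Re (x $ i) < Re (x $ j)" for i j
    unfolding \<rho>_def using that by (intro psubset_card_mono) auto
  have inj: "inj \<rho>"
  proof (rule injI, rule ccontr)
    fix i j assume "\<rho> i = \<rho> j" "i \<noteq> j"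
    then have "Re (x $ i) \<noteq> Re (x $ j)" using x by (auto simp: coincident_def)
    then have "Re (x $ i) < Re (x $ j) \<or> Re (x $ j) < Re (x $ i)" by linarith
    then have "\<rho> i < \<rho> j \<or> \<rho> j < \<rho> i" using \<rho>_mono by blast
    then show False using \<open>\<rho> i = \<rho> j\<close> by simp
  qed
  have bij\<rho>: "bij_betw \<rho> UNIV {..<CARD('n)}"
  proof -
    have "\<rho> ` UNIV = {..<CARD('n)}"
      by (rule card_subset_eq) (auto simp: \<rho>_less card_image inj)
    then show ?thesis by (simp add: bij_betw_def inj)
  qed
  define p where "p i = inv_into UNIV \<rho> (rk i)" for i :: 'n
  have \<rho>p: "\<rho> (p i) = rk i" for i
    unfolding p_def using bij\<rho> rk_less_CARD[of i] by (intro f_inv_into_f) (auto simp: bij_betw_def)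
  have "inj p"
  proof (rule injI)
    fix i j assume "p i = p j"
    then have "rk i = rk j" by (simp only: \<rho>p[symmetric])
    then show "i = j" by simp
  qed
  then have "bij p" using finite_UNIV_inj_surj[of p] by (simp add: bij_def)
  then have p: "p permutes UNIV" by (intro bij_imp_permutes) auto
  have po: "permv p x \<in> ordered_polydisc"
  proof -
    have "Re (x $ p i) < Re (x $ p j)" if "i < j" for i j
    proof (rule ccontr)
      assume *: "\<not> Re (x $ p i) < Re (x $ p j)"
      have "p i \<noteq> p j" using that \<open>inj p\<close> by (auto simp: inj_def)
      then have "Re (x $ p j) < Re (x $ p i)" using * x by (auto simp: coincident_def less_le)
      then have "rk j < rk i" using \<rho>_mono[of "p j" "p i"] by (simp only: \<rho>p)
      then show False using that by simp
    qed
    then show ?thesis using True polydisc_permv[OF p] by (auto simp: ordered_polydisc_def)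
  qed
  have uniq: "q = p" if "q permutes UNIV" "permv q x \<in> ordered_polydisc" for q
  proof
    fix i
    have "\<rho> (q i) = rk i" using ordered_permutation_rank[OF that] by (simp add: \<rho>_def)
    then have "\<rho> (q i) = \<rho> (p i)" by (simp only: \<rho>p)
    then show "q i = p i" by (rule injD[OF inj])
  qed
  have "(\<Sum>q | q permutes (UNIV :: 'n set). indicat_real ordered_polydisc (permv q x)) = (\<Sum>q | q permutes (UNIV :: 'n set). if q = p then 1 else 0)"
  proof (rule sum.cong[OF refl])
    fix q assume "q \<in> {q. q permutes (UNIV :: 'n set)}"
    then have q: "q permutes UNIV" by (rule CollectD)
    show "indicat_real ordered_polydisc (permv q x) = (if q = p then 1 else 0)"
    proof (cases "q = p")
      case True
      then show ?thesis using po by (simp only: indicator_simps if_True simp_thms)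
    next
      case False
      then have "permv q x \<notin> ordered_polydisc" using uniq[OF q] by (rule contrapos_nn)
      then show ?thesis using False by (simp only: indicator_simps if_False simp_thms)
    qed
  qed
  also have "\<dots> = 1"
    using sum.delta[OF finite_permutations[OF finite[of "UNIV :: 'n set"]], of p "\<lambda>_. 1 :: real"] p by (simp only: mem_Collect_eq if_True)
  finally show ?thesis using True by simp
qed

text \<open>The symmetrized point determines the set of coordinates, and for a point of the ordered
  polydisc the position of a coordinate is the number of elements of that set with smaller real
  part.\<close>

lemma inj_on_symmetrization: "inj_on symmetrization (ordered_polydisc :: (complex ^ 'n::{finite,wellorder}) set)"
proof (rule inj_onI)
  fix x y :: "complex ^ 'n::_"
  assume x: "x \<in> ordered_polydisc" and y: "y \<in> ordered_polydisc" and eq: "symmetrization x = symmetrization y"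
  have range: "range (($) x) = range (($) y)" by (rule symmetrization_eq_imp_range_eq[OF eq])
  have rank: "card {w \<in> range (($) z). Re w < Re (z $ i)} = rk i" if "z \<in> ordered_polydisc" for z :: "complex ^ 'n::_" and i
  proof -
    have mono: "Re (z $ m) < Re (z $ i) \<longleftrightarrow> m < i" for m i
      by (rule ordered_polydisc_less_iff[OF that])
    have "inj (($) z)"
    proof (rule injI, rule ccontr)
      fix m i assume "z $ m = z $ i" "m \<noteq> i"
      then show False using mono[of m i] mono[of i m] by (cases m i rule: linorder_cases) auto
    qed
    moreover have "{w \<in> range (($) z). Re w < Re (z $ i)} = ($) z ` {..<i}" using mono by auto
    ultimately show ?thesis by (simp add: rk_def card_image inj_on_subset)
  qed
  have "x $ i = y $ i" for i
  proof -
    have "x $ i \<in> range (($) y)" unfolding range[symmetric] by (rule rangeI)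
    then obtain j where j: "x $ i = y $ j" by (rule rangeE)
    have "rk i = rk j" using rank[OF x, of i] rank[OF y, of j] by (simp add: range j)
    then show ?thesis using j by simp
  qed
  then show "x = y" by (simp add: vec_eq_iff)
qed

text \<open>Invariance of domain spares any discussion of the Jacobian; openness is what makes the
  image measurable.\<close>

lemma open_symmetrization_image: "open (symmetrization ` (ordered_polydisc :: (complex ^ 'n::{finite,wellorder}) set))"
  by (rule invariance_of_domain[OF continuous_on_symmetrization open_ordered_polydisc inj_on_symmetrization])

text \<open>Every other point comes from a point with coinciding real parts, and a differentiable
  map between spaces of equal dimension sends null sets to null sets.\<close>

lemma sym_polydisc_decomposition:
  shows "symmetrization ` ordered_polydisc \<subseteq> (sym_polydisc :: (complex ^ 'n::{finite,wellorder}) set)"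
    and "AE \<xi> in lborel. \<xi> \<in> (sym_polydisc :: (complex ^ 'n::_) set) \<longleftrightarrow> \<xi> \<in> symmetrization ` ordered_polydisc"
proof -
  show sub: "symmetrization ` ordered_polydisc \<subseteq> (sym_polydisc :: (complex ^ 'n::_) set)"
    by (auto simp: sym_polydisc_def ordered_polydisc_def)
  have "symmetrization differentiable_on (coincident :: (complex ^ 'n::_) set)"
    using symmetrization_has_derivative by (auto simp: differentiable_on_def differentiable_def intro: has_derivative_at_withinI)
  then have "negligible (symmetrization ` (coincident :: (complex ^ 'n::_) set))"
    by (intro negligible_differentiable_image_negligible negligible_coincident) auto
  then have "AE \<xi> in lborel. \<xi> \<notin> symmetrization ` (coincident :: (complex ^ 'n::_) set)" by (rule AE_not_negligible)
  then show "AE \<xi> in lborel. \<xi> \<in> (sym_polydisc :: (complex ^ 'n::_) set) \<longleftrightarrow> \<xi> \<in> symmetrization ` ordered_polydisc"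
  proof (rule AE_mp, intro AE_I2 impI iffI)
    fix \<xi> :: "complex ^ 'n::_" assume \<xi>: "\<xi> \<notin> symmetrization ` coincident" "\<xi> \<in> sym_polydisc"
    then obtain x where x: "x \<in> polydisc" "\<xi> = symmetrization x" by (auto simp: sym_polydisc_def)
    then have "x \<notin> coincident" using \<xi> by auto
    from sum_indicator_ordered[OF this] x
    have "(\<Sum>p | p permutes (UNIV :: 'n set). indicat_real ordered_polydisc (permv p x)) \<noteq> 0" by simp
    then obtain p where p: "p permutes (UNIV :: 'n set)" "indicat_real ordered_polydisc (permv p x) \<noteq> 0"
      by (elim sum.not_neutral_contains_not_neutral) simp
    then have "permv p x \<in> ordered_polydisc" by (auto simp: indicator_def split: if_splits)
    moreover have "symmetrization (permv p x) = \<xi>" using symmetrization_permute[OF p(1)] x by (simp add: permv_def)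
    ultimately show "\<xi> \<in> symmetrization ` ordered_polydisc" by blast
  next
    fix \<xi> :: "complex ^ 'n::_" assume "\<xi> \<in> symmetrization ` ordered_polydisc"
    then show "\<xi> \<in> sym_polydisc" by (rule subsetD[OF sub])
  qed
qed

section \<open>The Bergman kernel of the symmetrized polydisc\<close>

lemma several_holomorphic_mult:
  assumes "several_holomorphic_on f \<Omega>" "several_holomorphic_on g \<Omega>"
  shows "several_holomorphic_on (\<lambda>x. f x * g x) \<Omega>"
  unfolding several_holomorphic_on_def
proof
  fix p assume p: "p \<in> \<Omega>"
  obtain f' where f: "(f has_derivative f') (at p)" "\<And>c v. f' (c *s v) = c * f' v"
    using assms(1) p unfolding several_holomorphic_on_def by blast
  obtain g' where g: "(g has_derivative g') (at p)" "\<And>c v. g' (c *s v) = c * g' v"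
    using assms(2) p unfolding several_holomorphic_on_def by blast
  show "\<exists>h'. ((\<lambda>x. f x * g x) has_derivative h') (at p) \<and> (\<forall>c v. h' (c *s v) = c * h' v)"
    by (rule exI, rule conjI, rule has_derivative_mult[OF f(1) g(1)]) (simp add: f(2) g(2) algebra_simps)
qed

lemma several_holomorphic_divide:
  assumes "several_holomorphic_on f \<Omega>" "several_holomorphic_on g \<Omega>" "\<And>p. p \<in> \<Omega> \<Longrightarrow> g p \<noteq> 0"
  shows "several_holomorphic_on (\<lambda>x. f x / g x) \<Omega>"
  unfolding several_holomorphic_on_def
proof
  fix p assume p: "p \<in> \<Omega>"
  obtain f' where f: "(f has_derivative f') (at p)" "\<And>c v. f' (c *s v) = c * f' v"
    using assms(1) p unfolding several_holomorphic_on_def by blast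
  obtain g' where g: "(g has_derivative g') (at p)" "\<And>c v. g' (c *s v) = c * g' v"
    using assms(2) p unfolding several_holomorphic_on_def by blast
  have lin: "(c * a * b - d * (c * e)) / w = c * ((a * b - d * e) / w)" for a b c d e w :: complex
    by (simp add: algebra_simps)
  show "\<exists>h'. ((\<lambda>x. f x / g x) has_derivative h') (at p) \<and> (\<forall>c v. h' (c *s v) = c * h' v)"
    by (rule exI, rule conjI, rule has_derivative_divide'[OF f(1) g(1) assms(3)[OF p]]) (simp only: f(2) g(2) lin simp_thms)
qed

lemma several_holomorphic_cong_open:
  assumes "several_holomorphic_on f \<Omega>" "open \<Omega>" "\<And>x. x \<in> \<Omega> \<Longrightarrow> f x = g x"
  shows "several_holomorphic_on g \<Omega>"
  unfolding several_holomorphic_on_def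
proof
  fix p assume p: "p \<in> \<Omega>"
  obtain f' where f: "(f has_derivative f') (at p)" "\<And>c v. f' (c *s v) = c * f' v"
    using assms(1) p unfolding several_holomorphic_on_def by blast
  have "(g has_derivative f') (at p)"
    by (rule has_derivative_transform_within_open[OF f(1) assms(2) p assms(3)])
  then show "\<exists>g'. (g has_derivative g') (at p) \<and> (\<forall>c v. g' (c *s v) = c * g' v)" using f(2) by blast
qed

lemma several_holomorphic_bipoly:
  assumes "bipoly f" shows "several_holomorphic_on (\<lambda>\<xi>. f \<xi> \<eta>) \<Omega>"
  unfolding several_holomorphic_on_def
proof
  fix p
  obtain f1 f2 where "has_partials f f1 f2" using bipoly_has_partials[OF assms] by blast
  from has_partials_compose[OF this has_derivative_ident has_derivative_const]
  have "((\<lambda>\<xi>. f \<xi> \<eta>) has_derivative (\<lambda>h. (\<Sum>i\<in>UNIV. f1 i p \<eta> * h $ i) + (\<Sum>i\<in>UNIV. f2 i p \<eta> * 0 $ i))) (at p)" .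
  then show "\<exists>f'. ((\<lambda>\<xi>. f \<xi> \<eta>) has_derivative f') (at p) \<and> (\<forall>c v. f' (c *s v) = c * f' v)"
    by (intro exI conjI) (assumption, simp add: sum_distrib_left mult.left_commute)
qed

lemma bipoly_det_vander: "bipoly (\<lambda>\<xi> _. det (vander \<xi>))"
  unfolding vander_def by (intro bipoly_det bipoly_power bipoly.fst)

text \<open>The lift carries the Vandermonde determinant in place of the Jacobian determinant, which
  has the same modulus. The factor turns the symmetric function into an antisymmetric one and turns
  square integrals downstairs into square integrals upstairs.\<close>

lemma several_holomorphic_lift:
  fixes f :: "complex ^ 'n::{finite,wellorder} \<Rightarrow> complex"
  assumes f: "several_holomorphic_on f sym_polydisc"
  shows "several_holomorphic_on (\<lambda>x. f (symmetrization x) * det (vander x)) polydisc"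
proof (rule several_holomorphic_mult)
  show "several_holomorphic_on (\<lambda>x. det (vander x)) polydisc"
    by (rule several_holomorphic_bipoly[OF bipoly_det_vander])
  show "several_holomorphic_on (\<lambda>x. f (symmetrization x)) polydisc"
    unfolding several_holomorphic_on_def
  proof
    fix p :: "complex ^ 'n::_" assume "p \<in> polydisc"
    then have "symmetrization p \<in> sym_polydisc" unfolding sym_polydisc_def by (rule imageI)
    then obtain f' where f': "(f has_derivative f') (at (symmetrization p))" "\<And>c v. f' (c *s v) = c * f' v"
      using f unfolding several_holomorphic_on_def by blast
    have "((\<lambda>x. f (symmetrization x)) has_derivative (\<lambda>h. f' (sym_jacobian p *v h))) (at p)"
      by (rule has_derivative_compose[OF symmetrization_has_derivative f'(1)])
    then show "\<exists>h'. ((\<lambda>x. f (symmetrization x)) has_derivative h') (at p) \<and> (\<forall>c v. h' (c *s v) = c * h' v)"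
      by (intro exI conjI) (assumption, simp add: vector_scalar_commute f'(2))
  qed
qed

lemma lift_permv:
  fixes x :: "complex ^ 'n::{finite,wellorder}"
  assumes "p permutes UNIV"
  shows "f (symmetrization (permv p x)) * det (vander (permv p x)) = of_int (sign p) * (f (symmetrization x) * det (vander x))"
proof -
  have "symmetrization (permv p x) = symmetrization x" using symmetrization_permute[OF assms] by (simp only: permv_def)
  moreover have "vander (permv p x) = (\<chi> i. vander x $ p i)" by (simp add: vander_def vec_eq_iff)
  moreover have "det (\<chi> i. vander x $ p i) = of_int (sign p) * det (vander x)" by (rule det_permute_rows[OF assms])
  ultimately show ?thesis by (simp add: mult.left_commute)
qed

lemma cnj_det: "cnj (det M) = det (\<chi> i j. cnj (M $ i $ j))"
  by (simp add: det_def)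

lemma cnjv_symmetrization: "cnjv (symmetrization y) = symmetrization (cnjv y)"
  by (simp add: vec_eq_iff symmetrization_def elem_sym_def)

lemma symmetrization_in: "x \<in> polydisc \<Longrightarrow> symmetrization x \<in> sym_polydisc"
  by (simp add: sym_polydisc_def)

text \<open>The candidate for the Bergman kernel. The power of \<open>pi\<close> collects one factor
  for each disc kernel, and the value \<open>0\<close> outside matches the normalization in
  \<open>bergman_kernel\<close>.\<close>

definition sym_kernel :: "complex ^ 'n::{finite,wellorder} \<Rightarrow> complex ^ 'n::_ \<Rightarrow> complex" where
  "sym_kernel \<xi> \<zeta> = (if \<xi> \<in> sym_polydisc \<and> \<zeta> \<in> sym_polydisc
     then kernel_num \<xi> (cnjv \<zeta>) / (of_real pi ^ CARD('n) * kernel_den \<xi> (cnjv \<zeta>)) else 0)"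

section \<open>Estimates and expansion of the candidate kernel\<close>

lemma norm_one_minus_mult_cnj:
  fixes a b :: complex
  assumes "norm a \<le> 1" "norm b \<le> q" shows "1 - q \<le> norm (1 - a * cnj b)"
proof -
  have "norm (a * cnj b) \<le> 1 * q" unfolding norm_mult using assms by (intro mult_mono) auto
  then show ?thesis using norm_triangle_ineq2[of 1 "a * cnj b"] by simp
qed

text \<open>Each factor satisfies \<open>1 - q \<le> norm (1 - x $ i * cnj (y $ j))\<close>. The
  bound is uniform in \<open>x\<close> up to the boundary, as long as \<open>y\<close> stays in a
  smaller polydisc.\<close>

lemma norm_kernel_den_ge:
  fixes x y :: "complex ^ 'n::{finite,wellorder}"
  assumes x: "x \<in> polydisc" and y: "\<And>j. norm (y $ j) \<le> q" and q: "q < 1"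
  shows "((1 - q) ^ (CARD('n) * CARD('n)))\<^sup>2 \<le> norm (kernel_den (symmetrization x) (cnjv (symmetrization y)))"
proof -
  have "(1 - q) ^ (CARD('n) * CARD('n)) = (\<Prod>j\<in>(UNIV :: 'n set). \<Prod>i\<in>(UNIV :: 'n set). 1 - q)"
    by (simp add: power_mult)
  also have "\<dots> \<le> (\<Prod>j\<in>UNIV. \<Prod>i\<in>UNIV. norm (1 - x $ i * cnj (y $ j)))"
  proof (intro prod_mono conjI prod_nonneg)
    fix i j
    have "norm (x $ i) \<le> 1" using x by (simp add: polydisc_def less_imp_le)
    then show "1 - q \<le> norm (1 - x $ i * cnj (y $ j))" using y by (rule norm_one_minus_mult_cnj)
  qed (use q in auto)
  also have "\<dots> = norm (\<Prod>j\<in>UNIV. \<Prod>i\<in>UNIV. 1 - x $ i * cnjv y $ j)" by (simp add: prod_norm[symmetric])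
  finally show ?thesis
    unfolding cnjv_symmetrization kernel_den_symmetrization norm_power using q by (intro power_mono) auto
qed

lemma polydisc_bound:
  fixes y :: "complex ^ 'n"
  assumes "y \<in> polydisc" obtains q where "q < 1" "\<And>j. norm (y $ j) < q"
proof -
  define m where "m = Max (range (\<lambda>j. norm (y $ j)))"
  have "m \<in> range (\<lambda>j. norm (y $ j))" unfolding m_def by (intro Max_in) auto
  then have "m < 1" using assms by (auto simp: polydisc_def)
  have le: "norm (y $ j) \<le> m" for j unfolding m_def by (intro Max_ge) auto
  obtain q where q: "m < q" "q < 1" using dense[OF \<open>m < 1\<close>] by blast
  show ?thesis by (rule that[OF q(2)]) (rule le_less_trans[OF le q(1)])
qed

lemma kernel_den_nonzero:
  fixes \<xi> \<zeta> :: "complex ^ 'n::{finite,wellorder}"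
  assumes "\<xi> \<in> sym_polydisc" "\<zeta> \<in> sym_polydisc" shows "kernel_den \<xi> (cnjv \<zeta>) \<noteq> 0"
proof -
  obtain x y where x: "x \<in> polydisc" "\<xi> = symmetrization x" and y: "y \<in> polydisc" "\<zeta> = symmetrization y"
    using assms unfolding sym_polydisc_def by blast
  obtain q where q: "q < 1" "\<And>j. norm (y $ j) < q" using polydisc_bound[OF y(1)] by blast
  have "0 < ((1 - q) ^ (CARD('n) * CARD('n)))\<^sup>2" using q(1) by simp
  also have "\<dots> \<le> norm (kernel_den \<xi> (cnjv \<zeta>))"
    unfolding x y by (rule norm_kernel_den_ge[OF x(1) less_imp_le[OF q(2)] q(1)])
  finally show ?thesis by auto
qed

lemma kernel_num_bound:
  "\<exists>C\<ge>0. \<forall>\<xi>\<in>(sym_polydisc :: (complex ^ 'n::{finite,wellorder}) set). \<forall>\<zeta>\<in>sym_polydisc. norm (kernel_num \<xi> (cnjv \<zeta>)) \<le> C"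
proof -
  let ?G = "closure sym_polydisc :: (complex ^ 'n::{finite,wellorder}) set"
  have "continuous_on (?G \<times> ?G) (\<lambda>p. kernel_num (fst p) (cnjv (snd p)))"
    by (rule bipoly_continuous[OF bipoly_kernel(1)]) (auto intro!: continuous_intros bounded_linear.continuous_on[OF bounded_linear_vec_nth])
  moreover have "bounded (sym_polydisc :: (complex ^ 'n::_) set)" by (rule bounded_sym_polydisc)
  then have "compact (?G \<times> ?G)" by (intro compact_Times) (simp_all add: compact_closure)
  ultimately have "bounded ((\<lambda>p. kernel_num (fst p) (cnjv (snd p))) ` (?G \<times> ?G))"
    by (intro compact_imp_bounded compact_continuous_image)
  then obtain C where C: "\<And>p. p \<in> ?G \<times> ?G \<Longrightarrow> norm (kernel_num (fst p) (cnjv (snd p))) \<le> C"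
    unfolding bounded_iff by blast
  have "norm (kernel_num \<xi> (cnjv \<zeta>)) \<le> max C 0" if "\<xi> \<in> sym_polydisc" "\<zeta> \<in> sym_polydisc" for \<xi> \<zeta> :: "complex ^ 'n::_"
  proof -
    have "\<xi> \<in> ?G" "\<zeta> \<in> ?G" using that closure_subset by blast+
    then have "norm (kernel_num \<xi> (cnjv \<zeta>)) \<le> C" using C[of "(\<xi>, \<zeta>)"] by simp
    then show ?thesis by (rule order_trans) simp
  qed
  then show ?thesis by (intro exI[of _ "max C 0"]) auto
qed

text \<open>Provides the constant by which integrals over \<xi> are dominated while the second
  argument moves in a compact part of the domain.\<close>

lemma sym_kernel_bound:
  assumes q: "q < 1"
  obtains C where "0 \<le> C" "\<And>\<xi> y :: complex ^ 'n::{finite,wellorder}. (\<And>j. norm (y $ j) \<le> q) \<Longrightarrow>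
    norm (sym_kernel \<xi> (symmetrization y)) \<le> C"
proof -
  obtain C where C: "0 \<le> C" "\<And>\<xi> \<zeta> :: complex ^ 'n::_. \<xi> \<in> sym_polydisc \<Longrightarrow> \<zeta> \<in> sym_polydisc \<Longrightarrow>
    norm (kernel_num \<xi> (cnjv \<zeta>)) \<le> C" using kernel_num_bound by blast
  define c where "c = pi ^ CARD('n) * ((1 - q) ^ (CARD('n) * CARD('n)))\<^sup>2"
  have c: "0 < c" using q by (simp add: c_def)
  show ?thesis
  proof (rule that)
    show "0 \<le> C / c" using C(1) c by simp
    fix \<xi> y :: "complex ^ 'n::_" assume y: "\<And>j. norm (y $ j) \<le> q"
    show "norm (sym_kernel \<xi> (symmetrization y)) \<le> C / c"
    proof (cases "\<xi> \<in> sym_polydisc \<and> symmetrization y \<in> sym_polydisc")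
      case False
      then have "sym_kernel \<xi> (symmetrization y) = 0" unfolding sym_kernel_def by (rule if_not_P)
      then show ?thesis using \<open>0 \<le> C / c\<close> by simp
    next
      case True
      then obtain x where x: "x \<in> polydisc" "\<xi> = symmetrization x" unfolding sym_polydisc_def by blast
      have "c \<le> norm (of_real pi ^ CARD('n) * kernel_den \<xi> (cnjv (symmetrization y)))"
        unfolding c_def norm_mult norm_power x(2)
        using norm_kernel_den_ge[OF x(1) y q] by (simp add: mult_left_mono)
      moreover have "norm (kernel_num \<xi> (cnjv (symmetrization y))) \<le> C" using C(2) True by blast
      ultimately have "norm (kernel_num \<xi> (cnjv (symmetrization y))) / norm (of_real pi ^ CARD('n) * kernel_den \<xi> (cnjv (symmetrization y))) \<le> C / c"
        using C(1) c by (intro frac_le) auto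
      then show ?thesis using True by (simp only: sym_kernel_def if_True norm_divide simp_thms)
    qed
  qed
qed

lemma several_holomorphic_sym_kernel:
  fixes w :: "complex ^ 'n::{finite,wellorder}"
  shows "several_holomorphic_on (\<lambda>\<xi>. sym_kernel \<xi> w) sym_polydisc"
proof (cases "w \<in> sym_polydisc")
  case False
  have "several_holomorphic_on (\<lambda>\<xi>. 0) (sym_polydisc :: (complex ^ 'n::_) set)"
    by (rule several_holomorphic_bipoly[OF bipoly.const])
  then show ?thesis using False by (simp add: sym_kernel_def)
next
  case True
  have "several_holomorphic_on (\<lambda>\<xi>. kernel_num \<xi> (cnjv w) / (of_real pi ^ CARD('n) * kernel_den \<xi> (cnjv w))) sym_polydisc"
    using kernel_den_nonzero[OF _ True]
    by (intro several_holomorphic_divide several_holomorphic_mult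
        several_holomorphic_bipoly[OF bipoly_kernel(1)] several_holomorphic_bipoly[OF bipoly_kernel(2)]
        several_holomorphic_bipoly[OF bipoly.const]) simp
  then show ?thesis by (rule several_holomorphic_cong_open[OF _ open_sym_polydisc]) (simp add: sym_kernel_def True)
qed

text \<open>The transformation rule of the kernel under the symmetrization, as the Leibniz expansion
  of the determinant of disc kernels. The Vandermonde determinants stay as factors because they may
  vanish; the conjugate is the form in which the kernel appears under the integral.\<close>

lemma sym_kernel_expansion:
  fixes x y :: "complex ^ 'n::{finite,wellorder}"
  assumes x: "x \<in> polydisc" and y: "y \<in> polydisc"
  shows "cnj (sym_kernel (symmetrization x) (symmetrization y)) * cnj (det (vander x)) * det (vander y) =
    (\<Sum>p | p permutes (UNIV :: 'n set). of_int (sign p) * (\<Prod>j\<in>UNIV. disc_kernel 1 (y $ j) (x $ p j)))"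
proof -
  let ?M = "\<chi> j i. 1 / (1 - x $ i * cnjv y $ j)\<^sup>2"
  let ?num = "kernel_num (symmetrization x) (symmetrization (cnjv y))"
  let ?den = "kernel_den (symmetrization x) (symmetrization (cnjv y))"
  have den: "?den \<noteq> 0"
    using kernel_den_nonzero[OF symmetrization_in[OF x] symmetrization_in[OF y]] by (simp only: cnjv_symmetrization not_False_eq_True)
  have nz: "1 - x $ i * cnjv y $ j \<noteq> 0" for i j
  proof -
    have "norm (x $ i) < 1" "norm (y $ j) < 1" using x y by (auto simp: polydisc_def)
    then have "1 - norm (y $ j) \<le> norm (1 - x $ i * cnj (y $ j))" by (intro norm_one_minus_mult_cnj) auto
    then show ?thesis using \<open>norm (y $ j) < 1\<close> by auto
  qed
  have "det ?M * ?den = det (vander (cnjv y)) * ?num * det (vander x)"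
    by (rule det_kernel_matrix[OF nz])
  then have M: "?num / ?den * det (vander x) * det (vander (cnjv y)) = det ?M"
    using den by (simp add: divide_eq_eq mult.commute mult.left_commute)
  have "sym_kernel (symmetrization x) (symmetrization y) = 1 / of_real pi ^ CARD('n) * (?num / ?den)"
    using symmetrization_in[OF x] symmetrization_in[OF y] by (simp add: sym_kernel_def cnjv_symmetrization)
  then have "sym_kernel (symmetrization x) (symmetrization y) * det (vander x) * det (vander (cnjv y)) = 1 / of_real pi ^ CARD('n) * det ?M"
    by (simp only: M[symmetric] mult.assoc)
  then have "cnj (sym_kernel (symmetrization x) (symmetrization y) * det (vander x) * det (vander (cnjv y))) = cnj (1 / of_real pi ^ CARD('n) * det ?M)"
    by (rule arg_cong)
  moreover have "cnj (det (vander (cnjv y))) = det (vander y)"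
    by (simp add: cnj_det vander_def)
  ultimately have "cnj (sym_kernel (symmetrization x) (symmetrization y)) * cnj (det (vander x)) * det (vander y) = 1 / of_real pi ^ CARD('n) * cnj (det ?M)"
    by simp
  also have "cnj (det ?M) = det (\<chi> j i. 1 / (1 - cnj (x $ i) * y $ j)\<^sup>2)"
    unfolding cnj_det by (simp only: vec_lambda_beta complex_cnj_divide complex_cnj_power complex_cnj_diff complex_cnj_mult complex_cnj_one cnjv_nth complex_cnj_cnj)
  also have "1 / of_real pi ^ CARD('n) * \<dots> = (\<Sum>p | p permutes (UNIV :: 'n set). of_int (sign p) *
      (1 / of_real pi ^ CARD('n) * (\<Prod>j\<in>UNIV. 1 / (1 - cnj (x $ p j) * y $ j)\<^sup>2)))"
    unfolding det_def sum_distrib_left by (simp only: vec_lambda_beta mult.left_commute)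
  also have "\<dots> = (\<Sum>p | p permutes (UNIV :: 'n set). of_int (sign p) * (\<Prod>j\<in>UNIV. disc_kernel 1 (y $ j) (x $ p j)))"
  proof (rule sum.cong[OF refl])
    fix p :: "'n \<Rightarrow> 'n"
    have "disc_kernel 1 (y $ j) (x $ p j) = 1 / of_real pi * (1 / (1 - cnj (x $ p j) * y $ j)\<^sup>2)" for j
      using x by (simp add: disc_kernel_def polydisc_def mult.commute)
    then have "(\<Prod>j\<in>UNIV. disc_kernel 1 (y $ j) (x $ p j)) = (\<Prod>j\<in>(UNIV :: 'n set). 1 / of_real pi) * (\<Prod>j\<in>UNIV. 1 / (1 - cnj (x $ p j) * y $ j)\<^sup>2)"
      by (simp only: prod.distrib)
    then show "of_int (sign p) * (1 / of_real pi ^ CARD('n) * (\<Prod>j\<in>UNIV. 1 / (1 - cnj (x $ p j) * y $ j)\<^sup>2)) =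
      of_int (sign p) * (\<Prod>j\<in>UNIV. disc_kernel 1 (y $ j) (x $ p j))"
      by (simp only: prod_constant power_one_over)
  qed
  finally show ?thesis .
qed

text \<open>Approximation by points with distinct coordinates that stay in one polydisc of radius
  \<open>q < 1\<close>, so that a single kernel bound serves the whole sequence.\<close>

lemma approximating_sequence:
  fixes y :: "complex ^ 'n::{finite,wellorder}"
  assumes y: "y \<in> polydisc"
  obtains q s where "q < 1" "\<And>j. norm (y $ j) \<le> q" "s \<longlonglongrightarrow> y" "\<And>k. det (vander (s k)) \<noteq> 0" "\<And>k j. norm (s k $ j) \<le> q"
proof -
  obtain q where q: "q < 1" "\<And>j. norm (y $ j) < q" using polydisc_bound[OF y] by blast
  define t where "t k = (\<chi> i. y $ i + of_real (inverse (real (Suc k))) * of_nat (rk i))" for k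
  have lim: "t \<longlonglongrightarrow> y" unfolding t_def by (rule perturbed_tendsto)
  have "\<forall>\<^sub>F k in sequentially. inj (($) (t k))" unfolding t_def by (rule eventually_distinct_coordinates)
  moreover have "\<forall>\<^sub>F k in sequentially. norm (t k $ j) < q" for j
    by (rule order_tendstoD(2)[OF tendsto_norm[OF tendsto_vec_nth[OF lim]] q(2)])
  then have "\<forall>\<^sub>F k in sequentially. \<forall>j. norm (t k $ j) < q" by (rule eventually_all_finite)
  ultimately have "\<forall>\<^sub>F k in sequentially. inj (($) (t k)) \<and> (\<forall>j. norm (t k $ j) < q)" by (rule eventually_conj)
  then obtain N where N: "\<And>k. N \<le> k \<Longrightarrow> inj (($) (t k)) \<and> (\<forall>j. norm (t k $ j) < q)"
    unfolding eventually_sequentially by blast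
  show ?thesis
  proof (rule that[of q "\<lambda>k. t (k + N)"])
    show "(\<lambda>k. t (k + N)) \<longlonglongrightarrow> y" using lim by (rule LIMSEQ_ignore_initial_segment)
    show "det (vander (t (k + N))) \<noteq> 0" for k using N[of "k + N"] by (intro det_vander_nonzero) auto
    show "norm (t (k + N) $ j) \<le> q" for k j using N[of "k + N"] by (auto intro: less_imp_le)
  qed (use q in \<open>auto intro: less_imp_le\<close>)
qed

text \<open>On a set of finite measure \<open>norm (f x) \<le> 1 + (norm (f x))\<^sup>2\<close>
  suffices.\<close>

lemma integrable_of_square:
  fixes f :: "'a::euclidean_space \<Rightarrow> complex"
  assumes \<Omega>: "open \<Omega>" "bounded \<Omega>" and m: "(\<lambda>x. indicator \<Omega> x * f x) \<in> borel_measurable borel"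
    and int: "integrable lborel (\<lambda>x. indicat_real \<Omega> x * (norm (f x))\<^sup>2)"
  shows "integrable lborel (\<lambda>x. indicator \<Omega> x * f x)"
proof (rule Bochner_Integration.integrable_bound)
  have "integrable lborel (indicat_real \<Omega>)"
    using \<Omega> emeasure_bounded_finite[OF \<Omega>(2)] by (intro integrable_real_indicator) auto
  then show "integrable lborel (\<lambda>x. indicat_real \<Omega> x + indicat_real \<Omega> x * (norm (f x))\<^sup>2)"
    using int by (rule Bochner_Integration.integrable_add)
  show "(\<lambda>x. indicator \<Omega> x * f x) \<in> borel_measurable lborel" using m by simp
  have sq: "norm (f x) \<le> 1 + (norm (f x))\<^sup>2" for x
  proof -
    have "2 * norm (f x) \<le> 1 + (norm (f x))\<^sup>2"
      using zero_le_power2[of "norm (f x) - 1"] by (simp add: power2_eq_square algebra_simps)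
    then show ?thesis using norm_ge_zero[of "f x"] by linarith
  qed
  show "AE x in lborel. norm (indicator \<Omega> x * f x) \<le> norm (indicat_real \<Omega> x + indicat_real \<Omega> x * (norm (f x))\<^sup>2)"
  proof (rule AE_I2)
    fix x
    show "norm (indicator \<Omega> x * f x) \<le> norm (indicat_real \<Omega> x + indicat_real \<Omega> x * (norm (f x))\<^sup>2)"
    proof (cases "x \<in> \<Omega>")
      case True
      have "norm (f x) \<le> norm (1 + (norm (f x))\<^sup>2)" using sq[of x] by (simp add: abs_of_nonneg)
      then show ?thesis using True by (simp only: indicator_simps mult_1_left)
    qed simp
  qed
qed

lemma borel_measurable_norm_square:
  fixes f :: "'a::euclidean_space \<Rightarrow> complex"
  assumes "(\<lambda>x. indicator \<Omega> x * f x) \<in> borel_measurable borel"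
  shows "(\<lambda>x. indicat_real \<Omega> x * (norm (f x))\<^sup>2) \<in> borel_measurable borel"
proof -
  have "(\<lambda>x. (norm (indicator \<Omega> x * f x))\<^sup>2) \<in> borel_measurable borel" using assms by measurable
  moreover have "(\<lambda>x. (norm (indicator \<Omega> x * f x))\<^sup>2) = (\<lambda>x. indicat_real \<Omega> x * (norm (f x))\<^sup>2)"
    by (auto simp: indicator_def)
  ultimately show ?thesis by (simp only:)
qed

section \<open>Unfolding integrals from the symmetrized polydisc to the polydisc\<close>

lemma bergman_space_iff_lborel:
  assumes \<Omega>: "open \<Omega>"
  shows "f \<in> bergman_space \<Omega> \<longleftrightarrow> several_holomorphic_on f \<Omega> \<and> integrable lborel (\<lambda>x. indicat_real \<Omega> x * (norm (f x))\<^sup>2)"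
proof -
  have "set_integrable lebesgue \<Omega> (\<lambda>z. (cmod (f z))\<^sup>2) \<longleftrightarrow> integrable lborel (\<lambda>x. indicat_real \<Omega> x * (norm (f x))\<^sup>2)"
    if f: "several_holomorphic_on f \<Omega>"
  proof -
    have "(\<lambda>x. indicat_real \<Omega> x * (norm (f x))\<^sup>2) \<in> borel_measurable lborel"
      using borel_measurable_norm_square[OF borel_measurable_indicator_mult[OF \<Omega> several_holomorphic_continuous[OF f]]] by simp
    from integrable_completion[OF this] show ?thesis by (simp add: set_integrable_def)
  qed
  then show ?thesis unfolding bergman_space_def by blast
qed

lemma set_lebesgue_integral_lborel:
  fixes f :: "'a::euclidean_space \<Rightarrow> complex"
  assumes "open \<Omega>" "continuous_on \<Omega> f"
  shows "(LINT z:\<Omega>|lebesgue. f z) = (\<integral>x. indicator \<Omega> x * f x \<partial>lborel)"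
proof -
  have eq: "(\<lambda>x. indicat_real \<Omega> x *\<^sub>R f x) = (\<lambda>x. indicator \<Omega> x * f x)" by (auto simp: indicator_def)
  have "(\<lambda>x. indicator \<Omega> x * f x) \<in> borel_measurable lborel"
    using borel_measurable_indicator_mult[OF assms] by simp
  from integral_completion[OF this] show ?thesis unfolding set_lebesgue_integral_def eq .
qed

text \<open>The permuted copies of the ordered polydisc tile the polydisc up to the null set of
  coincidences, and permuting coordinates preserves Lebesgue measure.\<close>

lemma sum_integral_ordered_polydisc:
  fixes H :: "complex ^ 'n::{finite,wellorder} \<Rightarrow> complex"
  assumes int: "integrable lborel (\<lambda>x. indicator polydisc x * H x)"
  shows "\<And>p. p permutes UNIV \<Longrightarrow> integrable lborel (\<lambda>x. indicator ordered_polydisc x * H (permv p x))"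
    and "(\<Sum>p | p permutes (UNIV :: 'n set). \<integral>x. indicator ordered_polydisc x * H (permv p x) \<partial>lborel) =
      (\<integral>x. indicator polydisc x * H x \<partial>lborel)"
proof -
  \<comment> \<open>\<open>g p\<close> restricts the integrand to the tile of the points sorted by
    \<open>inv p\<close>; the substitution by \<open>permv p\<close> moves this tile back to the
    ordered polydisc.\<close>
  define g where "g p z = indicator ordered_polydisc (permv (inv p) z) * (indicator polydisc z * H z)" for p :: "'n \<Rightarrow> 'n" and z
  have mH: "(\<lambda>x. indicator polydisc x * H x) \<in> borel_measurable borel"
    using borel_measurable_integrable[OF int] by simp
  have mO: "(\<lambda>x. indicator (ordered_polydisc :: (complex ^ 'n::_) set) x :: complex) \<in> borel_measurable borel"
    by (intro borel_measurable_indicator borel_open open_ordered_polydisc)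
  have mg: "g p \<in> borel_measurable borel" for p
    unfolding g_def by (intro borel_measurable_times mH measurable_compose[OF borel_measurable_permv mO])
  have intg: "integrable lborel (g p)" for p
  proof (rule Bochner_Integration.integrable_bound[OF int])
    show "g p \<in> borel_measurable lborel" using mg by simp
    show "AE x in lborel. norm (g p x) \<le> norm (indicator polydisc x * H x)"
      by (rule AE_I2) (simp add: g_def norm_mult indicator_def)
  qed
  have gp: "g p (permv p x) = indicator ordered_polydisc x * H (permv p x)" if p: "p permutes UNIV" for p x
  proof (cases "x \<in> ordered_polydisc")
    case True
    then have "permv p x \<in> polydisc" using polydisc_permv[OF p] by (auto simp: ordered_polydisc_def)
    then show ?thesis unfolding g_def permv_inverse(2)[OF p] by simp
  next
    case False
    then show ?thesis unfolding g_def permv_inverse(2)[OF p] by simp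
  qed
  show "integrable lborel (\<lambda>x. indicator ordered_polydisc x * H (permv p x))" if p: "p permutes UNIV" for p
    using integral_permv(1)[OF p mg[of p]] intg[of p] by (simp only: gp[OF p] simp_thms)
  have "(\<Sum>p | p permutes (UNIV :: 'n set). \<integral>x. indicator ordered_polydisc x * H (permv p x) \<partial>lborel) =
      (\<Sum>p | p permutes (UNIV :: 'n set). integral\<^sup>L lborel (g p))"
  proof (rule sum.cong[OF refl])
    fix p assume "p \<in> {p. p permutes (UNIV :: 'n set)}"
    then have p: "p permutes UNIV" by (rule CollectD)
    show "(\<integral>x. indicator ordered_polydisc x * H (permv p x) \<partial>lborel) = integral\<^sup>L lborel (g p)"
      using integral_permv(2)[OF p mg[of p]] by (simp only: gp[OF p])
  qed
  also have "\<dots> = (\<integral>z. (\<Sum>p | p permutes (UNIV :: 'n set). g p z) \<partial>lborel)"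
    by (rule Bochner_Integration.integral_sum[symmetric]) (rule intg)
  also have "\<dots> = (\<integral>x. indicator polydisc x * H x \<partial>lborel)"
  proof (rule integral_cong_AE)
    show "(\<lambda>x. indicator polydisc x * H x) \<in> borel_measurable lborel" using mH by simp
    show "(\<lambda>z. \<Sum>p | p permutes (UNIV :: 'n set). g p z) \<in> borel_measurable lborel"
      by (intro borel_measurable_sum) (use mg in simp)
    show "AE z in lborel. (\<Sum>p | p permutes (UNIV :: 'n set). g p z) = indicator polydisc z * H z"
      using AE_not_negligible[OF negligible_coincident]
    proof (rule AE_mp, intro AE_I2 impI)
      fix z :: "complex ^ 'n::_" assume z: "z \<notin> coincident"
      have "(\<Sum>p | p permutes (UNIV :: 'n set). indicat_real ordered_polydisc (permv (inv p) z)) = indicat_real polydisc z"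
        unfolding sum_indicator_ordered[OF z, symmetric] by (rule sum_permutations_inverse[symmetric])
      then have "complex_of_real (\<Sum>p | p permutes (UNIV :: 'n set). indicat_real ordered_polydisc (permv (inv p) z)) = complex_of_real (indicat_real polydisc z)"
        by (rule arg_cong)
      moreover have "complex_of_real (indicat_real A a) = indicator A a" for A :: "(complex ^ 'n::_) set" and a
        by (simp add: indicator_def)
      ultimately have 1: "(\<Sum>p | p permutes (UNIV :: 'n set). indicator ordered_polydisc (permv (inv p) z)) = (indicator polydisc z :: complex)"
        by (simp only: of_real_sum)
      have "(\<Sum>p | p permutes (UNIV :: 'n set). g p z) = indicator polydisc z * (indicator polydisc z * H z)"
        unfolding g_def sum_distrib_right[symmetric] 1 ..
      also have "\<dots> = indicator polydisc z * H z" by (simp add: indicator_def)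
      finally show "(\<Sum>p | p permutes (UNIV :: 'n set). g p z) = indicator polydisc z * H z" .
    qed
  qed
  finally show "(\<Sum>p | p permutes (UNIV :: 'n set). \<integral>x. indicator ordered_polydisc x * H (permv p x) \<partial>lborel) =
      (\<integral>x. indicator polydisc x * H x \<partial>lborel)" .
qed

lemma norm_lift_permv:
  fixes x :: "complex ^ 'n::{finite,wellorder}"
  assumes "p permutes UNIV"
  shows "norm (f (symmetrization (permv p x)) * det (vander (permv p x))) = norm (f (symmetrization x) * det (vander x))"
proof -
  have "norm (of_int (sign p) :: complex) = 1" by (simp add: sign_def)
  then show ?thesis unfolding lift_permv[OF assms] norm_mult by simp
qed

lemma AE_sum_indicator_lift:
  fixes f :: "complex ^ 'n::{finite,wellorder} \<Rightarrow> complex"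
  defines "h \<equiv> \<lambda>x. indicat_real ordered_polydisc x * (norm (f (symmetrization x) * det (vander x)))\<^sup>2"
  shows "AE x in lborel. (\<Sum>p | p permutes (UNIV :: 'n set). h (permv p x)) = indicat_real polydisc x * (norm (f (symmetrization x) * det (vander x)))\<^sup>2"
  using AE_not_negligible[OF negligible_coincident]
proof (rule AE_mp, intro AE_I2 impI)
  fix x :: "complex ^ 'n::_" assume x: "x \<notin> coincident"
  have "(\<Sum>p | p permutes (UNIV :: 'n set). h (permv p x)) =
    (\<Sum>p | p permutes (UNIV :: 'n set). indicat_real ordered_polydisc (permv p x) * (norm (f (symmetrization x) * det (vander x)))\<^sup>2)"
  proof (rule sum.cong[OF refl])
    fix p assume "p \<in> {p. p permutes (UNIV :: 'n set)}"
    then have p: "p permutes UNIV" by (rule CollectD)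
    show "h (permv p x) = indicat_real ordered_polydisc (permv p x) * (norm (f (symmetrization x) * det (vander x)))\<^sup>2"
      unfolding h_def norm_lift_permv[OF p] ..
  qed
  then show "(\<Sum>p | p permutes (UNIV :: 'n set). h (permv p x)) = indicat_real polydisc x * (norm (f (symmetrization x) * det (vander x)))\<^sup>2"
    unfolding sum_distrib_right[symmetric] sum_indicator_ordered[OF x] .
qed

text \<open>The squared modulus of the lift is invariant under permutations, and on the ordered
  polydisc its integral is that of \<open>(norm (f x))\<^sup>2\<close> by change of variables. Hence
  the lift is square integrable on the polydisc, and integrable since the polydisc is
  bounded.\<close>

lemma integrable_lift:
  fixes f :: "complex ^ 'n::{finite,wellorder} \<Rightarrow> complex"
  assumes f: "several_holomorphic_on f sym_polydisc" "integrable lborel (\<lambda>x. indicat_real sym_polydisc x * (norm (f x))\<^sup>2)"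
  shows "integrable lborel (\<lambda>x. indicator polydisc x * (f (symmetrization x) * det (vander x)))"
proof -
  let ?F = "\<lambda>x. f (symmetrization x) * det (vander x)"
  let ?T = "symmetrization ` (ordered_polydisc :: (complex ^ 'n::_) set)"
  define h where "h = (\<lambda>x. indicat_real ordered_polydisc x * (norm (?F x))\<^sup>2)"
  have F: "continuous_on polydisc ?F"
    by (rule several_holomorphic_continuous[OF several_holomorphic_lift[OF f(1)]])
  have cf: "continuous_on sym_polydisc f" by (rule several_holomorphic_continuous[OF f(1)])
  have sub: "(ordered_polydisc :: (complex ^ 'n::_) set) \<subseteq> polydisc" by (auto simp: ordered_polydisc_def)
  have mh: "h \<in> borel_measurable borel" unfolding h_def
    by (rule borel_measurable_norm_square[OF borel_measurable_indicator_mult[OF open_ordered_polydisc continuous_on_subset[OF F sub]]])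
  have mT: "(\<lambda>x. indicat_real ?T x * (norm (f x))\<^sup>2) \<in> borel_measurable borel"
    by (rule borel_measurable_norm_square[OF borel_measurable_indicator_mult[OF open_symmetrization_image continuous_on_subset[OF cf sym_polydisc_decomposition(1)]]])
  have eqh: "(\<lambda>x. indicat_real ordered_polydisc x * ((norm (det (sym_jacobian x)))\<^sup>2 * (norm (f (symmetrization x)))\<^sup>2)) = h"
    by (simp add: h_def norm_det_sym_jacobian norm_mult power_mult_distrib mult.commute mult.left_commute)
  have "integrable lborel (\<lambda>x. indicat_real ?T x * (norm (f x))\<^sup>2)"
  proof (rule integrable_cong_AE_imp[OF f(2)])
    show "(\<lambda>x. indicat_real ?T x * (norm (f x))\<^sup>2) \<in> borel_measurable lborel" using mT by simp
    show "AE x in lborel. indicat_real sym_polydisc x * (norm (f x))\<^sup>2 = indicat_real ?T x * (norm (f x))\<^sup>2"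
      using sym_polydisc_decomposition(2) by (rule AE_mp) (intro AE_I2 impI, simp add: indicator_def)
  qed
  moreover have "(\<lambda>x. indicat_real ordered_polydisc x * ((norm (det (sym_jacobian x)))\<^sup>2 * (norm (f (symmetrization x)))\<^sup>2)) \<in> borel_measurable borel"
    unfolding eqh by (rule mh)
  note change_of_variables_complex_real(1)[OF open_ordered_polydisc inj_on_symmetrization symmetrization_has_derivative mT this]
  ultimately have inth: "integrable lborel h" unfolding eqh by (rule iffD2[rotated])
  have "integrable lborel (\<lambda>x. h (permv p x))" if "p permutes UNIV" for p
    using integral_permv(1)[OF that mh] inth by blast
  then have "integrable lborel (\<lambda>x. \<Sum>p | p permutes (UNIV :: 'n set). h (permv p x))"
    by (intro Bochner_Integration.integrable_sum) (simp only: mem_Collect_eq)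
  then have "integrable lborel (\<lambda>x. indicat_real polydisc x * (norm (?F x))\<^sup>2)"
  proof (rule integrable_cong_AE_imp)
    show "(\<lambda>x. indicat_real polydisc x * (norm (?F x))\<^sup>2) \<in> borel_measurable lborel"
      using borel_measurable_norm_square[OF borel_measurable_indicator_mult[OF open_polydisc F]] by simp
    show "AE x in lborel. (\<Sum>p | p permutes (UNIV :: 'n set). h (permv p x)) = indicat_real polydisc x * (norm (?F x))\<^sup>2"
      unfolding h_def by (rule AE_sum_indicator_lift)
  qed
  then show ?thesis
    by (rule integrable_of_square[OF open_polydisc bounded_polydisc borel_measurable_indicator_mult[OF open_polydisc F]])
qed

lemma sym_kernel_product_integrable:
  fixes f :: "complex ^ 'n::{finite,wellorder} \<Rightarrow> complex"
  assumes f: "continuous_on sym_polydisc f" "integrable lborel (\<lambda>\<xi>. indicator sym_polydisc \<xi> * f \<xi>)"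
    and w: "w \<in> sym_polydisc"
  shows "continuous_on sym_polydisc (\<lambda>\<xi>. f \<xi> * cnj (sym_kernel \<xi> w))"
    and "(\<lambda>\<xi>. indicator sym_polydisc \<xi> * (f \<xi> * cnj (sym_kernel \<xi> w))) \<in> borel_measurable borel"
    and "integrable lborel (\<lambda>\<xi>. indicator sym_polydisc \<xi> * (f \<xi> * cnj (sym_kernel \<xi> w)))"
proof -
  show c: "continuous_on sym_polydisc (\<lambda>\<xi>. f \<xi> * cnj (sym_kernel \<xi> w))"
    by (intro continuous_on_mult f(1) continuous_on_cnj several_holomorphic_continuous several_holomorphic_sym_kernel)
  show m: "(\<lambda>\<xi>. indicator sym_polydisc \<xi> * (f \<xi> * cnj (sym_kernel \<xi> w))) \<in> borel_measurable borel"
    by (rule borel_measurable_indicator_mult[OF open_sym_polydisc c])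
  obtain y where y: "y \<in> polydisc" "w = symmetrization y" using w unfolding sym_polydisc_def by blast
  obtain q where q: "q < 1" "\<And>j. norm (y $ j) < q" using polydisc_bound[OF y(1)] by blast
  obtain C where C: "0 \<le> C" "\<And>\<xi> y :: complex ^ 'n::_. (\<And>j. norm (y $ j) \<le> q) \<Longrightarrow>
    norm (sym_kernel \<xi> (symmetrization y)) \<le> C" using sym_kernel_bound[OF q(1), where 'n='n] by blast
  have K: "norm (sym_kernel \<xi> w) \<le> C" for \<xi> unfolding y(2) by (rule C(2)) (rule less_imp_le[OF q(2)])
  show "integrable lborel (\<lambda>\<xi>. indicator sym_polydisc \<xi> * (f \<xi> * cnj (sym_kernel \<xi> w)))"
  proof (rule Bochner_Integration.integrable_bound)
    show "integrable lborel (\<lambda>\<xi>. of_real C * (indicator sym_polydisc \<xi> * f \<xi>))"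
      using f(2) by (intro Bochner_Integration.integrable_mult_right)
    show "(\<lambda>\<xi>. indicator sym_polydisc \<xi> * (f \<xi> * cnj (sym_kernel \<xi> w))) \<in> borel_measurable lborel" using m by simp
    have "norm (indicator sym_polydisc \<xi> * (f \<xi> * cnj (sym_kernel \<xi> w))) \<le> norm (of_real C * (indicator sym_polydisc \<xi> * f \<xi>))" for \<xi>
      using mult_right_mono[OF K[of \<xi>], of "norm (f \<xi>)"] C(1) by (simp add: norm_mult indicator_def mult.commute)
    then show "AE \<xi> in lborel. norm (indicator sym_polydisc \<xi> * (f \<xi> * cnj (sym_kernel \<xi> w))) \<le> norm (of_real C * (indicator sym_polydisc \<xi> * f \<xi>))"
      by (intro AE_I2)
  qed
qed

lemma disc_kernel_product:
  fixes y :: "complex ^ 'n"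
  assumes y: "y \<in> polydisc" and F: "integrable lborel (\<lambda>x. indicator polydisc x * F x)"
  shows "integrable lborel (\<lambda>x. indicator polydisc x * (F x * (\<Prod>j\<in>UNIV. disc_kernel 1 (y $ j) (x $ j))))"
proof -
  define C where "C = (\<Prod>j\<in>UNIV. 1 / (pi * (1 - norm (y $ j))\<^sup>2))"
  have "norm (\<Prod>j\<in>UNIV. disc_kernel 1 (y $ j) (x $ j)) \<le> C" for x :: "complex ^ 'n"
    unfolding C_def prod_norm[symmetric]
  proof (intro prod_mono conjI norm_ge_zero)
    fix j
    have "norm (y $ j) < 1" using y by (simp add: polydisc_def)
    then have "norm (disc_kernel 1 (y $ j) (x $ j)) \<le> indicat_real (ball 0 1) (x $ j) * (1 / (pi * (1 - norm (y $ j))\<^sup>2))"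
      by (intro norm_disc_kernel_le) auto
    also have "\<dots> \<le> 1 * (1 / (pi * (1 - norm (y $ j))\<^sup>2))" by (rule mult_right_mono) (auto simp: indicator_def)
    finally show "norm (disc_kernel 1 (y $ j) (x $ j)) \<le> 1 / (pi * (1 - norm (y $ j))\<^sup>2)" by simp
  qed
  note bound = this
  have "0 \<le> C" unfolding C_def by (intro prod_nonneg) simp
  have vec: "(\<lambda>x :: complex ^ 'n. x $ j) \<in> borel_measurable borel" for j
    by (intro borel_measurable_continuous_onI bounded_linear.continuous_on[OF bounded_linear_vec_nth] continuous_on_id)
  have mP: "(\<lambda>x :: complex ^ 'n. \<Prod>j\<in>UNIV. disc_kernel 1 (y $ j) (x $ j)) \<in> borel_measurable borel"
    by (intro borel_measurable_prod measurable_compose[OF vec borel_measurable_disc_kernel])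
  have mF: "(\<lambda>x. indicator polydisc x * F x) \<in> borel_measurable borel" using borel_measurable_integrable[OF F] by simp
  have "(\<lambda>x. (indicator polydisc x * F x) * (\<Prod>j\<in>UNIV. disc_kernel 1 (y $ j) (x $ j))) \<in> borel_measurable borel"
    by (intro borel_measurable_times mF mP)
  then have m: "(\<lambda>x. indicator polydisc x * (F x * (\<Prod>j\<in>UNIV. disc_kernel 1 (y $ j) (x $ j)))) \<in> borel_measurable lborel"
    by (simp add: mult.assoc)
  show ?thesis
  proof (rule Bochner_Integration.integrable_bound[OF _ m])
    show "integrable lborel (\<lambda>x. of_real C * (indicator polydisc x * F x))"
      using F by (intro Bochner_Integration.integrable_mult_right)
    have "norm (indicator polydisc x * (F x * (\<Prod>j\<in>UNIV. disc_kernel 1 (y $ j) (x $ j)))) \<le> norm (of_real C * (indicator polydisc x * F x))" for x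
    proof -
      have "norm (indicator polydisc x * (F x * (\<Prod>j\<in>UNIV. disc_kernel 1 (y $ j) (x $ j)))) =
        norm (indicator polydisc x * F x) * norm (\<Prod>j\<in>UNIV. disc_kernel 1 (y $ j) (x $ j))"
        by (simp only: norm_mult mult.assoc)
      also have "\<dots> \<le> norm (indicator polydisc x * F x) * C" by (rule mult_left_mono[OF bound norm_ge_zero])
      also have "\<dots> = norm (of_real C * (indicator polydisc x * F x))"
        using \<open>0 \<le> C\<close> by (simp only: norm_mult norm_of_real abs_of_nonneg mult.commute)
      finally show ?thesis .
    qed
    then show "AE x in lborel. norm (indicator polydisc x * (F x * (\<Prod>j\<in>UNIV. disc_kernel 1 (y $ j) (x $ j)))) \<le> norm (of_real C * (indicator polydisc x * F x))"
      by (intro AE_I2)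
  qed
qed

text \<open>The change of variables brings the integral to the ordered polydisc, where the kernel
  expansion turns it into a sum over permutations. Summation rebuilds the integral over the whole
  polydisc, and there the product of disc kernels reproduces the lift at \<open>y\<close>. Division
  by \<open>det (vander y)\<close> ends the argument. No factorial appears, because almost every
  point downstairs has exactly one ordered preimage.\<close>

lemma sym_kernel_reproducing_distinct:
  fixes f :: "complex ^ 'n::{finite,wellorder} \<Rightarrow> complex"
  assumes f: "f \<in> bergman_space sym_polydisc" and y: "y \<in> polydisc" and V: "det (vander y) \<noteq> 0"
  shows "(\<integral>\<xi>. indicator sym_polydisc \<xi> * (f \<xi> * cnj (sym_kernel \<xi> (symmetrization y))) \<partial>lborel) = f (symmetrization y)"
proof -
  have fh: "several_holomorphic_on f sym_polydisc" "integrable lborel (\<lambda>x. indicat_real sym_polydisc x * (norm (f x))\<^sup>2)"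
    using f bergman_space_iff_lborel[OF open_sym_polydisc, of f] by blast+
  have cf: "continuous_on sym_polydisc f" by (rule several_holomorphic_continuous[OF fh(1)])
  have fint: "integrable lborel (\<lambda>\<xi>. indicator sym_polydisc \<xi> * f \<xi>)"
    by (rule integrable_of_square[OF open_sym_polydisc bounded_sym_polydisc borel_measurable_indicator_mult[OF open_sym_polydisc cf] fh(2)])
  define u where "u \<xi> = f \<xi> * cnj (sym_kernel \<xi> (symmetrization y))" for \<xi>
  note u = sym_kernel_product_integrable[OF cf fint symmetrization_in[OF y], folded u_def]
  let ?F = "\<lambda>x. f (symmetrization x) * det (vander x)"
  let ?T = "symmetrization ` (ordered_polydisc :: (complex ^ 'n::_) set)"
  define H where "H x = ?F x * (\<Prod>j\<in>UNIV. disc_kernel 1 (y $ j) (x $ j))" for x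
  have intF: "integrable lborel (\<lambda>x. indicator polydisc x * ?F x)" by (rule integrable_lift[OF fh])
  have intH: "integrable lborel (\<lambda>x. indicator polydisc x * H x)" unfolding H_def by (rule disc_kernel_product[OF y intF])
  have sub: "(ordered_polydisc :: (complex ^ 'n::_) set) \<subseteq> polydisc" by (auto simp: ordered_polydisc_def)
  have mT: "(\<lambda>\<xi>. indicator ?T \<xi> * u \<xi>) \<in> borel_measurable borel"
    by (rule borel_measurable_indicator_mult[OF open_symmetrization_image continuous_on_subset[OF u(1) sym_polydisc_decomposition(1)]])
  then have mT': "(\<lambda>\<xi>. indicator ?T \<xi> * u \<xi>) \<in> borel_measurable lborel" by simp
  have mG': "(\<lambda>\<xi>. indicator sym_polydisc \<xi> * u \<xi>) \<in> borel_measurable lborel" using u(2) by simp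
  have AE: "AE \<xi> in lborel. indicator sym_polydisc \<xi> * u \<xi> = indicator ?T \<xi> * u \<xi>"
    using sym_polydisc_decomposition(2) by (rule AE_mp) (intro AE_I2 impI, simp add: indicator_def)
  have intT: "integrable lborel (\<lambda>\<xi>. indicator ?T \<xi> * u \<xi>)" by (rule integrable_cong_AE_imp[OF u(3) mT' AE])
  \<comment> \<open>The Jacobian factor is \<open>det (vander x)\<close> times its conjugate: the
    first goes with \<open>f\<close> into the lift, the second into the kernel expansion. The signs
    of that expansion are absorbed by the antisymmetry of the lift.\<close>
  have pointwise: "indicator ordered_polydisc x * ((norm (det (sym_jacobian x)))\<^sup>2 * u (symmetrization x)) * det (vander y) =
    (\<Sum>p | p permutes (UNIV :: 'n set). indicator ordered_polydisc x * H (permv p x))" for x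
  proof (cases "x \<in> ordered_polydisc")
    case True
    then have x: "x \<in> polydisc" using sub by blast
    have "(\<Sum>p | p permutes (UNIV :: 'n set). H (permv p x)) =
      (\<Sum>p | p permutes (UNIV :: 'n set). ?F x * (of_int (sign p) * (\<Prod>j\<in>UNIV. disc_kernel 1 (y $ j) (x $ p j))))"
    proof (rule sum.cong[OF refl])
      fix p assume "p \<in> {p. p permutes (UNIV :: 'n set)}"
      then have p: "p permutes UNIV" by (rule CollectD)
      show "H (permv p x) = ?F x * (of_int (sign p) * (\<Prod>j\<in>UNIV. disc_kernel 1 (y $ j) (x $ p j)))"
        unfolding H_def lift_permv[OF p] permv_nth by (simp only: mult.assoc mult.left_commute)
    qed
    also have "\<dots> = ?F x * (cnj (sym_kernel (symmetrization x) (symmetrization y)) * cnj (det (vander x)) * det (vander y))"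
      unfolding sum_distrib_left[symmetric] sym_kernel_expansion[OF x y] ..
    also have "\<dots> = (det (vander x) * cnj (det (vander x))) * u (symmetrization x) * det (vander y)"
      unfolding u_def by (simp only: mult.assoc mult.commute mult.left_commute)
    also have "\<dots> = (norm (det (sym_jacobian x)))\<^sup>2 * u (symmetrization x) * det (vander y)"
      using complex_norm_square[of "det (vander x)"] by (simp add: norm_det_sym_jacobian)
    finally show ?thesis using True by (simp add: sum_distrib_left[symmetric])
  qed simp
  have "continuous_on ordered_polydisc (\<lambda>x. of_real ((norm (det (vander x)))\<^sup>2) * u (symmetrization x))"
  proof (intro continuous_on_mult continuous_on_of_real continuous_on_power continuous_on_norm)
    show "continuous_on ordered_polydisc (\<lambda>x. det (vander x))"
      by (rule several_holomorphic_continuous[OF several_holomorphic_bipoly[OF bipoly_det_vander]])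
    show "continuous_on ordered_polydisc (\<lambda>x. u (symmetrization x))"
      by (rule continuous_on_compose2[OF u(1) continuous_on_symmetrization sym_polydisc_decomposition(1)])
  qed
  from borel_measurable_indicator_mult[OF open_ordered_polydisc this]
  have mV: "(\<lambda>x. indicator ordered_polydisc x * ((norm (det (sym_jacobian x)))\<^sup>2 * u (symmetrization x))) \<in> borel_measurable borel"
    by (simp add: norm_det_sym_jacobian)
  have "(\<integral>\<xi>. indicator sym_polydisc \<xi> * u \<xi> \<partial>lborel) = (\<integral>\<xi>. indicator ?T \<xi> * u \<xi> \<partial>lborel)"
    by (rule integral_cong_AE[OF mG' mT' AE])
  also have "\<dots> = (\<integral>x. indicator ordered_polydisc x * ((norm (det (sym_jacobian x)))\<^sup>2 * u (symmetrization x)) \<partial>lborel)"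
    by (rule change_of_variables_complex[OF open_ordered_polydisc inj_on_symmetrization symmetrization_has_derivative mT mV intT, symmetric])
  finally have "(\<integral>\<xi>. indicator sym_polydisc \<xi> * u \<xi> \<partial>lborel) * det (vander y) =
    (\<integral>x. indicator ordered_polydisc x * ((norm (det (sym_jacobian x)))\<^sup>2 * u (symmetrization x)) * det (vander y) \<partial>lborel)"
    by simp
  also have "\<dots> = (\<Sum>p | p permutes (UNIV :: 'n set). \<integral>x. indicator ordered_polydisc x * H (permv p x) \<partial>lborel)"
    unfolding pointwise using sum_integral_ordered_polydisc(1)[OF intH]
    by (intro Bochner_Integration.integral_sum) (simp only: mem_Collect_eq)
  also have "\<dots> = (\<integral>x. indicator polydisc x * H x \<partial>lborel)"
    by (rule sum_integral_ordered_polydisc(2)[OF intH])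
  also have "\<dots> = (\<integral>x. (indicator polydisc x * ?F x) * (\<Prod>j\<in>UNIV. disc_kernel 1 (y $ j) (x $ j)) \<partial>lborel)"
    unfolding H_def by (simp only: mult.assoc)
  also have "\<dots> = ?F y"
    by (rule polydisc_reproducing[OF several_holomorphic_lift[OF fh(1)] intF y])
  finally show ?thesis using V unfolding u_def by (simp only: mult_right_cancel[OF V])
qed

lemma continuous_on_sym_kernel:
  fixes \<xi> :: "complex ^ 'n::{finite,wellorder}"
  shows "continuous_on sym_polydisc (sym_kernel \<xi>)"
proof (cases "\<xi> \<in> sym_polydisc")
  case False
  have "sym_kernel \<xi> = (\<lambda>_. 0)" unfolding sym_kernel_def using False by simp
  then show ?thesis by (simp only: continuous_on_const)
next
  case True
  have cnjv: "continuous_on sym_polydisc (\<lambda>\<zeta>. cnjv \<zeta> $ i)" for i :: 'n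
    unfolding cnjv_nth by (intro continuous_on_cnj bounded_linear.continuous_on[OF bounded_linear_vec_nth] continuous_on_id)
  have "continuous_on sym_polydisc (\<lambda>\<zeta>. kernel_num \<xi> (cnjv \<zeta>) / (of_real pi ^ CARD('n) * kernel_den \<xi> (cnjv \<zeta>)))"
  proof (intro continuous_on_divide continuous_on_mult continuous_on_const ballI)
    show "continuous_on sym_polydisc (\<lambda>\<zeta>. kernel_num \<xi> (cnjv \<zeta>))"
      by (rule bipoly_continuous[OF bipoly_kernel(1) continuous_on_const cnjv])
    show "continuous_on sym_polydisc (\<lambda>\<zeta>. kernel_den \<xi> (cnjv \<zeta>))"
      by (rule bipoly_continuous[OF bipoly_kernel(2) continuous_on_const cnjv])
    show "of_real pi ^ CARD('n) * kernel_den \<xi> (cnjv \<zeta>) \<noteq> 0" if "\<zeta> \<in> sym_polydisc" for \<zeta>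
      using kernel_den_nonzero[OF True that] by simp
  qed
  then show ?thesis
    by (rule continuous_on_eq) (simp add: sym_kernel_def True)
qed

text \<open>Both sides depend continuously on \<open>w\<close>: the left by dominated convergence
  with the uniform kernel bound, the right because \<open>f\<close> is continuous. So repeated
  coordinates are reached from distinct ones.\<close>

lemma sym_kernel_reproducing:
  fixes f :: "complex ^ 'n::{finite,wellorder} \<Rightarrow> complex"
  assumes f: "f \<in> bergman_space sym_polydisc" and w: "w \<in> sym_polydisc"
  shows "(\<integral>\<xi>. indicator sym_polydisc \<xi> * (f \<xi> * cnj (sym_kernel \<xi> w)) \<partial>lborel) = f w"
proof -
  have fh: "several_holomorphic_on f sym_polydisc" "integrable lborel (\<lambda>x. indicat_real sym_polydisc x * (norm (f x))\<^sup>2)"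
    using f bergman_space_iff_lborel[OF open_sym_polydisc, of f] by blast+
  have cf: "continuous_on sym_polydisc f" by (rule several_holomorphic_continuous[OF fh(1)])
  have fint: "integrable lborel (\<lambda>\<xi>. indicator sym_polydisc \<xi> * f \<xi>)"
    by (rule integrable_of_square[OF open_sym_polydisc bounded_sym_polydisc borel_measurable_indicator_mult[OF open_sym_polydisc cf] fh(2)])
  obtain y where y: "y \<in> polydisc" "w = symmetrization y" using w unfolding sym_polydisc_def by blast
  obtain q s where q: "q < 1" "\<And>j. norm (y $ j) \<le> q" and s: "s \<longlonglongrightarrow> y" "\<And>k. det (vander (s k)) \<noteq> 0" "\<And>k j. norm (s k $ j) \<le> q"
    using approximating_sequence[OF y(1)] by blast
  have sp: "s k \<in> polydisc" for k
    unfolding polydisc_def using le_less_trans[OF s(3) q(1)] by simp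
  obtain C where C: "0 \<le> C" "\<And>\<xi> y :: complex ^ 'n::_. (\<And>j. norm (y $ j) \<le> q) \<Longrightarrow>
    norm (sym_kernel \<xi> (symmetrization y)) \<le> C" using sym_kernel_bound[OF q(1), where 'n='n] by blast
  have lim: "(\<lambda>k. symmetrization (s k)) \<longlonglongrightarrow> w"
    unfolding y(2) by (rule continuous_on_tendsto_compose[OF continuous_on_symmetrization[of UNIV] s(1)]) auto
  have "(\<lambda>k. \<integral>\<xi>. indicator sym_polydisc \<xi> * (f \<xi> * cnj (sym_kernel \<xi> (symmetrization (s k)))) \<partial>lborel) \<longlonglongrightarrow>
     (\<integral>\<xi>. indicator sym_polydisc \<xi> * (f \<xi> * cnj (sym_kernel \<xi> w)) \<partial>lborel)"
  proof (rule integral_dominated_convergence[where w="\<lambda>\<xi>. C * norm (indicator sym_polydisc \<xi> * f \<xi>)"])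
    show "(\<lambda>\<xi>. indicator sym_polydisc \<xi> * (f \<xi> * cnj (sym_kernel \<xi> w))) \<in> borel_measurable lborel"
      using sym_kernel_product_integrable(2)[OF cf fint w] by simp
    show "(\<lambda>\<xi>. indicator sym_polydisc \<xi> * (f \<xi> * cnj (sym_kernel \<xi> (symmetrization (s k))))) \<in> borel_measurable lborel" for k
      using sym_kernel_product_integrable(2)[OF cf fint symmetrization_in[OF sp]] by simp
    show "integrable lborel (\<lambda>\<xi>. C * norm (indicator sym_polydisc \<xi> * f \<xi>))"
      using fint by (intro Bochner_Integration.integrable_mult_right Bochner_Integration.integrable_norm)
    have "(\<lambda>k. indicator sym_polydisc \<xi> * (f \<xi> * cnj (sym_kernel \<xi> (symmetrization (s k))))) \<longlonglongrightarrow>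
      indicator sym_polydisc \<xi> * (f \<xi> * cnj (sym_kernel \<xi> w))" for \<xi>
    proof -
      have "(\<lambda>k. sym_kernel \<xi> (symmetrization (s k))) \<longlonglongrightarrow> sym_kernel \<xi> w"
        by (rule continuous_on_tendsto_compose[OF continuous_on_sym_kernel lim w]) (simp add: symmetrization_in[OF sp])
      then show ?thesis by (intro tendsto_mult tendsto_const tendsto_cnj)
    qed
    then show "AE \<xi> in lborel. (\<lambda>k. indicator sym_polydisc \<xi> * (f \<xi> * cnj (sym_kernel \<xi> (symmetrization (s k))))) \<longlonglongrightarrow>
      indicator sym_polydisc \<xi> * (f \<xi> * cnj (sym_kernel \<xi> w))" by (intro AE_I2)
    have "norm (indicator sym_polydisc \<xi> * (f \<xi> * cnj (sym_kernel \<xi> (symmetrization (s k))))) \<le> C * norm (indicator sym_polydisc \<xi> * f \<xi>)" for k \<xi>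
    proof -
      have "norm (indicator sym_polydisc \<xi> * (f \<xi> * cnj (sym_kernel \<xi> (symmetrization (s k))))) =
        norm (sym_kernel \<xi> (symmetrization (s k))) * norm (indicator sym_polydisc \<xi> * f \<xi>)"
        by (simp only: norm_mult complex_mod_cnj mult.assoc mult.commute mult.left_commute)
      also have "\<dots> \<le> C * norm (indicator sym_polydisc \<xi> * f \<xi>)"
        by (rule mult_right_mono[OF C(2) norm_ge_zero]) (rule s(3))
      finally show ?thesis .
    qed
    then show "AE \<xi> in lborel. norm (indicator sym_polydisc \<xi> * (f \<xi> * cnj (sym_kernel \<xi> (symmetrization (s k))))) \<le> C * norm (indicator sym_polydisc \<xi> * f \<xi>)" for k
      by (intro AE_I2)
  qed
  then have "(\<lambda>k. f (symmetrization (s k))) \<longlonglongrightarrow> (\<integral>\<xi>. indicator sym_polydisc \<xi> * (f \<xi> * cnj (sym_kernel \<xi> w)) \<partial>lborel)"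
    by (simp only: sym_kernel_reproducing_distinct[OF f sp s(2)])
  moreover have "(\<lambda>k. f (symmetrization (s k))) \<longlonglongrightarrow> f w"
    by (rule continuous_on_tendsto_compose[OF cf lim w]) (simp add: symmetrization_in[OF sp])
  ultimately show ?thesis by (rule LIMSEQ_unique)
qed

section \<open>Identification of the Bergman kernel and positivity on the diagonal\<close>

lemma integrable_indicat_sym_polydisc:
  "integrable lborel (indicat_real (sym_polydisc :: (complex ^ 'n::{finite,wellorder}) set))"
proof (rule integrable_real_indicator)
  show "(sym_polydisc :: (complex ^ 'n::_) set) \<in> sets lborel" using borel_open[OF open_sym_polydisc] by simp
  show "emeasure lborel (sym_polydisc :: (complex ^ 'n::_) set) < \<infinity>" using emeasure_bounded_finite[OF bounded_sym_polydisc] by simp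
qed

lemma sym_kernel_in_bergman_space:
  fixes w :: "complex ^ 'n::{finite,wellorder}"
  assumes w: "w \<in> sym_polydisc"
  shows "(\<lambda>z. sym_kernel z w) \<in> bergman_space sym_polydisc"
proof -
  obtain y where y: "y \<in> polydisc" "w = symmetrization y" using w unfolding sym_polydisc_def by blast
  obtain q where q: "q < 1" "\<And>j. norm (y $ j) < q" using polydisc_bound[OF y(1)] by blast
  obtain C where C: "0 \<le> C" "\<And>\<xi> y :: complex ^ 'n::_. (\<And>j. norm (y $ j) \<le> q) \<Longrightarrow>
    norm (sym_kernel \<xi> (symmetrization y)) \<le> C" using sym_kernel_bound[OF q(1), where 'n='n] by blast
  have K: "norm (sym_kernel \<xi> w) \<le> C" for \<xi> unfolding y(2) by (rule C(2)) (rule less_imp_le[OF q(2)])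
  have "integrable lborel (\<lambda>x. indicat_real sym_polydisc x * (norm (sym_kernel x w))\<^sup>2)"
  proof (rule Bochner_Integration.integrable_bound)
    show "integrable lborel (\<lambda>x :: complex ^ 'n::_. C\<^sup>2 * indicat_real sym_polydisc x)"
      by (intro Bochner_Integration.integrable_mult_right integrable_indicat_sym_polydisc)
    show "(\<lambda>x. indicat_real sym_polydisc x * (norm (sym_kernel x w))\<^sup>2) \<in> borel_measurable lborel"
      using borel_measurable_norm_square[OF borel_measurable_indicator_mult[OF open_sym_polydisc
          several_holomorphic_continuous[OF several_holomorphic_sym_kernel[of w]]]] by simp
    show "AE x in lborel. norm (indicat_real sym_polydisc x * (norm (sym_kernel x w))\<^sup>2) \<le> norm (C\<^sup>2 * indicat_real sym_polydisc x)"
      by (rule AE_I2) (simp add: indicator_def power_mono[OF K])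
  qed
  then show ?thesis using several_holomorphic_sym_kernel[of w] unfolding bergman_space_iff_lborel[OF open_sym_polydisc] by blast
qed

lemma reproducing_kernel_sym_kernel: "reproducing_kernel sym_polydisc sym_kernel"
  unfolding reproducing_kernel_def
proof (intro conjI ballI)
  fix f :: "complex ^ 'n::{finite,wellorder} \<Rightarrow> complex" and w :: "complex ^ 'n::_"
  assume f: "f \<in> bergman_space sym_polydisc" and w: "w \<in> sym_polydisc"
  have "several_holomorphic_on f sym_polydisc" using f by (simp add: bergman_space_def)
  then have "continuous_on sym_polydisc (\<lambda>\<xi>. f \<xi> * cnj (sym_kernel \<xi> w))"
    by (intro continuous_on_mult continuous_on_cnj several_holomorphic_continuous several_holomorphic_sym_kernel)
  from set_lebesgue_integral_lborel[OF open_sym_polydisc this]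
  show "f w = (LINT z:sym_polydisc|lebesgue. f z * cnj (sym_kernel z w))"
    by (simp only: sym_kernel_reproducing[OF f w])
qed (rule sym_kernel_in_bergman_space)

lemma set_lebesgue_integral_cnj: "(LINT x:A|M. cnj (f x)) = cnj (LINT x:A|M. f x)"
proof -
  have "(\<integral>x. indicat_real A x *\<^sub>R cnj (f x) \<partial>M) = (\<integral>x. cnj (indicat_real A x *\<^sub>R f x) \<partial>M)"
    by (simp only: complex_cnj_scaleR)
  also have "\<dots> = cnj (\<integral>x. indicat_real A x *\<^sub>R f x \<partial>M)" by (rule Bochner_Integration.integral_cnj)
  finally show ?thesis unfolding set_lebesgue_integral_def .
qed

lemma reproducing_kernelD:
  assumes "reproducing_kernel \<Omega> K" "w \<in> \<Omega>"
  shows "(\<lambda>z. K z w) \<in> bergman_space \<Omega>" "f \<in> bergman_space \<Omega> \<Longrightarrow> (LINT z:\<Omega>|lebesgue. f z * cnj (K z w)) = f w"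
  using assms unfolding reproducing_kernel_def by simp_all

text \<open>Each kernel reproduces the other one under the integral. With \<open>K = L\<close> this
  is Hermitian symmetry, and combined with that symmetry it gives uniqueness.\<close>

lemma reproducing_kernel_cnj_unique:
  assumes K: "reproducing_kernel \<Omega> K" and L: "reproducing_kernel \<Omega> L" and zw: "z \<in> \<Omega>" "w \<in> \<Omega>"
  shows "K z w = cnj (L w z)"
proof -
  have "K z w = (LINT x:\<Omega>|lebesgue. K x w * cnj (L x z))"
    by (rule reproducing_kernelD(2)[OF L zw(1) reproducing_kernelD(1)[OF K zw(2)], symmetric])
  also have "\<dots> = (LINT x:\<Omega>|lebesgue. cnj (L x z * cnj (K x w)))"
    by (simp only: complex_cnj_mult complex_cnj_cnj mult.commute)
  also have "\<dots> = cnj (LINT x:\<Omega>|lebesgue. L x z * cnj (K x w))" by (rule set_lebesgue_integral_cnj)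
  also have "(LINT x:\<Omega>|lebesgue. L x z * cnj (K x w)) = L w z"
    by (rule reproducing_kernelD(2)[OF K zw(2) reproducing_kernelD(1)[OF L zw(1)]])
  finally show ?thesis .
qed

lemma bergman_kernel_eqI:
  assumes K: "reproducing_kernel \<Omega> K" "\<And>z w. (z, w) \<notin> \<Omega> \<times> \<Omega> \<Longrightarrow> K z w = 0"
  shows "bergman_kernel \<Omega> = K"
  unfolding bergman_kernel_def
proof (rule the_equality)
  show "reproducing_kernel \<Omega> K \<and> (\<forall>z w. (z, w) \<notin> \<Omega> \<times> \<Omega> \<longrightarrow> K z w = 0)" using K by blast
  fix L assume L: "reproducing_kernel \<Omega> L \<and> (\<forall>z w. (z, w) \<notin> \<Omega> \<times> \<Omega> \<longrightarrow> L z w = 0)"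
  show "L = K"
  proof (intro ext)
    fix z w
    show "L z w = K z w"
    proof (cases "(z, w) \<in> \<Omega> \<times> \<Omega>")
      case True
      then have zw: "z \<in> \<Omega>" "w \<in> \<Omega>" by auto
      have "L z w = cnj (K w z)" using L by (intro reproducing_kernel_cnj_unique[OF _ K(1) zw]) blast
      also have "\<dots> = K z w" by (rule reproducing_kernel_cnj_unique[OF K(1) K(1) zw, symmetric])
      finally show ?thesis .
    next
      case False
      then show ?thesis using L K(2) by simp
    qed
  qed
qed

lemma bergman_kernel_sym_polydisc: "bergman_kernel sym_polydisc = sym_kernel"
  by (rule bergman_kernel_eqI[OF reproducing_kernel_sym_kernel]) (auto simp: sym_kernel_def)

text \<open>Reproducing the kernel function by itself shows that the diagonal value is its squared
  norm. If this were zero, the kernel function would vanish almost everywhere and could not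
  reproduce the constant \<open>1\<close>.\<close>

lemma sym_kernel_diagonal:
  fixes \<zeta> :: "complex ^ 'n::{finite,wellorder}"
  assumes \<zeta>: "\<zeta> \<in> sym_polydisc"
  shows "Im (sym_kernel \<zeta> \<zeta>) = 0" "0 < Re (sym_kernel \<zeta> \<zeta>)"
proof -
  define k where "k \<xi> = sym_kernel \<xi> \<zeta>" for \<xi>
  have k: "k \<in> bergman_space sym_polydisc" unfolding k_def by (rule sym_kernel_in_bergman_space[OF \<zeta>])
  then have int: "integrable lborel (\<lambda>x. indicat_real sym_polydisc x * (norm (k x))\<^sup>2)"
    unfolding bergman_space_iff_lborel[OF open_sym_polydisc] by blast
  have eq: "indicator sym_polydisc \<xi> * (k \<xi> * cnj (sym_kernel \<xi> \<zeta>)) = complex_of_real (indicat_real sym_polydisc \<xi> * (norm (k \<xi>))\<^sup>2)" for \<xi>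
    using complex_norm_square[of "k \<xi>"] by (simp add: k_def indicator_def)
  have diag: "sym_kernel \<zeta> \<zeta> = complex_of_real (\<integral>x. indicat_real sym_polydisc x * (norm (k x))\<^sup>2 \<partial>lborel)"
    using sym_kernel_reproducing[OF k \<zeta>] unfolding eq integral_complex_of_real by (simp only: k_def)
  show "Im (sym_kernel \<zeta> \<zeta>) = 0" unfolding diag by simp
  have "0 \<le> (\<integral>x. indicat_real sym_polydisc x * (norm (k x))\<^sup>2 \<partial>lborel)" by (intro Bochner_Integration.integral_nonneg) simp
  moreover have "(\<integral>x. indicat_real sym_polydisc x * (norm (k x))\<^sup>2 \<partial>lborel) \<noteq> 0"
  proof
    assume "(\<integral>x. indicat_real sym_polydisc x * (norm (k x))\<^sup>2 \<partial>lborel) = 0"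
    then have "AE x in lborel. indicat_real sym_polydisc x * (norm (k x))\<^sup>2 = 0"
      using integral_nonneg_eq_0_iff_AE[OF int] by simp
    then have AE: "AE \<xi> in lborel. indicator sym_polydisc \<xi> * (1 * cnj (sym_kernel \<xi> \<zeta>)) = 0"
      by (rule AE_mp) (intro AE_I2 impI, simp add: k_def indicator_def split: if_splits)
    have one: "(\<lambda>_. 1) \<in> bergman_space (sym_polydisc :: (complex ^ 'n::_) set)"
      unfolding bergman_space_iff_lborel[OF open_sym_polydisc]
      by (intro conjI several_holomorphic_bipoly[OF bipoly.const])
        (simp only: norm_one power_one mult_1_right integrable_indicat_sym_polydisc)
    have "(\<integral>\<xi>. indicator sym_polydisc \<xi> * (1 * cnj (sym_kernel \<xi> \<zeta>)) \<partial>lborel) = 0"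
      using AE by (rule integral_eq_zero_AE)
    then show False using sym_kernel_reproducing[OF one \<zeta>] by simp
  qed
  ultimately show "0 < Re (sym_kernel \<zeta> \<zeta>)" unfolding diag Re_complex_of_real less_le by simp
qed

theorem theorem1p1:
  fixes D :: "complex set"
    and F :: "complex \<Rightarrow> complex ^ 'm"
    and G :: "complex \<Rightarrow> complex ^ 'n::{finite,wellorder}"
  assumes "open D" and "connected D" and "D \<noteq> {}"
    and "\<And>i. (\<lambda>z. F z $ i) holomorphic_on D"
    and "\<And>i. (\<lambda>z. G z $ i) holomorphic_on D"
    and "G ` D \<subseteq> sym_polydisc"
    and "\<And>z v w. z \<in> D \<Longrightarrow>
           pullback F euclidean_form z v w = pullback G (bergman_form sym_polydisc) z v w"
  shows "F constant_on D"
proof -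
  \<comment> \<open>The power of \<open>pi\<close> is put into the denominator, so that the kernel
    is exactly a quotient of two \<open>bipoly\<close> functions.\<close>
  let ?B = "\<lambda>\<xi> \<eta> :: complex ^ 'n::_. of_real pi ^ CARD('n) * kernel_den \<xi> \<eta>"
  let ?u = "\<lambda>\<xi> :: complex ^ 'n::_. ln (Re (bergman_kernel sym_polydisc \<xi> \<xi>))"
  have K: "sym_kernel q q = kernel_num q (cnjv q) / ?B q (cnjv q)" if "q \<in> sym_polydisc" for q :: "complex ^ 'n::_"
    using that by (simp add: sym_kernel_def)
  have crit: "deriv (\<lambda>z. F z $ i) z = 0" if z: "z \<in> D" for i z
  proof (rule euclidean_rational_pullback_critical[OF assms(1) z assms(4,5) open_sym_polydisc assms(6) bipoly_kernel(1)])
    show "bipoly ?B" by (intro bipoly.mult bipoly.const bipoly_kernel(2))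
    fix q :: "complex ^ 'n::_" assume q: "q \<in> sym_polydisc"
    show "kernel_num q (cnjv q) \<noteq> 0"
      using sym_kernel_diagonal(2)[OF q] unfolding K[OF q] by auto
    show "?B q (cnjv q) \<noteq> 0" using kernel_den_nonzero[OF q q] by simp
    show "Im (kernel_num q (cnjv q) / ?B q (cnjv q)) = 0" using sym_kernel_diagonal(1)[OF q] unfolding K[OF q] .
    show "0 < Re (kernel_num q (cnjv q) / ?B q (cnjv q))" using sym_kernel_diagonal(2)[OF q] unfolding K[OF q] .
    show "?u q = ln (Re (kernel_num q (cnjv q) / ?B q (cnjv q)))" unfolding bergman_kernel_sym_polydisc K[OF q] ..
  \<comment> \<open>The equality of forms is used on the tangent vectors \<open>1\<close> and
    \<open>\<i>\<close> only.\<close>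
  next
    fix z assume "z \<in> D"
    then show "pullback F euclidean_form z 1 \<i> = pullback G (i_ddbar ?u) z 1 \<i>"
      by (rule assms(7)[unfolded bergman_form_def])
  qed
  have const: "\<exists>c. \<forall>z\<in>D. F z $ i = c" for i
  proof (rule DERIV_zero_connected_constant[OF assms(2,1) finite.emptyI holomorphic_on_imp_continuous_on[OF assms(4)]])
    show "\<forall>x\<in>D - {}. DERIV (\<lambda>z. F z $ i) x :> 0"
      using holomorphic_derivI[OF assms(4) assms(1)] crit by (metis Diff_empty)
  qed blast
  obtain z0 where "z0 \<in> D" using assms(3) by blast
  then have "F z = F z0" if "z \<in> D" for z
    using const that by (metis vec_eq_iff)
  then show ?thesis unfolding constant_on_def by blast
qed

end
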